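(* Let $p\in(0,1)$ be fixed and let $m\geqslant 5$ be a fixed integer. Then with high probability $$ n+\frac{n}{4(m-1)\log_{\frac{1}{1-p}} n}(1-o(1))\leqslant\mathrm{sat}\left(G\left(n,p\right),C_m\right)\leqslant n + \frac{n}{2\log_{\frac{1}{1-p}} n}(1+o(1)). $$
   Context: $G(n,p)$ is the binomial random graph on vertex set $[n]=\{1,\dots,n\}$ in which each pair of vertices is adjacent independently with probability $p$. A property holds with high probability (whp) if its probability tends to $1$ as $n\to\infty$; the $o(1)$ terms denote functions of $n$ tending to $0$ as $n\to\infty$. $C_m$ is the cycle on $m$ vertices. For graphs $F$ and $G$, a spanning subgraph $H\subseteq G$ is $F$-saturated in $G$ if $H$ contains no copy of $F$ but adding to $H$ any edge of $G$ not in $H$ creates a copy of $F$; $\mathrm{sat}(G,F)$ is the minimum number of edges of an $F$-saturated graph in $G$. *)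

theory Defs
  imports "HOL-Probability.Probability"
begin

text \<open>Graphs on vertex set [n] = {1..n} are represented by their edge sets,
  edges being 2-element sets of vertices.\<close>

definition all_pairs :: "nat \<Rightarrow> nat set set" where
  "all_pairs n = {e. \<exists>i j. 1 \<le> i \<and> i < j \<and> j \<le> n \<and> e = {i, j}}"

definition gnp :: "nat \<Rightarrow> real \<Rightarrow> nat set set pmf" where
  "gnp n p = map_pmf (\<lambda>f. {e \<in> all_pairs n. f e})
                (Pi_pmf (all_pairs n) False (\<lambda>_. bernoulli_pmf p))"

definition has_cycle :: "nat \<Rightarrow> nat set set \<Rightarrow> bool" where
  "has_cycle m H \<longleftrightarrow> (\<exists>vs. length vs = m \<and> distinct vs \<and>
      (\<forall>i<m. {vs ! i, vs ! ((i + 1) mod m)} \<in> H))"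

definition cycle_saturated :: "nat \<Rightarrow> nat set set \<Rightarrow> nat set set \<Rightarrow> bool" where
  "cycle_saturated m G H \<longleftrightarrow> H \<subseteq> G \<and> \<not> has_cycle m H \<and>
      (\<forall>e \<in> G - H. has_cycle m (insert e H))"

definition sat_cycle :: "nat set set \<Rightarrow> nat \<Rightarrow> nat" where
  "sat_cycle G m = Min (card ` {H. cycle_saturated m G H})"

end

theory Submission
  imports Defs "HOL-Real_Asymp.Real_Asymp"
begin

text \<open>
  Let \<open>L\<close> be the logarithm of \<open>n\<close> to the base \<open>1 / (1 - p)\<close>.

  Lower bound. If \<open>H\<close> is saturated in \<open>G\<close>, every edge of \<open>G\<close> outside \<open>H\<close> joins two vertices connected in
  \<open>H\<close> by a path with \<open>m\<close> vertices, so all pairs not so connected are non-edges of \<open>G\<close>. There are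
  only \<open>n^(n + o(n))\<close> graphs with \<open>n + O(n / L)\<close> edges, so with high probability each of them that is
  saturated has at most \<open>(1 + o(1)) n L\<close> unconnected pairs. In particular some vertex \<open>r\<close> is
  connected to all but \<open>O(L)\<close> vertices, so a breadth-first tree from \<open>r\<close> has depth at most \<open>m - 1\<close> up
  to \<open>O(L)\<close> vertices. If \<open>H\<close> has \<open>n + k\<close> edges, the ancestors of the endpoints of the non-tree edges
  form a set \<open>A\<close> of about \<open>2 k (m - 1)\<close> vertices, and the rest of \<open>H\<close> consists of trees hanging off
  \<open>A\<close>. Nearly all vertices have height below \<open>(m - 1) / 2\<close> in these trees, and two of them in the same
  tree are unconnected. By convexity there are at least about \<open>n^2 / (4 k (m - 1))\<close> unconnected
  pairs, whence \<open>k \<ge> (1 - o(1)) n / (4 (m - 1) L)\<close>.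

  Upper bound. Take a clique on \<open>m - 2\<close> vertices, join about \<open>n / (2 L)\<close> further vertices, the centres, to
  the same two vertices of the clique, and attach all other vertices as leaves to the centres so that
  the leaves of each centre are independent in \<open>G\<close>. This graph is saturated and has
  \<open>n + (1 + o(1)) n / (2 L)\<close> edges. It exists because with high probability every set of order
  \<open>n / L\<close> contains an independent set of size \<open>(2 - o(1)) L\<close>, by the second moment method and the
  bounded difference inequality, so almost all leaves can be distributed greedily; the few remaining
  ones receive a centre each.
\<close>

section \<open>Random subsets and bounded differences\<close>

text \<open>The pairs unjoined in \<open>H\<close> depend on \<open>H\<close> alone, so a union
  bound over \<open>H\<close> needs no conditioning on \<open>G\<close>. A fixed set of F pairs
  avoids \<open>G\<close> with probability (1 - p)^F = n^(-F/L), which outweighs the n^n choices of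
  \<open>H\<close> once F exceeds n L by a constant factor. In ordered pairs this threshold is 2 n
  L, and convexity gives n^2 / |A| ordered unjoined pairs, so |A| is at least about n / (2 L). A
  non-tree edge has two ends, each with at most m - 1 ancestors of depth 1 to m - 1, so |A| is about
  2 k (m - 1); hence the 4 (m - 1) of the theorem. The obstacle is formed by the vertices of height
  at least (m - 1) / 2: two of them in one tree may well be joined. Parity of heights and the
  rigidity of siblings show that they are few. In the upper bound, 2 L is the order of the largest
  independent sets of \<open>G\<close>, whence n / (2 L) centres. A centre has two edges to the hubs
  where a leaf has one, so each centre costs one edge above n. The error is a fixed constant until
  the very end, where it is made to tend to 0 with n.\<close>

definition random_subset :: "'a set \<Rightarrow> real \<Rightarrow> 'a set pmf" where
  "random_subset E p = map_pmf (\<lambda>f. {e \<in> E. f e}) (Pi_pmf E False (\<lambda>_. bernoulli_pmf p))"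

text \<open>The ground set of \<open>random_subset\<close> is arbitrary so that proofs can go by
  induction on it, and so that \<open>independent_set_random\<close> can draw random vertices
  instead of edges.\<close>

lemma gnp_eq_random_subset: "gnp n p = random_subset (all_pairs n) p"
  by (simp add: gnp_def random_subset_def)

lemma random_subset_empty: "random_subset {} p = return_pmf {}"
  by (simp add: random_subset_def)

lemma random_subset_insert:
  assumes "finite E" "e \<notin> E"
  shows "random_subset (insert e E) p =
    bernoulli_pmf p \<bind> (\<lambda>b. map_pmf (\<lambda>S. if b then insert e S else S) (random_subset E p))"
proof -
  have "random_subset (insert e E) p = map_pmf (\<lambda>(b, f). {x \<in> insert e E. (f(e := b)) x})
          (pair_pmf (bernoulli_pmf p) (Pi_pmf E False (\<lambda>_. bernoulli_pmf p)))"
    unfolding random_subset_def using assms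
    by (subst Pi_pmf_insert) (auto simp: pmf.map_comp o_def case_prod_unfold)
  also have "\<dots> = map_pmf (\<lambda>(b, f). if b then insert e {x \<in> E. f x} else {x \<in> E. f x})
          (pair_pmf (bernoulli_pmf p) (Pi_pmf E False (\<lambda>_. bernoulli_pmf p)))"
    using assms by (intro map_pmf_cong) (auto split: if_splits)
  also have "\<dots> = bernoulli_pmf p \<bind> (\<lambda>b. map_pmf (\<lambda>S. if b then insert e S else S) (random_subset E p))"
    by (simp add: random_subset_def pair_pmf_def map_pmf_def bind_assoc_pmf bind_return_pmf)
  finally show ?thesis .
qed

lemma set_pmf_random_subset_subset: "set_pmf (random_subset E p) \<subseteq> Pow E"
  by (auto simp: random_subset_def)

lemma finite_set_pmf_random_subset: "finite E \<Longrightarrow> finite (set_pmf (random_subset E p))"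
  by (rule finite_subset[OF set_pmf_random_subset_subset]) simp

lemma integrable_random_subset [simp]:
  "finite E \<Longrightarrow> integrable (measure_pmf (random_subset E p)) (f :: _ \<Rightarrow> real)"
  by (intro integrable_measure_pmf_finite finite_set_pmf_random_subset)

abbreviation expec :: "'a set \<Rightarrow> real \<Rightarrow> ('a set \<Rightarrow> real) \<Rightarrow> real" where
  "expec E p f \<equiv> measure_pmf.expectation (random_subset E p) f"

lemma expec_insert:
  assumes "finite E" "e \<notin> E" "0 \<le> p" "p \<le> 1"
  shows "expec (insert e E) p f = p * expec E p (\<lambda>S. f (insert e S)) + (1 - p) * expec E p f"
proof -
  have "expec (insert e E) p f = (\<Sum>b\<in>UNIV. pmf (bernoulli_pmf p) b *\<^sub>R
     measure_pmf.expectation (map_pmf (\<lambda>S. if b then insert e S else S) (random_subset E p)) f)"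
    unfolding random_subset_insert[OF assms(1,2)]
    by (rule pmf_expectation_bind) (auto intro: finite_set_pmf_random_subset assms)
  then show ?thesis
    using assms by (simp add: UNIV_bool)
qed

lemma expec_mono:
  assumes "finite E" "\<And>S. S \<subseteq> E \<Longrightarrow> f S \<le> g S"
  shows "expec E p f \<le> expec E p g"
  using assms set_pmf_random_subset_subset[of E p]
  by (intro integral_mono_AE) (auto simp: AE_measure_pmf_iff)

lemma expec_cong:
  assumes "\<And>S. S \<subseteq> E \<Longrightarrow> f S = g S"
  shows "expec E p f = expec E p g"
  using assms set_pmf_random_subset_subset[of E p]
  by (intro integral_cong_AE) (auto simp: AE_measure_pmf_iff)

lemma prob_random_subset_eq_expec: "measure_pmf.prob (random_subset E p) A = expec E p (indicator A)"
  by simp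

lemma prob_random_subset_subset:
  assumes "finite E" "F \<subseteq> E" "0 \<le> p" "p \<le> 1"
  shows "measure_pmf.prob (random_subset E p) {S. F \<subseteq> S} = p ^ card F"
  using assms
proof (induction E arbitrary: F rule: finite_induct)
  case empty
  then show ?case by (simp add: random_subset_empty)
next
  case (insert e E)
  show ?case
  proof (cases "e \<in> F")
    case True
    have 1: "expec E p (\<lambda>S. indicator {S. F \<subseteq> S} (insert e S)) = expec E p (indicator {S. F - {e} \<subseteq> S})"
      by (rule expec_cong) (auto simp: indicator_def)
    have 2: "expec E p (indicator {S. F \<subseteq> S}) = expec E p (\<lambda>_. 0)"
      by (rule expec_cong) (use True insert.hyps in \<open>auto simp: indicator_def\<close>)
    have "card F = Suc (card (F - {e}))"
      using True insert.prems insert.hyps by (metis card.remove finite_insert finite_subset)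
    moreover have "measure_pmf.prob (random_subset E p) {S. F - {e} \<subseteq> S} = p ^ card (F - {e})"
      using insert.prems by (intro insert.IH) auto
    ultimately show ?thesis
      unfolding prob_random_subset_eq_expec expec_insert[OF insert.hyps insert.prems(2,3)] 1 2 by simp
  next
    case False
    have 1: "expec E p (\<lambda>S. indicator {S. F \<subseteq> S} (insert e S)) = expec E p (indicator {S. F \<subseteq> S})"
      by (rule expec_cong) (use False in \<open>auto simp: indicator_def\<close>)
    have "measure_pmf.prob (random_subset E p) {S. F \<subseteq> S} = p ^ card F"
      using insert.prems False by (intro insert.IH) auto
    then show ?thesis
      unfolding prob_random_subset_eq_expec expec_insert[OF insert.hyps insert.prems(2,3)] 1
      by (simp add: algebra_simps)
  qed
qed

lemma prob_random_subset_disjoint: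
  assumes "finite E" "F \<subseteq> E" "0 \<le> p" "p \<le> 1"
  shows "measure_pmf.prob (random_subset E p) {S. S \<inter> F = {}} = (1 - p) ^ card F"
  using assms
proof (induction E arbitrary: F rule: finite_induct)
  case empty
  then show ?case by (simp add: random_subset_empty)
next
  case (insert e E)
  show ?case
  proof (cases "e \<in> F")
    case True
    have 1: "expec E p (indicator {S. S \<inter> F = {}}) = expec E p (indicator {S. S \<inter> (F - {e}) = {}})"
      by (rule expec_cong) (use insert.hyps in \<open>auto simp: indicator_def\<close>)
    have 2: "expec E p (\<lambda>S. indicator {S. S \<inter> F = {}} (insert e S)) = expec E p (\<lambda>_. 0)"
      by (rule expec_cong) (use True insert.hyps in \<open>auto simp: indicator_def\<close>)
    have "card F = Suc (card (F - {e}))"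
      using True insert.prems insert.hyps by (metis card.remove finite_insert finite_subset)
    moreover have "measure_pmf.prob (random_subset E p) {S. S \<inter> (F - {e}) = {}} = (1 - p) ^ card (F - {e})"
      using insert.prems by (intro insert.IH) auto
    ultimately show ?thesis
      unfolding prob_random_subset_eq_expec expec_insert[OF insert.hyps insert.prems(2,3)] 1 2 by simp
  next
    case False
    have 1: "expec E p (\<lambda>S. indicator {S. S \<inter> F = {}} (insert e S)) = expec E p (indicator {S. S \<inter> F = {}})"
      by (rule expec_cong) (use False in \<open>auto simp: indicator_def\<close>)
    have "measure_pmf.prob (random_subset E p) {S. S \<inter> F = {}} = (1 - p) ^ card F"
      using insert.prems False by (intro insert.IH) auto
    then show ?thesis
      unfolding prob_random_subset_eq_expec expec_insert[OF insert.hyps insert.prems(2,3)] 1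
      by (simp add: algebra_simps)
  qed
qed

text \<open>Hoeffding's lemma for a variable with two values. The library inequality takes a
  nonnegative difference of exponents, so the two values are exchanged, with \<open>1 - p\<close>
  for \<open>p\<close>, when the sign is wrong.\<close>

lemma two_point_Hoeffding:
  fixes p u v l :: real
  assumes "0 \<le> p" "p \<le> 1"
  shows "p * exp (l * u) + (1 - p) * exp (l * v)
    \<le> exp (l * (p * u + (1 - p) * v) + l\<^sup>2 * (u - v)\<^sup>2 / 8)"
proof -
  have base: "q * exp (h + z) + (1 - q) * exp z \<le> exp (z + q * h + h\<^sup>2 / 8)"
    if "0 \<le> q" "q \<le> 1" "0 \<le> h" for q h z :: real
  proof -
    have pos: "1 + q * (exp h - 1) > 0"
      using that by (smt (verit) exp_ge_zero mult_nonneg_nonneg one_le_exp_iff)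
    have "- h * q + ln (1 + q * (exp h - 1)) \<le> h\<^sup>2 / 8"
      using Hoeffdings_lemma_aux[of h q] that by simp
    then have "ln (1 + q * (exp h - 1)) \<le> q * h + h\<^sup>2 / 8" by (simp add: algebra_simps)
    then have "1 + q * (exp h - 1) \<le> exp (q * h + h\<^sup>2 / 8)"
      using pos by (metis exp_le_cancel_iff exp_ln)
    then have "exp z * (1 + q * (exp h - 1)) \<le> exp z * exp (q * h + h\<^sup>2 / 8)"
      by (intro mult_left_mono) auto
    then show ?thesis by (simp add: algebra_simps exp_add)
  qed
  show ?thesis
  proof (cases "l * v \<le> l * u")
    case True
    then show ?thesis using base[of p "l * u - l * v" "l * v"] assms
      by (simp add: algebra_simps power2_eq_square)
  next
    case False
    then show ?thesis using base[of "1 - p" "l * v - l * u" "l * u"] assms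
      by (simp add: algebra_simps power2_eq_square)
  qed
qed

text \<open>Elements are revealed one at a time. Given the outcome of \<open>e\<close>, the
  induction hypothesis bounds both branches; their means differ by at most the influence of
  \<open>e\<close>, so \<open>two_point_Hoeffding\<close> merges them. Elements outside
  \<open>E0\<close> have no influence and add nothing to the variance term.\<close>

lemma expec_exp_le_of_Lipschitz:
  assumes "finite E" "0 \<le> p" "p \<le> 1"
    and "\<And>e S. e \<in> E \<Longrightarrow> S \<subseteq> E \<Longrightarrow> e \<notin> S \<Longrightarrow>
           \<bar>f (insert e S) - f S\<bar> \<le> (if e \<in> E0 then 1 else (0::real))"
  shows "expec E p (\<lambda>S. exp (l * f S)) \<le> exp (l * expec E p f + l\<^sup>2 * real (card (E \<inter> E0)) / 8)"
  using assms
proof (induction E arbitrary: f rule: finite_induct)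
  case empty
  then show ?case by (simp add: random_subset_empty)
next
  case (insert e E)
  define u where "u = expec E p (\<lambda>S. f (insert e S))"
  define v where "v = expec E p f"
  define c :: real where "c = (if e \<in> E0 then 1 else 0)"
  define k where "k = real (card (E \<inter> E0))"
  have card: "real (card (insert e E \<inter> E0)) = k + c\<^sup>2"
    using insert.hyps by (auto simp: k_def c_def Int_insert_left)
  have 1: "expec E p (\<lambda>S. exp (l * f (insert e S))) \<le> exp (l * u + l\<^sup>2 * k / 8)"
    unfolding u_def k_def
  proof (rule insert.IH)
    fix e' S assume *: "e' \<in> E" "S \<subseteq> E" "e' \<notin> S"
    have "e' \<notin> insert e S" "insert e S \<subseteq> insert e E" using * insert.hyps by auto
    then show "\<bar>f (insert e (insert e' S)) - f (insert e S)\<bar> \<le> (if e' \<in> E0 then 1 else 0)"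
      using insert.prems(3)[of e' "insert e S"] * by (auto simp: insert_commute)
  qed (use insert.prems in auto)
  have 2: "expec E p (\<lambda>S. exp (l * f S)) \<le> exp (l * v + l\<^sup>2 * k / 8)"
    unfolding v_def k_def
  proof (rule insert.IH)
    fix e' S assume "e' \<in> E" "S \<subseteq> E" "e' \<notin> S"
    then show "\<bar>f (insert e' S) - f S\<bar> \<le> (if e' \<in> E0 then 1 else 0)"
      by (intro insert.prems(3)) auto
  qed (use insert.prems in auto)
  have bd: "\<bar>f (insert e S) - f S\<bar> \<le> c" if "S \<subseteq> E" for S
    unfolding c_def using that insert.hyps by (intro insert.prems(3)) auto
  have "u \<le> expec E p (\<lambda>S. f S + c)"
    unfolding u_def by (rule expec_mono) (use insert.hyps bd in \<open>auto simp: abs_le_iff diff_le_eq add.commute\<close>)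
  also have "\<dots> = v + c" using insert.hyps by (simp add: v_def)
  finally have u1: "u - v \<le> c" by simp
  have "v \<le> expec E p (\<lambda>S. f (insert e S) + c)"
    unfolding v_def
  proof (rule expec_mono)
    fix S assume "S \<subseteq> E" then show "f S \<le> f (insert e S) + c" using bd[of S] by linarith
  qed (use insert.hyps in auto)
  also have "\<dots> = u + c" using insert.hyps by (simp add: u_def)
  finally have u2: "v - u \<le> c" by simp
  have uv: "(u - v)\<^sup>2 \<le> c\<^sup>2" using u1 u2 by (intro abs_le_square_iff[THEN iffD1]) auto
  have "expec (insert e E) p (\<lambda>S. exp (l * f S))
     = p * expec E p (\<lambda>S. exp (l * f (insert e S))) + (1 - p) * expec E p (\<lambda>S. exp (l * f S))"
    using insert by (intro expec_insert) auto
  also have "\<dots> \<le> p * exp (l * u + l\<^sup>2 * k / 8) + (1 - p) * exp (l * v + l\<^sup>2 * k / 8)"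
    using 1 2 insert.prems by (intro add_mono mult_left_mono) auto
  also have "\<dots> = (p * exp (l * u) + (1 - p) * exp (l * v)) * exp (l\<^sup>2 * k / 8)"
    by (simp add: exp_add algebra_simps)
  also have "\<dots> \<le> exp (l * (p * u + (1 - p) * v) + l\<^sup>2 * (u - v)\<^sup>2 / 8) * exp (l\<^sup>2 * k / 8)"
    using insert.prems by (intro mult_right_mono two_point_Hoeffding) auto
  also have "\<dots> \<le> exp (l * (p * u + (1 - p) * v) + l\<^sup>2 * c\<^sup>2 / 8) * exp (l\<^sup>2 * k / 8)"
    using uv by (intro mult_right_mono) (auto intro!: mult_left_mono)
  also have "\<dots> = exp (l * expec (insert e E) p f + l\<^sup>2 * real (card (insert e E \<inter> E0)) / 8)"
    unfolding card expec_insert[OF insert.hyps insert.prems(1,2)] u_def v_def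
    by (simp add: exp_add[symmetric] algebra_simps add_divide_distrib)
  finally show ?case .
qed

lemma bounded_difference_lower_tail:
  assumes "finite E" "0 \<le> p" "p \<le> 1" "E0 \<subseteq> E" "0 < M" "real (card E0) \<le> M" "0 \<le> t"
    and lip: "\<And>e S. e \<in> E \<Longrightarrow> S \<subseteq> E \<Longrightarrow> e \<notin> S \<Longrightarrow>
           \<bar>f (insert e S) - f S\<bar> \<le> (if e \<in> E0 then 1 else (0::real))"
  shows "measure_pmf.prob (random_subset E p) {S. f S \<le> expec E p f - t} \<le> exp (- 2 * t\<^sup>2 / M)"
proof -
  define \<mu> where "\<mu> = expec E p f"
  \<comment> \<open>This value minimises \<open>l * t + l\<^sup>2 * M / 8\<close>.\<close>
  define l where "l = - 4 * t / M"
  have l: "l \<le> 0" using assms by (simp add: l_def)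
  have "measure_pmf.prob (random_subset E p) {S. f S \<le> \<mu> - t} = expec E p (indicator {S. f S \<le> \<mu> - t})"
    by simp
  also have "\<dots> \<le> expec E p (\<lambda>S. exp (l * f S) * exp (- l * (\<mu> - t)))"
  proof (rule expec_mono)
    fix S
    have "1 \<le> exp (l * f S) * exp (- l * (\<mu> - t))" if "f S \<le> \<mu> - t"
    proof -
      have "l * (\<mu> - t) \<le> l * f S" using l that by (intro mult_left_mono_neg)
      then show ?thesis by (simp add: exp_add[symmetric] algebra_simps)
    qed
    then show "indicator {S. f S \<le> \<mu> - t} S \<le> exp (l * f S) * exp (- l * (\<mu> - t))"
      by (auto simp: indicator_def)
  qed (use assms in auto)
  also have "\<dots> = expec E p (\<lambda>S. exp (l * f S)) * exp (- l * (\<mu> - t))" by simp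
  also have "\<dots> \<le> exp (l * \<mu> + l\<^sup>2 * real (card (E \<inter> E0)) / 8) * exp (- l * (\<mu> - t))"
    unfolding \<mu>_def using assms by (intro mult_right_mono expec_exp_le_of_Lipschitz) auto
  also have "\<dots> = exp (l * t + l\<^sup>2 * real (card (E \<inter> E0)) / 8)"
    by (simp add: exp_add[symmetric] algebra_simps)
  also have "\<dots> \<le> exp (l * t + l\<^sup>2 * M / 8)"
    using assms by (auto intro!: mult_left_mono divide_right_mono simp: Int_absorb1)
  also have "l * t + l\<^sup>2 * M / 8 = - 2 * t\<^sup>2 / M"
    using assms by (simp add: l_def field_simps power2_eq_square)
  finally show ?thesis by (simp add: \<mu>_def)
qed

text \<open>The deletion method: keep each vertex with probability \<open>q\<close>, then delete one
  end of every edge that survives. The number of vertices kept minus the number of surviving edges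
  reaches its mean for some choice.\<close>

lemma independent_set_random:
  fixes V :: "'a set" and R :: "'a set set"
  assumes "finite V" "\<And>e. e \<in> R \<Longrightarrow> e \<subseteq> V \<and> card e = 2" "0 \<le> q" "q \<le> 1"
  shows "\<exists>I \<subseteq> V. (\<forall>e\<in>R. \<not> e \<subseteq> I) \<and> real (card I) \<ge> q * real (card V) - q\<^sup>2 * real (card R)"
proof -
  have finR: "finite R" using assms by (intro finite_subset[of R "Pow V"]) auto
  define \<phi> where "\<phi> = (\<lambda>S. (\<Sum>v\<in>V. indicator {S. {v} \<subseteq> S} S) - (\<Sum>e\<in>R. indicator {S. e \<subseteq> S} S :: real))"
  have "expec V q \<phi> = (\<Sum>v\<in>V. expec V q (indicator {S. {v} \<subseteq> S})) - (\<Sum>e\<in>R. expec V q (indicator {S. e \<subseteq> S}))"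
    unfolding \<phi>_def using assms by (subst Bochner_Integration.integral_diff) auto
  also have "\<dots> = (\<Sum>v\<in>V. q ^ card {v}) - (\<Sum>e\<in>R. q ^ card e)"
    unfolding prob_random_subset_eq_expec[symmetric] using assms
    by (intro arg_cong2[of _ _ _ _ "(-)"] sum.cong refl prob_random_subset_subset) auto
  also have "\<dots> = q * real (card V) - q\<^sup>2 * real (card R)"
    using assms by (simp add: mult.commute)
  finally have E: "expec V q \<phi> = q * real (card V) - q\<^sup>2 * real (card R)" .
  have "\<exists>S\<subseteq>V. \<phi> S \<ge> expec V q \<phi>"
  proof (rule ccontr)
    assume "\<not> ?thesis"
    then have lt: "\<phi> S < expec V q \<phi>" if "S \<subseteq> V" for S using that by (meson not_le)
    define m where "m = Max (\<phi> ` Pow V)"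
    have "m \<in> \<phi> ` Pow V" unfolding m_def using assms by (intro Max_in) auto
    then have "m < expec V q \<phi>" using lt by auto
    moreover have "expec V q \<phi> \<le> expec V q (\<lambda>_. m)"
      using assms by (intro expec_mono) (auto simp: m_def intro!: Max_ge)
    ultimately show False by simp
  qed
  then obtain S where S: "S \<subseteq> V" "\<phi> S \<ge> expec V q \<phi>" by blast
  have finS: "finite S" using S assms finite_subset by blast
  define B where "B = {e\<in>R. e \<subseteq> S}"
  have finB: "finite B" using finR by (simp add: B_def)
  have "\<forall>e\<in>B. \<exists>v. v \<in> e" using assms by (fastforce simp: B_def card_2_iff)
  then obtain w where w: "\<And>e. e \<in> B \<Longrightarrow> w e \<in> e" by metis
  define I where "I = S - w ` B"
  have "\<phi> S = real (card S) - real (card B)"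
  proof -
    have "(\<Sum>v\<in>V. indicator {S. {v} \<subseteq> S} S :: real) = real (card S)"
    proof -
      have "(\<Sum>v\<in>V. indicator {S. {v} \<subseteq> S} S :: real) = (\<Sum>v\<in>V. indicator S v)"
        by (intro sum.cong) (auto simp: indicator_def)
      also have "\<dots> = real (card (V \<inter> S))" using assms by (simp add: indicator_def sum.If_cases)
      finally show ?thesis using S by (simp add: Int_absorb1)
    qed
    moreover have "(\<Sum>e\<in>R. indicator {S. e \<subseteq> S} S :: real) = real (card B)"
    proof -
      have "(\<Sum>e\<in>R. indicator {S. e \<subseteq> S} S :: real) = (\<Sum>e\<in>R. indicator B e)"
        by (intro sum.cong) (auto simp: indicator_def B_def)
      also have "\<dots> = real (card (R \<inter> B))" using finR by (simp add: indicator_def sum.If_cases)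
      finally show ?thesis by (simp add: B_def Int_absorb1 Collect_conj_eq)
    qed
    ultimately show ?thesis by (simp add: \<phi>_def)
  qed
  moreover have "real (card I) \<ge> real (card S) - real (card B)"
  proof -
    have "card S \<le> card (I \<union> w ` B)"
      using finS finB by (intro card_mono) (auto simp: I_def)
    also have "\<dots> \<le> card I + card (w ` B)" by (rule card_Un_le)
    also have "card (w ` B) \<le> card B" using finB by (rule card_image_le)
    finally show ?thesis by linarith
  qed
  moreover have "\<not> e \<subseteq> I" if "e \<in> R" for e
  proof
    assume "e \<subseteq> I"
    then have "e \<in> B" using that by (auto simp: I_def B_def)
    then show False using w[of e] \<open>e \<subseteq> I\<close> by (auto simp: I_def)
  qed
  moreover have "I \<subseteq> V" using S by (auto simp: I_def)
  ultimately show ?thesis using S E by (intro exI[of _ I]) auto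
qed

section \<open>Paths in graphs with pendant trees\<close>

text \<open>\<open>m\<close> counts vertices, so that the edge \<open>{u, v}\<close> closes such a
  path to a cycle of length \<open>m\<close>.\<close>

definition hpath :: "nat \<Rightarrow> 'a set set \<Rightarrow> 'a \<Rightarrow> 'a \<Rightarrow> bool" where
  "hpath m H u v \<longleftrightarrow> (\<exists>vs. length vs = m \<and> distinct vs \<and>
     (\<forall>i. Suc i < m \<longrightarrow> {vs ! i, vs ! Suc i} \<in> H) \<and> vs ! 0 = u \<and> vs ! (m - 1) = v)"

lemma hpath_sym: "hpath m H u v \<Longrightarrow> hpath m H v u"
proof -
  assume "hpath m H u v"
  then obtain vs where vs: "length vs = m" "distinct vs"
    "\<forall>i. Suc i < m \<longrightarrow> {vs ! i, vs ! Suc i} \<in> H" "vs ! 0 = u" "vs ! (m - 1) = v"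
    unfolding hpath_def by blast
  show ?thesis
  proof (cases "m = 0")
    case True
    then show ?thesis using vs by (auto simp: hpath_def)
  next
    case False
    have "{rev vs ! i, rev vs ! Suc i} \<in> H" if "Suc i < m" for i
    proof -
      have "{vs ! (m - Suc (Suc i)), vs ! Suc (m - Suc (Suc i))} \<in> H"
        using vs(3) that by auto
      moreover have "Suc (m - Suc (Suc i)) = m - Suc i" using that by simp
      ultimately show ?thesis using that vs(1) by (simp add: rev_nth insert_commute)
    qed
    then show ?thesis unfolding hpath_def using vs False
      by (intro exI[of _ "rev vs"]) (auto simp: rev_nth)
  qed
qed

text \<open>
  The complement of \<open>A\<close> in \<open>V'\<close> is a union of trees hanging off \<open>A\<close>: \<open>par\<close> is the parent, \<open>h v\<close>
  is the height of \<open>v\<close> above \<open>A\<close> and \<open>tp v\<close> is the vertex of \<open>A\<close> from which its tree hangs.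
\<close>

locale pendant =
  fixes H :: "'a set set" and V' A :: "'a set" and par tp :: "'a \<Rightarrow> 'a" and h :: "'a \<Rightarrow> nat"
  assumes nbr: "\<And>v w. v \<in> V' \<Longrightarrow> v \<notin> A \<Longrightarrow> {v, w} \<in> H \<Longrightarrow>
                  w = par v \<or> (w \<in> V' \<and> w \<notin> A \<and> par w = v)"
    and par_in: "\<And>v. v \<in> V' \<Longrightarrow> v \<notin> A \<Longrightarrow> par v \<in> V'"
    and par_edge: "\<And>v. v \<in> V' \<Longrightarrow> v \<notin> A \<Longrightarrow> {v, par v} \<in> H"
    and A_sub: "A \<subseteq> V'"
    and hA: "\<And>v. v \<in> A \<Longrightarrow> h v = 0"
    and tpA: "\<And>v. v \<in> A \<Longrightarrow> tp v = v"
    and hU: "\<And>v. v \<in> V' \<Longrightarrow> v \<notin> A \<Longrightarrow> h v = Suc (h (par v))"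
    and tpU: "\<And>v. v \<in> V' \<Longrightarrow> v \<notin> A \<Longrightarrow> tp v = tp (par v)"
    and tp_in: "\<And>v. v \<in> V' \<Longrightarrow> tp v \<in> A"
begin

lemma h_eq_0_iff: "v \<in> V' \<Longrightarrow> h v = 0 \<longleftrightarrow> v \<in> A"
  using hA hU by (metis Zero_not_Suc)

context
  fixes vs :: "'a list" and m :: nat
  assumes len: "length vs = m" and dist: "distinct vs" and "0 < m"
    and walk: "\<And>i. Suc i < m \<Longrightarrow> {vs ! i, vs ! Suc i} \<in> H"
    and start: "vs ! 0 \<in> V'"
begin

definition down where "down i \<longleftrightarrow> vs ! Suc i \<in> V' \<and> vs ! Suc i \<notin> A \<and> par (vs ! Suc i) = vs ! i"

text \<open>After a step down, the parent of the current vertex has just been visited, so the next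
  vertex of the path can only be a child: a path that has turned never climbs again.\<close>

lemma down_from: "down i \<Longrightarrow> i \<le> j \<Longrightarrow> Suc j < m \<Longrightarrow> down j"
proof (induction j)
  case (Suc j)
  show ?case
  proof (cases "i = Suc j")
    case False
    then have "down j" using Suc by auto
    then have v: "vs ! Suc j \<in> V'" "vs ! Suc j \<notin> A" "par (vs ! Suc j) = vs ! j"
      by (auto simp: down_def)
    have "vs ! Suc (Suc j) \<noteq> vs ! j"
      using dist len Suc.prems by (simp add: nth_eq_iff_index_eq)
    then show ?thesis using nbr[OF v(1,2) walk[of "Suc j"]] Suc.prems v(3) by (auto simp: down_def)
  qed (use Suc in auto)
qed auto

lemma down_height:
  assumes "down i" "i \<le> j" "j < m"
  shows "h (vs ! j) = h (vs ! i) + (j - i) \<and> tp (vs ! j) = tp (vs ! i)"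
  using assms(2,3)
proof (induction j rule: dec_induct)
  case (step j)
  then have "down j" using down_from[OF assms(1), of j] by auto
  then have "h (vs ! Suc j) = Suc (h (vs ! j))" "tp (vs ! Suc j) = tp (vs ! j)"
    using hU tpU by (metis down_def)+
  then show ?case using step by auto
qed auto

text \<open>Outside \<open>A\<close> the only neighbour that is not a child is the parent, so before
  its first step down the path climbs one level at a time until it meets \<open>A\<close>.\<close>

lemma up_height:
  assumes "\<And>j. j < k \<Longrightarrow> \<not> down j" "k < m" "k \<le> h (vs ! 0)"
  shows "h (vs ! k) = h (vs ! 0) - k \<and> tp (vs ! k) = tp (vs ! 0) \<and> vs ! k \<in> V' \<and>
    (0 < k \<longrightarrow> vs ! 1 = par (vs ! 0))"
  using assms
proof (induction k)
  case (Suc k)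
  then have IH: "h (vs ! k) = h (vs ! 0) - k" "tp (vs ! k) = tp (vs ! 0)" "vs ! k \<in> V'"
    "0 < k \<longrightarrow> vs ! 1 = par (vs ! 0)" by auto
  then have "h (vs ! k) \<noteq> 0" using Suc.prems by auto
  then have nA: "vs ! k \<notin> A" using hA by auto
  have "\<not> down k" using Suc.prems by auto
  then have up: "vs ! Suc k = par (vs ! k)"
    using nbr[OF IH(3) nA walk[of k]] Suc.prems by (auto simp: down_def)
  have "h (vs ! k) = Suc (h (vs ! Suc k))" "tp (vs ! Suc k) = tp (vs ! k)" "vs ! Suc k \<in> V'"
    unfolding up using hU tpU par_in IH(3) nA by auto
  then show ?case using IH up by (cases "k = 0") auto
qed (use start in auto)

text \<open>Either the path climbs until it meets \<open>A\<close> or ends, or it turns down after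
  \<open>i\<close> steps, before reaching \<open>A\<close>, and stays in the same tree to its end.
  The clause about \<open>vs ! 1\<close> serves \<open>not_hpath_siblings\<close>.\<close>

lemma up_or_turn:
  "(\<forall>k. k < m \<and> k \<le> h (vs ! 0) \<longrightarrow> h (vs ! k) = h (vs ! 0) - k \<and> tp (vs ! k) = tp (vs ! 0) \<and>
       vs ! k \<in> V' \<and> (0 < k \<longrightarrow> vs ! 1 = par (vs ! 0))) \<or>
   (\<exists>i. i < h (vs ! 0) \<and> Suc i < m \<and> h (vs ! (m - 1)) = h (vs ! 0) - i + (m - 1 - i) \<and>
       tp (vs ! (m - 1)) = tp (vs ! 0) \<and> (0 < i \<longrightarrow> vs ! 1 = par (vs ! 0)))"
proof (cases "\<exists>i. i < h (vs ! 0) \<and> Suc i < m \<and> down i")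
  case True
  define i where "i = (LEAST i. i < h (vs ! 0) \<and> Suc i < m \<and> down i)"
  have i: "i < h (vs ! 0)" "Suc i < m" "down i"
    using LeastI_ex[OF True] unfolding i_def by auto
  have nd: "\<not> down j" if "j < i" for j
    using not_less_Least[of j "\<lambda>i. i < h (vs ! 0) \<and> Suc i < m \<and> down i"] that i
    unfolding i_def[symmetric] by auto
  have "h (vs ! i) = h (vs ! 0) - i \<and> tp (vs ! i) = tp (vs ! 0) \<and> vs ! i \<in> V' \<and>
    (0 < i \<longrightarrow> vs ! 1 = par (vs ! 0))"
    by (rule up_height) (use i nd in auto)
  moreover have "h (vs ! (m - 1)) = h (vs ! i) + (m - 1 - i) \<and> tp (vs ! (m - 1)) = tp (vs ! i)"
    by (rule down_height) (use i in auto)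
  ultimately show ?thesis using i by (intro disjI2 exI[of _ i]) auto
next
  case False
  have "h (vs ! k) = h (vs ! 0) - k \<and> tp (vs ! k) = tp (vs ! 0) \<and> vs ! k \<in> V' \<and>
    (0 < k \<longrightarrow> vs ! 1 = par (vs ! 0))" if "k < m" "k \<le> h (vs ! 0)" for k
    by (rule up_height) (use that False in auto)
  then show ?thesis by blast
qed

end

text \<open>\<open>up_or_turn\<close> for the path and for its reverse, expressed along one and the
  same list so that the two descriptions can be compared by index.\<close>

lemma hpath_profile:
  assumes "hpath m H u v" "0 < m" "u \<in> V'" "v \<in> V'"
  obtains vs where "length vs = m" "distinct vs" "vs ! 0 = u" "vs ! (m - 1) = v"
    and "(\<forall>k. k < m \<and> k \<le> h u \<longrightarrow> h (vs ! k) = h u - k \<and> tp (vs ! k) = tp u \<and> vs ! k \<in> V' \<and>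
         (0 < k \<longrightarrow> vs ! 1 = par u)) \<or>
       (\<exists>i. i < h u \<and> Suc i < m \<and> h v = h u - i + (m - 1 - i) \<and> tp v = tp u \<and>
         (0 < i \<longrightarrow> vs ! 1 = par u))"
    and "(\<forall>k. k < m \<and> k \<le> h v \<longrightarrow> h (vs ! (m - 1 - k)) = h v - k \<and> tp (vs ! (m - 1 - k)) = tp v \<and>
         vs ! (m - 1 - k) \<in> V' \<and> (0 < k \<longrightarrow> vs ! (m - 2) = par v)) \<or>
       (\<exists>i. i < h v \<and> Suc i < m \<and> h u = h v - i + (m - 1 - i) \<and> tp u = tp v \<and>
         (0 < i \<longrightarrow> vs ! (m - 2) = par v))"
proof -
  obtain vs where vs: "length vs = m" "distinct vs"
    "\<And>i. Suc i < m \<Longrightarrow> {vs ! i, vs ! Suc i} \<in> H" "vs ! 0 = u" "vs ! (m - 1) = v"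
    using assms(1) unfolding hpath_def by blast
  have r: "rev vs ! k = vs ! (m - 1 - k)" if "k < m" for k
    using that vs(1) by (simp add: rev_nth)
  have rw: "{rev vs ! i, rev vs ! Suc i} \<in> H" if "Suc i < m" for i
  proof -
    have "{vs ! (m - Suc (Suc i)), vs ! Suc (m - Suc (Suc i))} \<in> H"
      using vs(3) that by auto
    moreover have "Suc (m - Suc (Suc i)) = m - Suc i" using that by simp
    ultimately show ?thesis using that vs(1) by (simp add: rev_nth insert_commute)
  qed
  have r0: "rev vs ! 0 = v" "rev vs ! (m - 1) = u" using r[of 0] r[of "m-1"] assms vs by auto
  have r1: "rev vs ! 1 = vs ! (m - 2)" if "1 < m" using r[of 1] that by (simp add: numeral_2_eq_2)
  have f: "(\<forall>k. k < m \<and> k \<le> h u \<longrightarrow> h (vs ! k) = h u - k \<and> tp (vs ! k) = tp u \<and> vs ! k \<in> V' \<and>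
         (0 < k \<longrightarrow> vs ! 1 = par u)) \<or>
       (\<exists>i. i < h u \<and> Suc i < m \<and> h v = h u - i + (m - 1 - i) \<and> tp v = tp u \<and>
         (0 < i \<longrightarrow> vs ! 1 = par u))"
    using up_or_turn[of vs m] vs assms by simp
  have "(\<forall>k. k < m \<and> k \<le> h v \<longrightarrow> h (rev vs ! k) = h v - k \<and> tp (rev vs ! k) = tp v \<and>
         rev vs ! k \<in> V' \<and> (0 < k \<longrightarrow> rev vs ! 1 = par v)) \<or>
       (\<exists>i. i < h v \<and> Suc i < m \<and> h u = h v - i + (m - 1 - i) \<and> tp u = tp v \<and>
         (0 < i \<longrightarrow> rev vs ! 1 = par v))"
    using up_or_turn[of "rev vs" m] vs(1,2) rw r0 assms by simp
  then have "(\<forall>k. k < m \<and> k \<le> h v \<longrightarrow> h (vs ! (m - 1 - k)) = h v - k \<and> tp (vs ! (m - 1 - k)) = tp v \<and>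
         vs ! (m - 1 - k) \<in> V' \<and> (0 < k \<longrightarrow> vs ! (m - 2) = par v)) \<or>
       (\<exists>i. i < h v \<and> Suc i < m \<and> h u = h v - i + (m - 1 - i) \<and> tp u = tp v \<and>
         (0 < i \<longrightarrow> vs ! (m - 2) = par v))"
  proof (elim disjE, goal_cases)
    case 1
    have "h (vs ! (m - 1 - k)) = h v - k \<and> tp (vs ! (m - 1 - k)) = tp v \<and>
         vs ! (m - 1 - k) \<in> V' \<and> (0 < k \<longrightarrow> vs ! (m - 2) = par v)" if "k < m \<and> k \<le> h v" for k
      using 1[rule_format, OF that] r[of k] r1 that by auto
    then show ?case by blast
  next
    case 2
    then show ?case using r1 by auto
  qed
  with f show ?thesis using that[OF vs(1,2,4,5)] by blast
qed

text \<open>A path that turns inside a tree goes up and then down, which fixes the parity of the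
  heights. A path that turns at neither end climbs to \<open>A\<close> from both ends: if the two
  climbs meet \<open>A\<close> in the same vertex they make up the whole path, otherwise they are
  disjoint parts of it.\<close>

lemma hpath_heights:
  assumes "hpath m H u v" "0 < m" "u \<in> V'" "v \<in> V'"
  shows "if tp u = tp v then m - 1 \<le> h u + h v \<and> even (h u + h v + (m - 1))
         else h u + h v < m - 1"
proof -
  obtain vs where vs: "length vs = m" "distinct vs" "vs ! 0 = u" "vs ! (m - 1) = v"
    and 1: "(\<forall>k. k < m \<and> k \<le> h u \<longrightarrow> h (vs ! k) = h u - k \<and> tp (vs ! k) = tp u \<and> vs ! k \<in> V' \<and>
         (0 < k \<longrightarrow> vs ! 1 = par u)) \<or>
       (\<exists>i. i < h u \<and> Suc i < m \<and> h v = h u - i + (m - 1 - i) \<and> tp v = tp u \<and>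
         (0 < i \<longrightarrow> vs ! 1 = par u))"
    and 2: "(\<forall>k. k < m \<and> k \<le> h v \<longrightarrow> h (vs ! (m - 1 - k)) = h v - k \<and> tp (vs ! (m - 1 - k)) = tp v \<and>
         vs ! (m - 1 - k) \<in> V' \<and> (0 < k \<longrightarrow> vs ! (m - 2) = par v)) \<or>
       (\<exists>i. i < h v \<and> Suc i < m \<and> h u = h v - i + (m - 1 - i) \<and> tp u = tp v \<and>
         (0 < i \<longrightarrow> vs ! (m - 2) = par v))"
    by (rule hpath_profile[OF assms])
  have turn: "m - 1 \<le> a + b \<and> even (a + b + (m - 1))"
    if "i < a" "Suc i < m" "b = a - i + (m - 1 - i)" for a b i :: nat
  proof -
    define M where "M = m - 1"
    have *: "a + b + 2 * i = 2 * a + M" using that unfolding M_def by linarith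
    then have "even (a + b + M)" by presburger
    moreover have "M \<le> a + b" using * that(1) by linarith
    ultimately show ?thesis by (simp add: M_def)
  qed
  show ?thesis
  proof (cases "(\<exists>i. i < h u \<and> Suc i < m \<and> h v = h u - i + (m - 1 - i) \<and> tp v = tp u) \<or>
                (\<exists>i. i < h v \<and> Suc i < m \<and> h u = h v - i + (m - 1 - i) \<and> tp u = tp v)")
    case True
    then show ?thesis
    proof (elim disjE exE conjE)
      fix i assume "i < h u" "Suc i < m" "h v = h u - i + (m - 1 - i)" "tp v = tp u"
      then show ?thesis using turn[of i "h u" "h v"] by metis
    next
      fix i assume "i < h v" "Suc i < m" "h u = h v - i + (m - 1 - i)" "tp u = tp v"
      then show ?thesis using turn[of i "h v" "h u"] by (metis add.commute)
    qed
  next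
    case False
    have a: "h (vs ! k) = h u - k" "tp (vs ! k) = tp u" "vs ! k \<in> V'" if "k < m" "k \<le> h u" for k
      using 1 False that by blast+
    have b: "h (vs ! (m - 1 - k)) = h v - k" "tp (vs ! (m - 1 - k)) = tp v" "vs ! (m - 1 - k) \<in> V'"
      if "k < m" "k \<le> h v" for k
      using 2 False that by blast+
    consider "m - 1 \<le> h u" | "m - 1 \<le> h v" | "h u < m - 1" "h v < m - 1" by linarith
    then show ?thesis
    proof cases
      case 1
      then have "h v = h u - (m - 1)" "tp v = tp u" using a[of "m - 1"] assms(2) vs by auto
      moreover from this have "h u + h v + (m - 1) = 2 * h u" using 1 by simp
      ultimately show ?thesis using 1 by auto
    next
      case 2
      then have "h u = h v - (m - 1)" "tp v = tp u" using b[of "m - 1"] assms(2) vs by auto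
      moreover from this have "h u + h v + (m - 1) = 2 * h v" using 2 by simp
      ultimately show ?thesis using 2 by auto
    next
      case 3
      \<comment> \<open>The index at which the climb from the far end \<open>v\<close> reaches
        \<open>A\<close>; the climb from \<open>u\<close> reaches it at index
        \<open>h u\<close>.\<close>
      define j where "j = m - 1 - h v"
      have "h (vs ! h u) = 0" "vs ! h u \<in> V'" using a[of "h u"] 3 by auto
      then have i0: "vs ! h u \<in> A" using h_eq_0_iff by blast
      have i1: "vs ! h u = tp u" using a(2)[of "h u"] 3 tpA[OF i0] by simp
      have "h (vs ! j) = 0" "vs ! j \<in> V'" using b[of "h v"] 3 by (auto simp: j_def)
      then have j0: "vs ! j \<in> A" using h_eq_0_iff by blast
      have j1: "vs ! j = tp v" using b(2)[of "h v"] 3 tpA[OF j0] by (simp add: j_def)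
      have jm: "j < m" "h u < m" using 3 by (auto simp: j_def)
      show ?thesis
      proof (cases "tp u = tp v")
        case True
        then have "vs ! h u = vs ! j" using i1 j1 by simp
        then have "h u = j" using jm vs(1,2) by (simp add: nth_eq_iff_index_eq)
        then have s: "h u + h v = m - 1" using 3 by (simp add: j_def)
        show ?thesis using True unfolding s by simp
      next
        case False
        \<comment> \<open>Before index \<open>h u\<close> the heights are still positive, whereas
          \<open>vs ! j\<close> lies in \<open>A\<close>.\<close>
        have "\<not> j < h u" using a(1)[of j] hA[OF j0] jm by auto
        moreover have "j \<noteq> h u" using False i1 j1 by metis
        ultimately show ?thesis using False 3 by (auto simp: j_def)
      qed
    qed
  qed
qed

text \<open>Siblings have equal height, so the path cannot start downwards: its other end would be
  \<open>m - 1\<close> levels deeper. Hence the second and the last but one vertex are both the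
  common parent, although their indices differ for \<open>m > 3\<close>.\<close>

lemma not_hpath_siblings:
  assumes "u \<in> V'" "u \<notin> A" "v \<in> V'" "v \<notin> A" "par u = par v" "3 < m"
  shows "\<not> hpath m H u v"
proof
  assume *: "hpath m H u v"
  have hh: "h u = h v" "0 < h u" using hU assms by auto
  obtain vs where vs: "length vs = m" "distinct vs" "vs ! 0 = u" "vs ! (m - 1) = v"
    and 1: "(\<forall>k. k < m \<and> k \<le> h u \<longrightarrow> h (vs ! k) = h u - k \<and> tp (vs ! k) = tp u \<and> vs ! k \<in> V' \<and>
         (0 < k \<longrightarrow> vs ! 1 = par u)) \<or>
       (\<exists>i. i < h u \<and> Suc i < m \<and> h v = h u - i + (m - 1 - i) \<and> tp v = tp u \<and>
         (0 < i \<longrightarrow> vs ! 1 = par u))"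
    and 2: "(\<forall>k. k < m \<and> k \<le> h v \<longrightarrow> h (vs ! (m - 1 - k)) = h v - k \<and> tp (vs ! (m - 1 - k)) = tp v \<and>
         vs ! (m - 1 - k) \<in> V' \<and> (0 < k \<longrightarrow> vs ! (m - 2) = par v)) \<or>
       (\<exists>i. i < h v \<and> Suc i < m \<and> h u = h v - i + (m - 1 - i) \<and> tp u = tp v \<and>
         (0 < i \<longrightarrow> vs ! (m - 2) = par v))"
    by (rule hpath_profile[OF * _ assms(1,3)]) (use assms in auto)
  have "vs ! 1 = par u"
    using 1
  proof
    assume "\<forall>k. k < m \<and> k \<le> h u \<longrightarrow> h (vs ! k) = h u - k \<and> tp (vs ! k) = tp u \<and> vs ! k \<in> V' \<and>
         (0 < k \<longrightarrow> vs ! 1 = par u)"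
    from this[rule_format, of 1] show ?thesis using assms hh by auto
  next
    assume "\<exists>i. i < h u \<and> Suc i < m \<and> h v = h u - i + (m - 1 - i) \<and> tp v = tp u \<and>
         (0 < i \<longrightarrow> vs ! 1 = par u)"
    then obtain i where i: "h v = h u - i + (m - 1 - i)" "0 < i \<longrightarrow> vs ! 1 = par u" by blast
    have "i \<noteq> 0" using i(1) hh assms by auto
    then show ?thesis using i by auto
  qed
  moreover have "vs ! (m - 2) = par v"
    using 2
  proof
    assume "\<forall>k. k < m \<and> k \<le> h v \<longrightarrow> h (vs ! (m - 1 - k)) = h v - k \<and> tp (vs ! (m - 1 - k)) = tp v \<and>
         vs ! (m - 1 - k) \<in> V' \<and> (0 < k \<longrightarrow> vs ! (m - 2) = par v)"
    from this[rule_format, of 1] show ?thesis using assms hh by auto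
  next
    assume "\<exists>i. i < h v \<and> Suc i < m \<and> h u = h v - i + (m - 1 - i) \<and> tp u = tp v \<and>
         (0 < i \<longrightarrow> vs ! (m - 2) = par v)"
    then obtain i where i: "h u = h v - i + (m - 1 - i)" "0 < i \<longrightarrow> vs ! (m - 2) = par v" by blast
    have "i \<noteq> 0" using i(1) hh assms by auto
    then show ?thesis using i by auto
  qed
  ultimately have "vs ! 1 = vs ! (m - 2)" using assms by simp
  then have "1 = m - 2" using vs(1,2) assms by (subst (asm) nth_eq_iff_index_eq) auto
  then show False using assms by simp
qed

end

section \<open>Breadth-first trees\<close>

text \<open>Cauchy-Schwarz for the sizes of the fibres. It is applied to \<open>tp\<close>, to find
  pairs in a common tree, and to \<open>par\<close>, to find siblings.\<close>

lemma card_square_le_card_mult_fibres: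
  assumes "finite W" "finite A" "f ` W \<subseteq> A"
  shows "(card W)\<^sup>2 \<le> card A * card {(u, v) \<in> W \<times> W. f u = f v}"
proof -
  define s where "s = (\<lambda>c. card {u \<in> W. f u = c})"
  have W: "card W = (\<Sum>c\<in>A. s c)"
  proof -
    have "card W = card (\<Union>c\<in>A. {u \<in> W. f u = c})" using assms by (intro arg_cong[of _ _ card]) auto
    also have "\<dots> = (\<Sum>c\<in>A. s c)" unfolding s_def using assms by (intro card_UN_disjoint) auto
    finally show ?thesis .
  qed
  have "card {(u, v) \<in> W \<times> W. f u = f v} = card (\<Union>c\<in>A. {u \<in> W. f u = c} \<times> {u \<in> W. f u = c})"
    using assms by (intro arg_cong[of _ _ card]) auto
  also have "\<dots> = (\<Sum>c\<in>A. (s c)\<^sup>2)"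
    unfolding s_def using assms
    by (subst card_UN_disjoint) (auto simp: card_cartesian_product power2_eq_square)
  finally have T: "card {(u, v) \<in> W \<times> W. f u = f v} = (\<Sum>c\<in>A. (s c)\<^sup>2)" .
  have "(\<Sum>c\<in>A. 1 * real (s c))\<^sup>2 \<le> (\<Sum>c\<in>A. 1\<^sup>2) * (\<Sum>c\<in>A. (real (s c))\<^sup>2)"
    by (rule Cauchy_Schwarz_ineq_sum)
  then have "(real (card W))\<^sup>2 \<le> real (card A) * real (card {(u, v) \<in> W \<times> W. f u = f v})"
    unfolding W T by simp
  then have "real ((card W)\<^sup>2) \<le> real (card A * card {(u, v) \<in> W \<times> W. f u = f v})" by simp
  then show ?thesis by (simp only: of_nat_le_iff)
qed

text \<open>The ends of walks with exactly \<open>i\<close> edges from \<open>r\<close>. Levels may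
  overlap; the distance from \<open>r\<close> is the least level of a vertex.\<close>

fun bfs_level :: "'a set set \<Rightarrow> 'a \<Rightarrow> nat \<Rightarrow> 'a set" where
  "bfs_level H r 0 = {r}"
| "bfs_level H r (Suc i) = {v. \<exists>u\<in>bfs_level H r i. {u, v} \<in> H}"

lemma BFS_tree:
  fixes H :: "'a set set" and r :: 'a
  defines "V' \<equiv> \<Union>i. bfs_level H r i"
  obtains d :: "'a \<Rightarrow> nat" and par where "d r = 0"
    and "\<And>v. v \<in> V' \<Longrightarrow> d v = 0 \<Longrightarrow> v = r"
    and "\<And>v. v \<in> V' \<Longrightarrow> v \<noteq> r \<Longrightarrow> par v \<in> V' \<and> d v = Suc (d (par v)) \<and> {par v, v} \<in> H"
    and "\<And>v i. v \<in> bfs_level H r i \<Longrightarrow> d v \<le> i"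
proof -
  define d where "d = (\<lambda>v. LEAST i. v \<in> bfs_level H r i)"
  have d_le: "d v \<le> i" if "v \<in> bfs_level H r i" for v i
    unfolding d_def using that by (rule Least_le)
  have d_in: "v \<in> bfs_level H r (d v)" if v: "v \<in> V'" for v
    unfolding d_def using v by (auto simp: V'_def intro: LeastI)
  have dr: "d r = 0" using d_le[of r 0] by simp
  have d0: "v = r" if "v \<in> V'" "d v = 0" for v
    using d_in[OF that(1)] that(2) by simp
  have "\<exists>u. u \<in> V' \<and> d v = Suc (d u) \<and> {u, v} \<in> H" if v: "v \<in> V'" "v \<noteq> r" for v
  proof -
    obtain i where i: "d v = Suc i" using d0 v by (metis not0_implies_Suc)
    then obtain u where u: "u \<in> bfs_level H r i" "{u, v} \<in> H" using d_in[OF v(1)] by auto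
    have uV: "u \<in> V'" using u by (auto simp: V'_def)
    have "v \<in> bfs_level H r (Suc (d u))" using d_in[OF uV] u by auto
    then have "d v \<le> Suc (d u)" by (rule d_le)
    then show ?thesis using d_le[OF u(1)] i u uV by (intro exI[of _ u]) auto
  qed
  then obtain par where "\<And>v. v \<in> V' \<Longrightarrow> v \<noteq> r \<Longrightarrow> par v \<in> V' \<and> d v = Suc (d (par v)) \<and> {par v, v} \<in> H"
    by metis
  with dr d0 d_le show ?thesis using that by blast
qed

lemma hpath_imp_bfs_level:
  assumes "hpath m H r v" "0 < m"
  shows "v \<in> bfs_level H r (m - 1)"
proof -
  obtain vs where vs: "\<forall>i. Suc i < m \<longrightarrow> {vs ! i, vs ! Suc i} \<in> H" "vs ! 0 = r" "vs ! (m - 1) = v"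
    using assms unfolding hpath_def by blast
  have "vs ! i \<in> bfs_level H r i" if "i < m" for i
    using that by (induction i) (use vs in auto)
  from this[of "m - 1"] show ?thesis using assms vs by auto
qed

text \<open>If \<open>H\<close> is saturated in \<open>G\<close>, then no edge of \<open>G\<close>
  leads from \<open>u\<close> to any of these vertices.\<close>

definition unjoined :: "nat \<Rightarrow> 'a set \<Rightarrow> 'a set set \<Rightarrow> 'a \<Rightarrow> 'a set" where
  "unjoined m V H u = {v \<in> V. v \<noteq> u \<and> {u, v} \<notin> H \<and> \<not> hpath m H u v}"

text \<open>A vertex joined to \<open>r\<close> by an edge or a path lies in level 1 or
  \<open>m - 1\<close>, so vertices of depth at least \<open>m\<close>, and those not reached from
  \<open>r\<close>, are unjoined from \<open>r\<close>. Apart from these and \<open>r\<close>, the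
  set \<open>A\<close> contains only ancestors of depth 1 to \<open>m - 1\<close> of ends of
  non-tree edges, at most \<open>m - 1\<close> for each end. The breadth-first tree has
  \<open>card V' - 1\<close> edges, which leaves \<open>card H + 1 - card V'\<close> others.\<close>

lemma pendant_structure:
  fixes H :: "'a set set"
  assumes fin: "finite V" and r: "r \<in> V" and m: "2 \<le> m"
    and H: "\<And>e. e \<in> H \<Longrightarrow> \<exists>u v. e = {u, v} \<and> u \<in> V \<and> v \<in> V \<and> u \<noteq> v"
  obtains V' A par tp and h :: "'a \<Rightarrow> nat" where "pendant H V' A par tp h" "V' \<subseteq> V"
    "card V \<le> card V' + card (unjoined m V H r)" "card V' \<le> card H + 1"
    "card A \<le> 1 + card (unjoined m V H r) + 2 * (m - 1) * (card H + 1 - card V')"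
proof -
  define V' where "V' = (\<Union>i. bfs_level H r i)"
  obtain d par where dr: "d r = 0"
    and d0: "\<And>v. v \<in> V' \<Longrightarrow> d v = (0::nat) \<Longrightarrow> v = r"
    and par: "\<And>v. v \<in> V' \<Longrightarrow> v \<noteq> r \<Longrightarrow> par v \<in> V' \<and> d v = Suc (d (par v)) \<and> {par v, v} \<in> H"
    and dle: "\<And>v i. v \<in> bfs_level H r i \<Longrightarrow> d v \<le> i"
    using BFS_tree[of r H] unfolding V'_def by blast
  have rV': "r \<in> V'" unfolding V'_def using bfs_level.simps(1)[of H r] by blast
  have finH: "finite H"
    by (rule finite_subset[of _ "Pow V"]) (use H fin in fastforce)+
  have V'V: "V' \<subseteq> V"
  proof -
    have "bfs_level H r i \<subseteq> V" for i
    proof (induction i)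
      case (Suc i)
      then show ?case using H by (fastforce simp: doubleton_eq_iff)
    qed (use r in auto)
    then show ?thesis by (auto simp: V'_def)
  qed
  have finV': "finite V'" using V'V fin finite_subset by blast
  have nbr_V': "w \<in> V'" if vw: "v \<in> V'" "{v, w} \<in> H" for v w
  proof -
    obtain i where "v \<in> bfs_level H r i" using vw(1) unfolding V'_def by blast
    then have "w \<in> bfs_level H r (Suc i)" using vw by auto
    then show ?thesis unfolding V'_def by blast
  qed
  have far_lev: "v \<notin> bfs_level H r i" if "v \<in> {v \<in> V'. m \<le> d v} \<union> (V - V')" "i < m" for v i
  proof
    assume i: "v \<in> bfs_level H r i"
    then have "v \<in> V'" unfolding V'_def by blast
    then show False using dle[OF i] that by auto
  qed
  have far: "{v \<in> V'. m \<le> d v} \<union> (V - V') \<subseteq> unjoined m V H r"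
  proof
    fix v assume v: "v \<in> {v \<in> V'. m \<le> d v} \<union> (V - V')"
    have "v \<noteq> r" using v rV' dr m by auto
    moreover have "{r, v} \<notin> H"
    proof
      assume "{r, v} \<in> H"
      then have "v \<in> bfs_level H r 1" by simp
      then show False using far_lev[OF v, of 1] m by simp
    qed
    moreover have "\<not> hpath m H r v"
    proof
      assume "hpath m H r v"
      then have "v \<in> bfs_level H r (m - 1)" using m by (intro hpath_imp_bfs_level) auto
      then show False using far_lev[OF v, of "m - 1"] m by simp
    qed
    ultimately show "v \<in> unjoined m V H r" using v V'V by (auto simp: unjoined_def)
  qed
  have finnc: "finite (unjoined m V H r)" using fin by (simp add: unjoined_def)
  define t where "t = (\<lambda>v. {par v, v})"
  define T where "T = t ` (V' - {r})"
  have inj: "inj_on t (V' - {r})"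
  proof (rule inj_onI)
    fix v w assume *: "v \<in> V' - {r}" "w \<in> V' - {r}" "t v = t w"
    show "v = w"
    proof (rule ccontr)
      assume "v \<noteq> w"
      then have "v = par w" "w = par v" using * by (auto simp: t_def doubleton_eq_iff)
      then show False using par[of v] par[of w] * by auto
    qed
  qed
  have TH: "T \<subseteq> H" using par by (auto simp: T_def t_def)
  have cardT: "card T = card V' - 1"
    unfolding T_def using card_image[OF inj] rV' finV' by simp
  have cV1: "1 \<le> card V'" using rV' finV' by (metis One_nat_def Suc_leI card_gt_0_iff empty_iff)
  have cV': "card V' \<le> card H + 1" using card_mono[OF finH TH] cardT by linarith
  \<comment> \<open>The ends of the non-tree edges in the component of \<open>r\<close>.\<close>
  define K where "K = V' \<inter> \<Union>(H - T)"
  have finK: "finite K" using finV' by (simp add: K_def)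
  have cardK: "card K \<le> 2 * (card H + 1 - card V')"
  proof -
    have "card K \<le> card (\<Union>(H - T))"
    proof (rule card_mono)
      show "finite (\<Union>(H - T))" using finH H by (intro finite_Union) (fastforce)+
    qed (auto simp: K_def)
    also have "\<dots> \<le> (\<Sum>e\<in>H - T. card e)"
      using card_Union_le_sum_card by blast
    also have "\<dots> \<le> (\<Sum>e\<in>H - T. 2)"
      by (intro sum_mono) (use H in \<open>fastforce simp: card_insert_if\<close>)
    also have "\<dots> = 2 * (card H - card T)"
      using TH finH by (simp add: card_Diff_subset finite_subset)
    finally show ?thesis using cardT cV1 by simp
  qed
  have anc: "(par ^^ i) x \<in> V' \<and> d ((par ^^ i) x) = d x - i" if "x \<in> V'" "i \<le> d x" for x i
    using that(2)
  proof (induction i)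
    case (Suc i)
    then have IH: "(par ^^ i) x \<in> V'" "d ((par ^^ i) x) = d x - i" by auto
    then have "(par ^^ i) x \<noteq> r" using Suc.prems dr by auto
    then show ?case using par[OF IH(1)] IH(2) by auto
  qed (use that in auto)
  \<comment> \<open>Closing \<open>insert r K\<close> under parents makes what is left a union of
    full subtrees, and every edge at a vertex outside \<open>A\<close> is a tree edge.\<close>
  define A where "A = {(par ^^ i) x |x i. x \<in> insert r K \<and> i \<le> d x}"
  have KV': "insert r K \<subseteq> V'" using rV' by (auto simp: K_def)
  have KA: "insert r K \<subseteq> A"
  proof
    fix x assume "x \<in> insert r K"
    then show "x \<in> A" unfolding A_def by (intro CollectI exI[of _ x] exI[of _ 0]) auto
  qed
  have AV': "A \<subseteq> V'" unfolding A_def using anc KV' by blast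
  have Apar: "par v \<in> A" if vA: "v \<in> A" "v \<noteq> r" for v
  proof -
    obtain x i where x: "x \<in> insert r K" "i \<le> d x" "v = (par ^^ i) x" using vA(1) by (auto simp: A_def)
    have "i \<noteq> d x"
    proof
      assume "i = d x"
      then have "d v = 0" "v \<in> V'" using anc[of x i] x KV' by auto
      then show False using d0 that by auto
    qed
    then have "Suc i \<le> d x" "par v = (par ^^ Suc i) x" using x by auto
    then show ?thesis unfolding A_def using x by blast
  qed
  have ex: "\<exists>i. (par ^^ i) v \<in> A" if "v \<in> V'" for v
  proof -
    have "(par ^^ d v) v = r" using anc[OF that, of "d v"] d0 by auto
    then show ?thesis using KA by (metis insert_subset)
  qed
  define h where "h = (\<lambda>v. LEAST i. (par ^^ i) v \<in> A)"
  define tp where "tp = (\<lambda>v. (par ^^ h v) v)"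
  have hin: "(par ^^ h v) v \<in> A" if "v \<in> V'" for v
    unfolding h_def using LeastI_ex[OF ex[OF that]] .
  have hS: "h v = Suc (h (par v))" if "v \<in> V'" "v \<notin> A" for v
  proof -
    have pv: "par v \<in> V'" using par that KA by blast
    have s: "(par ^^ Suc i) v = (par ^^ i) (par v)" for i by (simp add: funpow_swap1)
    have "h v = Suc (LEAST i. (par ^^ Suc i) v \<in> A)"
      unfolding h_def by (rule Least_Suc[of "\<lambda>i. (par ^^ i) v \<in> A" "h v"]) (use that hin in auto)
    then show ?thesis unfolding s h_def .
  qed
  have P: "pendant H V' A par tp h"
  proof
    fix v w assume v: "v \<in> V'" "v \<notin> A" "{v, w} \<in> H"
    have w: "w \<in> V'" using nbr_V' v by blast
    have "{v, w} \<in> T"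
    proof (rule ccontr)
      assume "{v, w} \<notin> T"
      then have "v \<in> K" using v by (auto simp: K_def)
      then show False using v KA by auto
    qed
    then obtain z where z: "z \<in> V'" "z \<noteq> r" "{v, w} = {par z, z}" by (auto simp: T_def t_def)
    then consider "z = v" "w = par v" | "z = w" "v = par w" by (auto simp: doubleton_eq_iff)
    then show "w = par v \<or> w \<in> V' \<and> w \<notin> A \<and> par w = v"
    proof cases
      case 2
      then have "w \<notin> A" using Apar[of w] z v by auto
      then show ?thesis using 2 w by auto
    qed auto
  next
    fix v assume v: "v \<in> V'" "v \<notin> A"
    have "v \<noteq> r" using v KA by auto
    then show "par v \<in> V'" "{v, par v} \<in> H" using par[of v] v by (auto simp: insert_commute)
    show "h v = Suc (h (par v))" using hS v by blast
    show "tp v = tp (par v)" unfolding tp_def hS[OF v] by (simp add: funpow_swap1)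
  next
    show "A \<subseteq> V'" by (rule AV')
  next
    fix v assume "v \<in> A"
    then show "h v = 0" unfolding h_def by (intro Least_equality) auto
    then show "tp v = v" by (simp add: tp_def)
  next
    fix v assume "v \<in> V'"
    then show "tp v \<in> A" using hin by (simp add: tp_def)
  qed
  have cardA: "card A \<le> 1 + card (unjoined m V H r) + 2 * (m - 1) * (card H + 1 - card V')"
  proof -
    \<comment> \<open>Here \<open>d x - i\<close> is the depth of the ancestor
      \<open>(par ^^ i) x\<close>. Deeper ancestors are charged to \<open>unjoined m V H r\<close>,
      and depth 0 to \<open>r\<close>.\<close>
    define near where "near = (\<lambda>x. {(par ^^ i) x |i. i \<le> d x \<and> 1 \<le> d x - i \<and> d x - i \<le> m - 1})"
    have card_near: "card (near x) \<le> m - 1" for x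
    proof -
      have "near x \<subseteq> (\<lambda>k. (par ^^ (d x - k)) x) ` {1..m - 1}"
      proof
        fix y assume "y \<in> near x"
        then obtain i where "i \<le> d x" "1 \<le> d x - i" "d x - i \<le> m - 1" "y = (par ^^ i) x"
          by (auto simp: near_def)
        then show "y \<in> (\<lambda>k. (par ^^ (d x - k)) x) ` {1..m - 1}"
          by (intro image_eqI[of _ _ "d x - i"]) auto
      qed
      then have "card (near x) \<le> card {1..m - 1}" by (rule surj_card_le[rotated]) simp
      then show ?thesis by simp
    qed
    have finnear: "finite (near x)" for x unfolding near_def by simp
    have sub: "A \<subseteq> {r} \<union> {v \<in> V'. m \<le> d v} \<union> (\<Union>x\<in>K. near x)"
    proof
      fix a assume a: "a \<in> A"
      then obtain x i where x: "x \<in> insert r K" "i \<le> d x" "a = (par ^^ i) x" by (auto simp: A_def)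
      have ad: "a \<in> V'" "d a = d x - i" using anc[of x i] x KV' by auto
      show "a \<in> {r} \<union> {v \<in> V'. m \<le> d v} \<union> (\<Union>x\<in>K. near x)"
      proof (cases "d a = 0 \<or> m \<le> d a")
        case True
        then show ?thesis using d0 ad by auto
      next
        case False
        then have "x \<in> K" using x ad dr by auto
        moreover have "a \<in> near x" unfolding near_def using x ad False
          by (intro CollectI exI[of _ i]) auto
        ultimately show ?thesis by blast
      qed
    qed
    have "card A \<le> card ({r} \<union> {v \<in> V'. m \<le> d v} \<union> (\<Union>x\<in>K. near x))"
      using sub finV' finK finnear by (intro card_mono) auto
    also have "\<dots> \<le> card {r} + card {v \<in> V'. m \<le> d v} + card (\<Union>x\<in>K. near x)"
      by (meson add_le_mono card_Un_le le_refl le_trans)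
    also have "card {v \<in> V'. m \<le> d v} \<le> card (unjoined m V H r)"
      using far finnc by (intro card_mono) auto
    also have "card (\<Union>x\<in>K. near x) \<le> (\<Sum>x\<in>K. card (near x))" using finK by (rule card_UN_le)
    also have "\<dots> \<le> card K * (m - 1)" using card_near by (metis sum_bounded_above of_nat_id)
    also have "\<dots> \<le> 2 * (card H + 1 - card V') * (m - 1)" using cardK by simp
    finally show ?thesis by (simp add: mult.commute mult.left_commute)
  qed
  have "card V \<le> card V' + card (unjoined m V H r)"
  proof -
    have "card V \<le> card (V' \<union> unjoined m V H r)"
      using far finV' finnc V'V by (intro card_mono) auto
    also have "\<dots> \<le> card V' + card (unjoined m V H r)" by (rule card_Un_le)
    finally show ?thesis .
  qed
  with P V'V cV' cardA show ?thesis using that by blast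
qed

section \<open>Counting pairs not joined by a path\<close>

text \<open>Ordered pairs: each unjoined edge is counted in both directions, which fits the pairs
  counted by \<open>card_square_le_card_mult_fibres\<close>.\<close>

definition unjoined_pairs :: "nat \<Rightarrow> 'a set \<Rightarrow> 'a set set \<Rightarrow> ('a \<times> 'a) set" where
  "unjoined_pairs m V H = (SIGMA u:V. unjoined m V H u)"

lemma card_unjoined_pairs: "finite V \<Longrightarrow> card (unjoined_pairs m V H) = (\<Sum>u\<in>V. card (unjoined m V H u))"
  unfolding unjoined_pairs_def by (rule card_SigmaI) (auto simp: unjoined_def)

lemma sum_degree_le:
  assumes "finite V" and H: "\<And>e. e \<in> H \<Longrightarrow> \<exists>u v. e = {u, v} \<and> u \<in> V \<and> v \<in> V \<and> u \<noteq> v"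
  shows "(\<Sum>v\<in>V. card {w. {v, w} \<in> H}) \<le> 2 * card H"
proof -
  have finH: "finite H"
    by (rule finite_subset[of _ "Pow V"]) (use assms in fastforce)+
  have sub: "{w. {v, w} \<in> H} \<subseteq> V" for v using H by (fastforce simp: doubleton_eq_iff)
  have fin: "finite {w. {v, w} \<in> H}" for v using sub assms finite_subset by blast
  have two: "card {(v, w). {v, w} = e} \<le> 2 \<and> finite {(v, w). {v, w} = e}" if "e \<in> H" for e
  proof -
    obtain a b where ab: "e = {a, b}" using H[OF \<open>e \<in> H\<close>] by blast
    have "{(v, w). {v, w} = e} = {(a, b), (b, a)}" by (auto simp: ab doubleton_eq_iff)
    moreover have "card {(a, b), (b, a)} \<le> 2" using card_length[of "[(a, b), (b, a)]"] by (simp only: list.set list.size)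
    ultimately show ?thesis by (simp only: finite.emptyI finite.insertI)
  qed
  have "(\<Sum>v\<in>V. card {w. {v, w} \<in> H}) = card (SIGMA v:V. {w. {v, w} \<in> H})"
    using assms fin by (subst card_SigmaI) auto
  also have "\<dots> \<le> card (\<Union>e\<in>H. {(v, w). {v, w} = e})"
    using finH two by (intro card_mono) auto
  also have "\<dots> \<le> (\<Sum>e\<in>H. card {(v, w). {v, w} = e})" using finH by (rule card_UN_le)
  also have "\<dots> \<le> (\<Sum>e\<in>H. 2)" using two by (intro sum_mono) auto
  finally show ?thesis by simp
qed

context pendant
begin

text \<open>Two such vertices in one tree have heights of sum below \<open>m - 1\<close>, which by
  \<open>hpath_heights\<close> is too little for a path between them. So two of them with the same
  \<open>tp\<close> are unjoined unless they are equal or child and parent; these exceptions make up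
  \<open>3 * card V\<close>.\<close>

lemma card_shallow:
  assumes "finite V" "V' \<subseteq> V" "2 \<le> m"
  shows "(card {v \<in> V'. 2 * h v < m - 1})\<^sup>2 \<le> card A * (card (unjoined_pairs m V H) + 3 * card V)"
proof -
  define W where "W = {v \<in> V'. 2 * h v < m - 1}"
  define T where "T = {(u, v) \<in> W \<times> W. tp u = tp v}"
  have fin: "finite V'" "finite A" "finite W" "finite (unjoined_pairs m V H)"
    using assms A_sub finite_subset by (auto simp: W_def unjoined_pairs_def unjoined_def intro: finite_subset)
  have "(card W)\<^sup>2 \<le> card A * card T"
    unfolding T_def using fin tp_in by (intro card_square_le_card_mult_fibres) (auto simp: W_def)
  also have "card T \<le> card (unjoined_pairs m V H \<union> (\<lambda>u. (u, u)) ` V \<union> (\<lambda>u. (u, par u)) ` V \<union> (\<lambda>u. (par u, u)) ` V)"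
  proof (rule card_mono)
    show "T \<subseteq> unjoined_pairs m V H \<union> (\<lambda>u. (u, u)) ` V \<union> (\<lambda>u. (u, par u)) ` V \<union> (\<lambda>u. (par u, u)) ` V"
    proof
      fix x assume "x \<in> T"
      then obtain u v where x: "x = (u, v)" "u \<in> V'" "v \<in> V'" "2 * h u < m - 1" "2 * h v < m - 1"
        "tp u = tp v" by (auto simp: T_def W_def)
      have "\<not> hpath m H u v" using hpath_heights[of m u v] x assms by auto
      moreover have "u = v \<or> v = par u \<or> u = par v" if "{u, v} \<in> H"
      proof (cases "u \<in> A \<and> v \<in> A")
        case True
        then show ?thesis using tpA x by metis
      next
        case False
        then show ?thesis using nbr[of u v] nbr[of v u] x that by (auto simp: insert_commute)
      qed
      ultimately show "x \<in> unjoined_pairs m V H \<union> (\<lambda>u. (u, u)) ` V \<union> (\<lambda>u. (u, par u)) ` V \<union> (\<lambda>u. (par u, u)) ` V"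
        using x assms(2) by (auto simp: unjoined_pairs_def unjoined_def)
    qed
  qed (use fin assms in auto)
  also have "\<dots> \<le> card (unjoined_pairs m V H) + card V + card V + card V"
    by (intro order_trans[OF card_Un_le] add_mono card_image_le assms order_refl)
  also have "card (unjoined_pairs m V H) + card V + card V + card V = card (unjoined_pairs m V H) + 3 * card V" by simp
  finally show ?thesis by (simp only: W_def) simp
qed

text \<open>
  A vertex \<open>v\<close> of \<open>D\<close> can be joined to other vertices of \<open>D\<close> only inside its own tree, where the parity
  of the heights prevents its parent from being joined to any of them. So the parents of most
  vertices of \<open>D\<close> are unjoined from most of \<open>D\<close>; there are few such parents, hence many pairs of
  siblings, and siblings are never joined.
\<close>

lemma card_deep:
  assumes "finite V" "V' \<subseteq> V" "4 < m"
    and HV: "\<And>e. e \<in> H \<Longrightarrow> \<exists>u v. e = {u, v} \<and> u \<in> V \<and> v \<in> V \<and> u \<noteq> v"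
  defines "D \<equiv> {v \<in> V'. m - 1 \<le> 2 * h v}"
  obtains g q :: nat where "g \<le> card D" "(card D - g) * \<Theta> \<le> card (unjoined_pairs m V H) + 2 * card H"
    "q * card D \<le> card (unjoined_pairs m V H) + q * (\<Theta> + 2)" "g\<^sup>2 \<le> q * (card (unjoined_pairs m V H) + card V)"
proof -
  define N where "N = (\<lambda>v. {w. {v, w} \<in> H})"
  \<comment> \<open>The vertices of \<open>D\<close> with few unjoined or adjacent vertices. By
    averaging, few vertices of \<open>D\<close> are not of this kind.\<close>
  define Dg where "Dg = {v \<in> D. card (unjoined m V H v) + card (N v) \<le> \<Theta>}"
  define Q where "Q = par ` Dg"
  have fin: "finite V'" "finite D" "finite Dg" "finite Q" "finite (unjoined_pairs m V H)"
    using assms finite_subset by (auto simp: D_def Dg_def Q_def unjoined_pairs_def unjoined_def intro: finite_subset)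
  have finnc: "finite (unjoined m V H v)" for v using assms by (simp add: unjoined_def)
  have NV: "N v \<subseteq> V" for v using HV by (fastforce simp: doubleton_eq_iff N_def)
  have finN: "finite (N v)" for v using NV assms finite_subset by blast
  have DV: "D \<subseteq> V" "D \<subseteq> V'" "Dg \<subseteq> D" using assms by (auto simp: D_def Dg_def)
  have DU: "v \<in> V'" "v \<notin> A" if "v \<in> D" for v
    using that assms hA by (auto simp: D_def)
  have "card (D - Dg) * \<Theta> \<le> (\<Sum>v\<in>D - Dg. card (unjoined m V H v) + card (N v))"
    by (rule sum_bounded_below[of _ \<Theta>, simplified]) (auto simp: Dg_def)
  also have "\<dots> \<le> (\<Sum>v\<in>V. card (unjoined m V H v) + card (N v))"
    using DV assms by (intro sum_mono2) auto
  also have "\<dots> \<le> card (unjoined_pairs m V H) + 2 * card H"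
    using sum_degree_le[OF assms(1) HV] by (simp add: sum.distrib card_unjoined_pairs assms N_def)
  finally have 1: "(card D - card Dg) * \<Theta> \<le> card (unjoined_pairs m V H) + 2 * card H"
    using card_Diff_subset[of Dg D] fin DV by simp
  have par_nc: "card D \<le> \<Theta> + 2 + card (unjoined m V H (par v))" if v: "v \<in> Dg" for v
  proof -
    have vD: "v \<in> D" using v DV by auto
    note vU = DU[OF vD]
    have pv: "par v \<in> V'" "tp (par v) = tp v" "h v = Suc (h (par v))"
      using par_in tpU hU vU by auto
    have "D \<subseteq> unjoined m V H v \<union> N v \<union> {v, par (par v)} \<union> unjoined m V H (par v)"
    proof
      fix x assume x: "x \<in> D"
      note xU = DU[OF x]
      show "x \<in> unjoined m V H v \<union> N v \<union> {v, par (par v)} \<union> unjoined m V H (par v)"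
      proof (rule ccontr)
        assume n: "x \<notin> unjoined m V H v \<union> N v \<union> {v, par (par v)} \<union> unjoined m V H (par v)"
        then have c: "hpath m H v x" "{v, x} \<notin> H" using x DV by (auto simp: unjoined_def N_def)
        have "m - 1 \<le> h v + h x" using x vD by (auto simp: D_def)
        then have tp: "tp v = tp x" "even (h v + h x + (m - 1))"
          using hpath_heights[OF c(1)] vU xU assms(3) by (auto split: if_splits)
        have unjoined: "\<not> hpath m H (par v) x"
        proof
          assume "hpath m H (par v) x"
          then have "even (h (par v) + h x + (m - 1))"
            using hpath_heights[of m "par v" x] pv xU assms(3) tp by auto
          then show False using tp(2) pv(3) by simp
        qed
        have ne: "x \<noteq> par v" using par_edge vU c(2) by auto
        \<comment> \<open>Such an edge would make \<open>x\<close> the grandparent of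
          \<open>v\<close>, which is excluded explicitly, or a sibling of \<open>v\<close>, which
          contradicts the path between \<open>v\<close> and \<open>x\<close>.\<close>
        have "{par v, x} \<notin> H"
        proof
          assume e: "{par v, x} \<in> H"
          then have "par v = par x \<or> (par v \<in> V' \<and> par v \<notin> A \<and> par (par v) = x)"
            using nbr[of x "par v"] xU by (auto simp: insert_commute)
          then have "par v = par x" using n by auto
          then show False using not_hpath_siblings[of v x m] vU xU c assms(3) by auto
        qed
        then have "x \<in> unjoined m V H (par v)" using unjoined ne x DV by (auto simp: unjoined_def)
        then show False using n by auto
      qed
    qed
    then have "card D \<le> card (unjoined m V H v \<union> N v \<union> {v, par (par v)} \<union> unjoined m V H (par v))"
      using finnc finN by (intro card_mono) auto
    also have "\<dots> \<le> card (unjoined m V H v) + card (N v) + card {v, par (par v)} + card (unjoined m V H (par v))"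
      by (intro order_trans[OF card_Un_le] add_mono order_refl)
    also have "card {v, par (par v)} \<le> 2" by (simp add: card_insert_if)
    finally show ?thesis using v by (simp add: Dg_def)
  qed
  have "par v \<in> V" if "v \<in> Dg" for v
    using par_in[of v] DU[of v] DV assms(2) that by blast
  then have QV: "Q \<subseteq> V" by (auto simp: Q_def)
  have "card Q * card D \<le> (\<Sum>x\<in>Q. \<Theta> + 2 + card (unjoined m V H x))"
    by (rule sum_bounded_below[of _ "card D", simplified]) (use par_nc in \<open>auto simp: Q_def\<close>)
  also have "\<dots> = card Q * (\<Theta> + 2) + (\<Sum>x\<in>Q. card (unjoined m V H x))" by (simp only: sum.distrib) simp
  also have "(\<Sum>x\<in>Q. card (unjoined m V H x)) \<le> card (unjoined_pairs m V H)"
    unfolding card_unjoined_pairs[OF assms(1)] using QV assms by (intro sum_mono2) auto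
  finally have 2: "card Q * card D \<le> card (unjoined_pairs m V H) + card Q * (\<Theta> + 2)" by simp
  have "(card Dg)\<^sup>2 \<le> card Q * card {(u, v) \<in> Dg \<times> Dg. par u = par v}"
    by (rule card_square_le_card_mult_fibres) (use fin in \<open>auto simp: Q_def\<close>)
  also have "card {(u, v) \<in> Dg \<times> Dg. par u = par v} \<le> card (unjoined_pairs m V H \<union> (\<lambda>u. (u, u)) ` V)"
  proof (rule card_mono)
    show "{(u, v) \<in> Dg \<times> Dg. par u = par v} \<subseteq> unjoined_pairs m V H \<union> (\<lambda>u. (u, u)) ` V"
    proof (clarsimp)
      fix u v assume uv: "u \<in> Dg" "v \<in> Dg" "par u = par v" "(u, v) \<notin> (\<lambda>u. (u, u)) ` V"
      have U: "u \<in> V'" "u \<notin> A" "v \<in> V'" "v \<notin> A" "u \<in> V" "v \<in> V" using uv DU DV by auto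
      have "\<not> hpath m H u v" using not_hpath_siblings U uv assms(3) by auto
      moreover have "{u, v} \<notin> H"
      proof
        assume "{u, v} \<in> H"
        then have "v = par u \<or> par v = u" using nbr U by blast
        then show False using hU[OF U(1,2)] hU[OF U(3,4)] uv(3) by (metis n_not_Suc_n)
      qed
      ultimately show "(u, v) \<in> unjoined_pairs m V H" using U uv by (auto simp: unjoined_pairs_def unjoined_def)
    qed
  qed (use fin assms in auto)
  also have "\<dots> \<le> card (unjoined_pairs m V H) + card V"
    by (intro order_trans[OF card_Un_le] add_mono card_image_le assms order_refl)
  finally have 3: "(card Dg)\<^sup>2 \<le> card Q * (card (unjoined_pairs m V H) + card V)" by simp
  have "card Dg \<le> card D" using fin DV by (intro card_mono) auto
  with 1 2 3 show ?thesis using that by blast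
qed

end

text \<open>All that the numerical argument needs, in cardinalities only: \<open>k\<close> vertices
  unjoined from a best root \<open>r\<close>, hence at most the average \<open>P / n\<close>;
  \<open>v'\<close> vertices reached; \<open>a\<close> the order of \<open>A\<close>;
  \<open>w\<close> shallow and \<open>D\<close> deep vertices. The threshold \<open>\<Theta>\<close>
  stays quantified because it is chosen after \<open>D\<close> is known.\<close>

lemma lower_bound_structure:
  fixes H :: "'a set set"
  assumes fin: "finite V" "V \<noteq> {}" and m: "4 < m"
    and H: "\<And>e. e \<in> H \<Longrightarrow> \<exists>u v. e = {u, v} \<and> u \<in> V \<and> v \<in> V \<and> u \<noteq> v"
  defines "n \<equiv> card V" and "P \<equiv> card (unjoined_pairs m V H)"
  obtains v' a w D k :: nat where "n * k \<le> P" "n \<le> v' + k" "v' \<le> n" "v' \<le> card H + 1"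
    "a \<le> 1 + k + 2 * (m - 1) * (card H + 1 - v')" "v' \<le> w + D" "w\<^sup>2 \<le> a * (P + 3 * n)"
    "\<And>\<Theta>. \<exists>g q. g \<le> D \<and> (D - g) * \<Theta> \<le> P + 2 * card H \<and> q * D \<le> P + q * (\<Theta> + 2) \<and> g\<^sup>2 \<le> q * (P + n)"
proof -
  obtain r where r: "r \<in> V" "n * card (unjoined m V H r) \<le> P"
  proof -
    obtain r where "r \<in> V" "\<And>u. u \<in> V \<Longrightarrow> card (unjoined m V H r) \<le> card (unjoined m V H u)"
      using arg_min_if_finite(1)[OF fin, of "\<lambda>u. card (unjoined m V H u)"]
        arg_min_least[OF fin, of _ "\<lambda>u. card (unjoined m V H u)"] by blast
    moreover from this have "n * card (unjoined m V H r) \<le> P"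
      unfolding n_def P_def card_unjoined_pairs[OF fin(1)]
      by (intro sum_bounded_below[of _ "card (unjoined m V H r)", simplified]) auto
    ultimately show ?thesis using that by blast
  qed
  obtain V' A par tp and h :: "'a \<Rightarrow> nat" where p: "pendant H V' A par tp h" "V' \<subseteq> V"
    "card V \<le> card V' + card (unjoined m V H r)" "card V' \<le> card H + 1"
    "card A \<le> 1 + card (unjoined m V H r) + 2 * (m - 1) * (card H + 1 - card V')"
    by (rule pendant_structure[of V r m H]) (use assms r in auto)
  interpret pendant H V' A par tp h by (rule p)
  define W where "W = {v \<in> V'. 2 * h v < m - 1}"
  define D where "D = {v \<in> V'. m - 1 \<le> 2 * h v}"
  have "card V' \<le> card W + card D"
  proof -
    have "V' = W \<union> D" by (auto simp: W_def D_def)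
    then show ?thesis using card_Un_le[of W D] by simp
  qed
  moreover have "(card W)\<^sup>2 \<le> card A * (P + 3 * n)"
    unfolding W_def P_def n_def using fin p m by (intro card_shallow) auto
  moreover have "\<exists>g q. g \<le> card D \<and> (card D - g) * \<Theta> \<le> P + 2 * card H \<and>
      q * card D \<le> P + q * (\<Theta> + 2) \<and> g\<^sup>2 \<le> q * (P + n)" for \<Theta>
    unfolding D_def P_def n_def by (rule card_deep[OF fin(1) p(2) m H, of \<Theta>]) blast+
  moreover have "card V' \<le> n" unfolding n_def using fin p by (intro card_mono) auto
  ultimately show ?thesis
    using r p unfolding n_def[symmetric] by (intro that[of "card (unjoined m V H r)" "card V'" "card A" "card W" "card D"]) auto
qed

section \<open>Saturated graphs and the union bound\<close>

lemma finite_all_pairs [simp]: "finite (all_pairs n)"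
  by (rule finite_subset[of _ "Pow {1..n}"]) (auto simp: all_pairs_def)

lemma doubleton_in_all_pairs:
  "{u, v} \<in> all_pairs n \<longleftrightarrow> u \<in> {1..n} \<and> v \<in> {1..n} \<and> u \<noteq> v"
proof
  assume *: "u \<in> {1..n} \<and> v \<in> {1..n} \<and> u \<noteq> v"
  then consider "u < v" | "v < u" by linarith
  then show "{u, v} \<in> all_pairs n"
  proof cases
    case 1
    then show ?thesis unfolding all_pairs_def using *
      by (intro CollectI exI[of _ u] exI[of _ v]) auto
  next
    case 2
    then show ?thesis unfolding all_pairs_def using *
      by (intro CollectI exI[of _ v] exI[of _ u]) auto
  qed
qed (auto simp: all_pairs_def doubleton_eq_iff)

lemma all_pairsE:
  assumes "e \<in> all_pairs n"
  shows "\<exists>u v. e = {u, v} \<and> u \<in> {1..n} \<and> v \<in> {1..n} \<and> u \<noteq> v"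
  using assms unfolding all_pairs_def by force

lemma card_all_pairs_le: "card (all_pairs n) \<le> n\<^sup>2"
proof -
  have "card (all_pairs n) \<le> card ((\<lambda>(i, j). {i, j}) ` ({1..n} \<times> {1..n}))"
    by (intro card_mono) (force simp: all_pairs_def)+
  also have "\<dots> \<le> card ({1..n} \<times> {1..n})" by (intro card_image_le) auto
  finally show ?thesis by (simp add: power2_eq_square)
qed

lemma hpath_imp_has_cycle:
  assumes "hpath m H u v" "3 \<le> m"
  shows "has_cycle m (insert {u, v} H)"
proof -
  obtain vs where vs: "length vs = m" "distinct vs"
    "\<forall>i. Suc i < m \<longrightarrow> {vs ! i, vs ! Suc i} \<in> H" "vs ! 0 = u" "vs ! (m - 1) = v"
    using assms unfolding hpath_def by blast
  have "{vs ! i, vs ! ((i + 1) mod m)} \<in> insert {u, v} H" if "i < m" for i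
  proof (cases "Suc i < m")
    case True
    then show ?thesis using vs by simp
  next
    case False
    then have "i = m - 1" using that by simp
    then show ?thesis using vs assms by (simp add: insert_commute)
  qed
  then show ?thesis unfolding has_cycle_def using vs by blast
qed

text \<open>As \<open>H\<close> has no cycle of length \<open>m\<close>, the new cycle uses the edge
  \<open>{u, v}\<close>. Rotated to begin just after this edge, the cycle becomes a path, whose
  other edges all lie in \<open>H\<close> because they differ from \<open>{u, v}\<close>.\<close>

lemma saturated_imp_hpath:
  assumes sat: "cycle_saturated m G H" and m: "3 \<le> m"
    and uv: "{u, v} \<in> G" "{u, v} \<notin> H"
  shows "hpath m H u v"
proof -
  have "has_cycle m (insert {u, v} H)" "\<not> has_cycle m H"
    using sat uv by (auto simp: cycle_saturated_def)
  then obtain vs i where vs: "length vs = m" "distinct vs"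
    "\<forall>i<m. {vs ! i, vs ! ((i + 1) mod m)} \<in> insert {u, v} H"
    and i: "i < m" "{vs ! i, vs ! ((i + 1) mod m)} \<notin> H"
    unfolding has_cycle_def by metis
  have e: "{vs ! i, vs ! ((i + 1) mod m)} = {u, v}" using vs i by blast
  define ws where "ws = rotate (i + 1) vs"
  have nth: "ws ! j = vs ! ((i + 1 + j) mod m)" if "j < m" for j
    unfolding ws_def using that vs by (subst nth_rotate) auto
  have inH: "{ws ! j, ws ! Suc j} \<in> H" if "Suc j < m" for j
  proof -
    define a where "a = (i + 1 + j) mod m"
    have a: "a < m" using m by (simp add: a_def)
    have e1: "{ws ! j, ws ! Suc j} = {vs ! a, vs ! ((a + 1) mod m)}"
      using nth[of j] nth[of "Suc j"] that by (simp add: a_def mod_Suc_eq)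
    have "{vs ! a, vs ! ((a + 1) mod m)} \<noteq> {u, v}"
    proof
      assume "{vs ! a, vs ! ((a + 1) mod m)} = {u, v}"
      then have "(vs ! a = vs ! i) \<or> (vs ! a = vs ! ((i + 1) mod m) \<and> vs ! ((a + 1) mod m) = vs ! i)"
        unfolding e[symmetric] by (auto simp: doubleton_eq_iff)
      moreover have "(i + 1) mod m < m" "(a + 1) mod m < m" using m by auto
      ultimately have "a = i \<or> (a = (i + 1) mod m \<and> (a + 1) mod m = i)"
        using vs(1,2) a i by (simp add: nth_eq_iff_index_eq)
      then show False
      proof
        assume "a = i"
        moreover have "a = (if i + 1 + j < m then i + 1 + j else i + 1 + j - m)"
          using i that by (simp add: a_def mod_if)
        ultimately show False using i that by (simp split: if_splits)
      next
        \<comment> \<open>The edge \<open>{u, v}\<close> would be traversed a second time backwards,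
          so that two steps lead back to \<open>i\<close>; this is impossible for
          \<open>m \<ge> 3\<close>.\<close>
        assume *: "a = (i + 1) mod m \<and> (a + 1) mod m = i"
        then show False using i m by (cases "i + 1 < m"; cases "i + 2 < m") (auto simp: mod_if split: if_splits)
      qed
    qed
    then show ?thesis using vs(3) a unfolding e1 by blast
  qed
  have "hpath m H (ws ! 0) (ws ! (m - 1))"
    unfolding hpath_def using inH vs by (intro exI[of _ ws]) (auto simp: ws_def)
  moreover have "ws ! 0 = vs ! ((i + 1) mod m)" "ws ! (m - 1) = vs ! i"
    using nth[of 0] nth[of "m - 1"] m i by auto
  ultimately have "hpath m H (vs ! ((i + 1) mod m)) (vs ! i)" by simp
  then show ?thesis using e hpath_sym by (metis doubleton_eq_iff)
qed

text \<open>No \<open>G\<close> occurs here: for each fixed \<open>H\<close> this is a fixed set of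
  pairs, which a \<open>G\<close> with \<open>H\<close> saturated must avoid.\<close>

definition unjoined_edges :: "nat \<Rightarrow> nat \<Rightarrow> nat set set \<Rightarrow> nat set set" where
  "unjoined_edges m n H = {e \<in> all_pairs n. e \<notin> H \<and> (\<forall>u v. e = {u, v} \<longrightarrow> \<not> hpath m H u v)}"

lemma card_unjoined_pairs_le: "card (unjoined_pairs m {1..n} H) \<le> 2 * card (unjoined_edges m n H)"
proof -
  have fin: "finite (unjoined_edges m n H)" by (simp add: unjoined_edges_def)
  have two: "card {(v, w). {v, w} = e} \<le> 2 \<and> finite {(v, w). {v, w} = e}" if e: "e \<in> unjoined_edges m n H" for e
  proof -
    obtain a b where ab: "e = {a, b}" using e all_pairsE unfolding unjoined_edges_def by blast
    have "{(v, w). {v, w} = e} = {(a, b), (b, a)}" by (auto simp: ab doubleton_eq_iff)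
    moreover have "card {(a, b), (b, a)} \<le> 2"
      using card_length[of "[(a, b), (b, a)]"] by (simp only: list.set list.size)
    ultimately show ?thesis by (simp only: finite.emptyI finite.insertI)
  qed
  have "unjoined_pairs m {1..n} H \<subseteq> (\<Union>e\<in>unjoined_edges m n H. {(v, w). {v, w} = e})"
  proof
    fix x assume "x \<in> unjoined_pairs m {1..n} H"
    then obtain u v where x: "x = (u, v)" "u \<in> {1..n}" "v \<in> {1..n}" "v \<noteq> u" "{u, v} \<notin> H" "\<not> hpath m H u v"
      by (auto simp: unjoined_pairs_def unjoined_def)
    then have "{u, v} \<in> unjoined_edges m n H"
      unfolding unjoined_edges_def using hpath_sym[of m H v u]
      by (auto simp: doubleton_in_all_pairs doubleton_eq_iff)
    then show "x \<in> (\<Union>e\<in>unjoined_edges m n H. {(v, w). {v, w} = e})" using x by auto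
  qed
  then have "card (unjoined_pairs m {1..n} H) \<le> card (\<Union>e\<in>unjoined_edges m n H. {(v, w). {v, w} = e})"
    using fin two by (intro card_mono) auto
  also have "\<dots> \<le> (\<Sum>e\<in>unjoined_edges m n H. card {(v, w). {v, w} = e})" using fin by (rule card_UN_le)
  also have "\<dots> \<le> (\<Sum>e\<in>unjoined_edges m n H. 2)" using two by (intro sum_mono) auto
  finally show ?thesis by simp
qed

lemma saturated_unjoined_edges_disjoint:
  assumes "cycle_saturated m G H" "3 \<le> m"
  shows "G \<inter> unjoined_edges m n H = {}"
proof -
  have False if e: "e \<in> G" "e \<in> unjoined_edges m n H" for e
  proof -
    obtain u v where uv: "e = {u, v}" using e all_pairsE unfolding unjoined_edges_def by blast
    then have "hpath m H u v" using saturated_imp_hpath[OF assms, of u v] e by (auto simp: unjoined_edges_def)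
    then show False using e uv by (auto simp: unjoined_edges_def)
  qed
  then show ?thesis by blast
qed

lemma sum_power_card_Pow:
  assumes "finite E"
  shows "(\<Sum>H\<in>Pow E. x ^ card H) = (1 + x :: real) ^ card E"
proof -
  have "(1 + x) ^ card E = (\<Prod>e\<in>E. x + 1)" by (simp add: add.commute)
  also have "\<dots> = (\<Sum>H\<in>Pow E. (\<Prod>i\<in>H. x) * (\<Prod>i\<in>E - H. 1))" using assms by (rule prod_add)
  finally show ?thesis by simp
qed

text \<open>Each graph counted has weight \<open>real n powr M * (1 / real n) ^ card H\<close> at
  least 1, and the sum of the weights over all graphs factorises over the pairs.\<close>

lemma card_sparse_graphs_le:
  assumes "1 \<le> n"
  shows "real (card {H \<in> Pow (all_pairs n). real (card H) \<le> M}) \<le> real n powr M * exp (real n)"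
proof -
  have n: "real n \<ge> 1" using assms by simp
  have "real (card {H \<in> Pow (all_pairs n). real (card H) \<le> M})
      = (\<Sum>H\<in>{H \<in> Pow (all_pairs n). real (card H) \<le> M}. 1)" by simp
  also have "\<dots> \<le> (\<Sum>H\<in>{H \<in> Pow (all_pairs n). real (card H) \<le> M}. real n powr M * (1 / real n) ^ card H)"
  proof (rule sum_mono)
    fix H assume "H \<in> {H \<in> Pow (all_pairs n). real (card H) \<le> M}"
    then have "real n powr real (card H) \<le> real n powr M" using n by (intro powr_mono) auto
    then show "1 \<le> real n powr M * (1 / real n) ^ card H"
      using n by (simp add: powr_realpow power_divide field_simps)
  qed
  also have "\<dots> \<le> (\<Sum>H\<in>Pow (all_pairs n). real n powr M * (1 / real n) ^ card H)"
    by (intro sum_mono2) auto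
  also have "\<dots> = real n powr M * (1 + 1 / real n) ^ card (all_pairs n)"
    by (simp add: sum_distrib_left[symmetric] sum_power_card_Pow)
  also have "\<dots> \<le> real n powr M * (1 + 1 / real n) ^ n\<^sup>2"
    by (intro mult_left_mono power_increasing card_all_pairs_le) auto
  also have "\<dots> \<le> real n powr M * exp (1 / real n) ^ n\<^sup>2"
    by (intro mult_left_mono power_mono exp_ge_add_one_self) auto
  also have "exp (1 / real n) ^ n\<^sup>2 = exp (real n)"
    using n by (simp add: exp_of_nat_mult[symmetric] power2_eq_square)
  finally show ?thesis .
qed

text \<open>A union bound over all sparse \<open>H\<close> with at least \<open>F\<close> unjoined
  edges: \<open>G\<close> must avoid these edges. The factor 2 in the event passes from ordered
  pairs to edges.\<close>

lemma prob_sparse_saturated_le: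
  assumes "0 < p" "p < 1" "1 \<le> n" "3 \<le> m"
  shows "measure_pmf.prob (gnp n p) {G. \<exists>H. cycle_saturated m G H \<and> real (card H) \<le> M \<and>
      2 * F \<le> real (card (unjoined_pairs m {1..n} H))} \<le> real n powr M * exp (real n) * (1 - p) powr F"
proof -
  define HH where "HH = {H \<in> Pow (all_pairs n). real (card H) \<le> M \<and> F \<le> real (card (unjoined_edges m n H))}"
  have fin: "finite HH" unfolding HH_def by simp
  have "measure_pmf.prob (gnp n p) {G. \<exists>H. cycle_saturated m G H \<and> real (card H) \<le> M \<and>
      2 * F \<le> real (card (unjoined_pairs m {1..n} H))}
      \<le> measure_pmf.prob (gnp n p) (\<Union>H\<in>HH. {G. G \<inter> unjoined_edges m n H = {}})"
  proof (rule measure_pmf.finite_measure_mono_AE)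
    show "AE G in measure_pmf (gnp n p). G \<in> {G. \<exists>H. cycle_saturated m G H \<and> real (card H) \<le> M \<and>
      2 * F \<le> real (card (unjoined_pairs m {1..n} H))} \<longrightarrow> G \<in> (\<Union>H\<in>HH. {G. G \<inter> unjoined_edges m n H = {}})"
    proof (unfold AE_measure_pmf_iff, intro ballI impI)
      fix G assume G: "G \<in> set_pmf (gnp n p)" "G \<in> {G. \<exists>H. cycle_saturated m G H \<and> real (card H) \<le> M \<and>
        2 * F \<le> real (card (unjoined_pairs m {1..n} H))}"
      then obtain H where H: "cycle_saturated m G H" "real (card H) \<le> M"
        "2 * F \<le> real (card (unjoined_pairs m {1..n} H))" by blast
      have "G \<subseteq> all_pairs n" using G(1) set_pmf_random_subset_subset unfolding gnp_eq_random_subset by blast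
      then have "H \<subseteq> all_pairs n" using H by (auto simp: cycle_saturated_def)
      moreover have "F \<le> real (card (unjoined_edges m n H))" using H(3) card_unjoined_pairs_le[of m n H] by linarith
      ultimately have "H \<in> HH" using H by (auto simp: HH_def)
      then show "G \<in> (\<Union>H\<in>HH. {G. G \<inter> unjoined_edges m n H = {}})"
        using saturated_unjoined_edges_disjoint[OF H(1) assms(4)] by blast
    qed
  qed auto
  also have "\<dots> \<le> (\<Sum>H\<in>HH. measure_pmf.prob (gnp n p) {G. G \<inter> unjoined_edges m n H = {}})"
    using fin by (intro measure_UNION_le) auto
  also have "\<dots> \<le> (\<Sum>H\<in>HH. (1 - p) powr F)"
  proof (rule sum_mono)
    fix H assume H: "H \<in> HH"
    have "measure_pmf.prob (gnp n p) {G. G \<inter> unjoined_edges m n H = {}} = (1 - p) ^ card (unjoined_edges m n H)"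
      unfolding gnp_eq_random_subset using assms by (intro prob_random_subset_disjoint) (auto simp: unjoined_edges_def)
    also have "\<dots> = (1 - p) powr real (card (unjoined_edges m n H))" using assms by (simp add: powr_realpow)
    also have "\<dots> \<le> (1 - p) powr F" using assms H by (intro powr_mono') (auto simp: HH_def)
    finally show "measure_pmf.prob (gnp n p) {G. G \<inter> unjoined_edges m n H = {}} \<le> (1 - p) powr F" .
  qed
  also have "\<dots> = real (card HH) * (1 - p) powr F" by simp
  also have "\<dots> \<le> real (card {H \<in> Pow (all_pairs n). real (card H) \<le> M}) * (1 - p) powr F"
    by (intro mult_right_mono of_nat_mono card_mono) (auto simp: HH_def)
  also have "\<dots> \<le> real n powr M * exp (real n) * (1 - p) powr F"
    using assms by (intro mult_right_mono card_sparse_graphs_le) auto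
  finally show ?thesis .
qed

section \<open>Numerical side of the lower bound\<close>

lemma lower_bound_numeric:
  fixes n l e \<delta> m1 P hH :: real and v' a w D k :: nat
  assumes n: "0 < n" and l: "0 < l" and e: "0 < e" "e < 1" and \<delta>: "\<delta> = e / 16" and m1: "1 \<le> m1"
    and P: "0 \<le> P" "P \<le> (2 + e) * n * l" and hH: "hH \<le> n + (1 - e) * n / (4 * m1 * l)"
    and k: "n * real k \<le> P" "n \<le> real v' + real k" "real v' \<le> hH + 1"
    and a: "real a \<le> 1 + real k + 2 * m1 * (hH + 1 - real v')"
    and w: "real v' \<le> real w + real D" "(real w)\<^sup>2 \<le> real a * (P + 3 * n)"
    and deep: "\<And>\<Theta>::nat. \<exists>g q::nat. g \<le> D \<and> (real D - real g) * real \<Theta> \<le> P + 2 * hH \<and>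
        real q * real D \<le> P + real q * (real \<Theta> + 2) \<and> (real g)\<^sup>2 \<le> real q * (P + n)"
    and I1: "8 / \<delta> \<le> n" and I2: "(1 - e) * n / (4 * m1 * l) \<le> n"
    and I3: "(24 * l + 32) / \<delta> \<le> \<delta> * n / 2"
    and I4: "6 * l / \<delta> * (3 * n * l + n) < (\<delta> * n / 2)\<^sup>2"
    and I5: "3 * l \<le> n * (1 - \<delta>)"
    and I6: "((1 - e) * n / (2 * l) + 1 + 3 * l + 2 * m1 * (1 + 3 * l)) * ((2 + e) * n * l + 3 * n)
              < (n * (1 - \<delta>) - 3 * l)\<^sup>2"
  shows False
proof -
  have \<delta>0: "0 < \<delta>" using e \<delta> by simp
  have P3: "P \<le> 3 * n * l"
  proof -
    have "(2 + e) * (n * l) \<le> 3 * (n * l)" using e n l by (intro mult_right_mono) auto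
    then show ?thesis using P by (simp add: mult.assoc)
  qed
  have "n * real k \<le> n * (3 * l)" using k(1) P3 by (simp add: algebra_simps)
  then have k3: "real k \<le> 3 * l" using n by simp
  \<comment> \<open>Otherwise, with \<open>\<Theta>\<close> linear in \<open>n\<close>, all but O(l)
    deep vertices count in \<open>g\<close>, while \<open>q\<close> is O(l). Then
    \<open>g\<^sup>2\<close>, of order n^2, is at most \<open>real q * (P + n)\<close>, of order n
    l^2.\<close>
  have Dle: "real D \<le> \<delta> * n"
  proof (rule ccontr)
    assume "\<not> real D \<le> \<delta> * n"
    then have D: "\<delta> * n < real D" by simp
    \<comment> \<open>Large enough to make \<open>D - g\<close> of order \<open>l\<close>, yet small
      enough that \<open>D - \<Theta> - 2\<close> is still at least
      \<open>\<delta> * n / 2\<close>.\<close>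
    define \<Theta> where "\<Theta> = nat \<lfloor>\<delta> * n / 4\<rfloor>"
    have dn: "8 \<le> \<delta> * n" using I1 \<delta>0 by (simp add: field_simps)
    have T1: "real \<Theta> \<le> \<delta> * n / 4" "\<delta> * n / 4 - 1 \<le> real \<Theta>" using dn by (auto simp: \<Theta>_def) linarith
    have T2: "\<delta> * n / 8 \<le> real \<Theta>" using T1 dn by linarith
    obtain g q :: nat where g: "g \<le> D" "(real D - real g) * real \<Theta> \<le> P + 2 * hH"
      and q: "real q * real D \<le> P + real q * (real \<Theta> + 2)" and gq: "(real g)\<^sup>2 \<le> real q * (P + n)"
      using deep[of \<Theta>] by blast
    have "(real D - real g) * (\<delta> * n / 8) \<le> (real D - real g) * real \<Theta>"
      using T2 g by (intro mult_left_mono) auto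
    also have "\<dots> \<le> 3 * n * l + 4 * n" using g P3 hH I2 by linarith
    finally have "(real D - real g) * \<delta> * n \<le> (24 * l + 32) * n" by (simp add: algebra_simps)
    then have "(real D - real g) * \<delta> \<le> 24 * l + 32" using n by simp
    then have "real D - real g \<le> (24 * l + 32) / \<delta>" using \<delta>0 by (simp add: field_simps)
    then have g2: "\<delta> * n / 2 \<le> real g" using I3 D by linarith
    have "real q * (\<delta> * n / 2) \<le> real q * (real D - real \<Theta> - 2)"
      using D T1 dn by (intro mult_left_mono) auto
    also have "\<dots> \<le> 3 * n * l" using q P3 by (simp add: algebra_simps)
    finally have "real q * \<delta> * n \<le> 6 * l * n" by (simp add: algebra_simps)
    then have "real q * \<delta> \<le> 6 * l" using n by simp
    then have q2: "real q \<le> 6 * l / \<delta>" using \<delta>0 by (simp add: field_simps)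
    have "(\<delta> * n / 2)\<^sup>2 \<le> (real g)\<^sup>2" using g2 dn by (intro power_mono) auto
    also have "\<dots> \<le> real q * (P + n)" by (rule gq)
    also have "\<dots> \<le> 6 * l / \<delta> * (3 * n * l + n)"
      using q2 P P3 n l \<delta>0 by (intro mult_mono) auto
    finally show False using I4 by simp
  qed
  have w1: "n * (1 - \<delta>) - 3 * l \<le> real w" using w(1) k(2) k3 Dle by (simp add: algebra_simps)
  \<comment> \<open>\<open>hH + 1 - real v'\<close> counts the non-tree edges. At most
    \<open>3 * l\<close> vertices are missing from \<open>v'\<close>, so it exceeds the surplus
    \<open>hH - n\<close> by at most \<open>1 + 3 * l\<close>.\<close>
  have "2 * m1 * (hH + 1 - real v') \<le> 2 * m1 * ((1 - e) * n / (4 * m1 * l) + 1 + 3 * l)"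
    using hH k k3 m1 by (intro mult_left_mono) auto
  also have "\<dots> = (1 - e) * n / (2 * l) + 2 * m1 * (1 + 3 * l)"
    using m1 l by (simp add: field_simps)
  finally have a1: "real a \<le> (1 - e) * n / (2 * l) + 1 + 3 * l + 2 * m1 * (1 + 3 * l)"
    using a k3 by linarith
  have "(n * (1 - \<delta>) - 3 * l)\<^sup>2 \<le> (real w)\<^sup>2" using w1 I5 by (intro power_mono) auto
  also have "\<dots> \<le> real a * (P + 3 * n)" by (rule w)
  also have "\<dots> \<le> ((1 - e) * n / (2 * l) + 1 + 3 * l + 2 * m1 * (1 + 3 * l)) * ((2 + e) * n * l + 3 * n)"
    using a1 P n by (intro mult_mono) auto
  finally show False using I6 by simp
qed

text \<open>Only the last claim is delicate. Divided by n^2, its two sides tend to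
  \<open>(1 - e) / 2 * (2 + e)\<close> and \<open>(1 - \<delta>)\<^sup>2\<close>; the value
  \<open>1 - e / 2\<close> separates these limits, and \<open>\<delta> = e / 16\<close> is small
  enough for that.\<close>

lemma lower_bound_asymptotics:
  fixes c e \<delta> m1 :: real
  assumes "0 < c" "0 < e" "e < 1" "0 < \<delta>" "\<delta> = e / 16" "1 \<le> m1"
  defines "l \<equiv> (\<lambda>n::nat. c * ln (real n))"
  shows "eventually (\<lambda>n. 8 / \<delta> \<le> real n) at_top"
    and "eventually (\<lambda>n. (1 - e) * real n / (4 * m1 * l n) \<le> real n) at_top"
    and "eventually (\<lambda>n. (24 * l n + 32) / \<delta> \<le> \<delta> * real n / 2) at_top"
    and "eventually (\<lambda>n. 6 * l n / \<delta> * (3 * real n * l n + real n) < (\<delta> * real n / 2)\<^sup>2) at_top"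
    and "eventually (\<lambda>n. 3 * l n \<le> real n * (1 - \<delta>)) at_top"
    and "eventually (\<lambda>n. ((1 - e) * real n / (2 * l n) + 1 + 3 * l n + 2 * m1 * (1 + 3 * l n)) *
          ((2 + e) * real n * l n + 3 * real n) < (real n * (1 - \<delta>) - 3 * l n)\<^sup>2) at_top"
proof -
  have d1: "1 - \<delta> > 0" using assms by simp
  show "eventually (\<lambda>n. 8 / \<delta> \<le> real n) at_top" by real_asymp
  show "eventually (\<lambda>n. (1 - e) * real n / (4 * m1 * l n) \<le> real n) at_top"
    unfolding l_def using assms(1-4,6) by real_asymp
  show "eventually (\<lambda>n. (24 * l n + 32) / \<delta> \<le> \<delta> * real n / 2) at_top"
    unfolding l_def using assms(1-4) by real_asymp
  show "eventually (\<lambda>n. 6 * l n / \<delta> * (3 * real n * l n + real n) < (\<delta> * real n / 2)\<^sup>2) at_top"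
    unfolding l_def using assms(1-4) by real_asymp
  show "eventually (\<lambda>n. 3 * l n \<le> real n * (1 - \<delta>)) at_top"
    unfolding l_def using assms(1-4) d1 by real_asymp
  have lim1: "(\<lambda>n. ((1 - e) / 2 + (1 + 3 * l n + 2 * m1 * (1 + 3 * l n)) * l n / real n) *
          ((2 + e) + 3 / l n)) \<longlonglongrightarrow> ((1 - e) / 2 + 0) * ((2 + e) + 0)"
  proof (intro tendsto_intros)
    show "(\<lambda>n. (1 + 3 * l n + 2 * m1 * (1 + 3 * l n)) * l n / real n) \<longlonglongrightarrow> 0"
      unfolding l_def using assms(1-4,6) by real_asymp
    show "(\<lambda>n. 3 / l n) \<longlonglongrightarrow> 0" unfolding l_def using assms(1-4,6) by real_asymp
  qed
  have lim2: "(\<lambda>n. ((1 - \<delta>) - 3 * l n / real n)\<^sup>2) \<longlonglongrightarrow> ((1 - \<delta>) - 0)\<^sup>2"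
  proof (intro tendsto_intros)
    show "(\<lambda>n. 3 * l n / real n) \<longlonglongrightarrow> 0" unfolding l_def using assms(1-4,6) by real_asymp
  qed
  have "((1 - e) / 2 + 0) * ((2 + e) + 0) < 1 - e / 2"
    using assms by (simp add: field_simps)
  then have e1: "eventually (\<lambda>n. ((1 - e) / 2 + (1 + 3 * l n + 2 * m1 * (1 + 3 * l n)) * l n / real n) *
          ((2 + e) + 3 / l n) < 1 - e / 2) at_top"
    by (rule order_tendstoD(2)[OF lim1])
  have "1 - e / 2 < ((1 - \<delta>) - 0)\<^sup>2"
  proof -
    have "((1 - \<delta>) - 0)\<^sup>2 = 1 - e / 8 + \<delta>\<^sup>2" using assms(5) by (simp add: power2_eq_square algebra_simps)
    then show ?thesis using assms(2) zero_le_power2[of \<delta>] by linarith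
  qed
  then have e2: "eventually (\<lambda>n. 1 - e / 2 < ((1 - \<delta>) - 3 * l n / real n)\<^sup>2) at_top"
    by (rule order_tendstoD(1)[OF lim2])
  have e3: "eventually (\<lambda>n. 0 < l n \<and> 0 < real n) at_top"
    unfolding l_def using assms(1) by (intro eventually_conj) real_asymp+
  show "eventually (\<lambda>n. ((1 - e) * real n / (2 * l n) + 1 + 3 * l n + 2 * m1 * (1 + 3 * l n)) *
          ((2 + e) * real n * l n + 3 * real n) < (real n * (1 - \<delta>) - 3 * l n)\<^sup>2) at_top"
    using e1 e2 e3
  proof eventually_elim
    case (elim n)
    define x where "x = real n"
    define y where "y = l n"
    have xy: "0 < x" "0 < y" using elim by (auto simp: x_def y_def)
    have "((1 - e) * x / (2 * y) + 1 + 3 * y + 2 * m1 * (1 + 3 * y)) * ((2 + e) * x * y + 3 * x)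
       = x\<^sup>2 * (((1 - e) / 2 + (1 + 3 * y + 2 * m1 * (1 + 3 * y)) * y / x) * ((2 + e) + 3 / y))"
    proof -
      have A: "(1 - e) * x / (2 * y) + 1 + 3 * y + 2 * m1 * (1 + 3 * y) =
        (x / y) * ((1 - e) / 2 + (1 + 3 * y + 2 * m1 * (1 + 3 * y)) * y / x)"
        using xy by (simp add: field_simps)
      have B: "(2 + e) * x * y + 3 * x = x * y * ((2 + e) + 3 / y)" using xy by (simp add: field_simps)
      show ?thesis unfolding A B using xy by (simp add: power2_eq_square)
    qed
    also have "\<dots> < x\<^sup>2 * ((1 - \<delta>) - 3 * y / x)\<^sup>2"
      using elim xy unfolding x_def[symmetric] y_def[symmetric] by (intro mult_strict_left_mono) auto
    also have "\<dots> = (x * (1 - \<delta>) - 3 * y)\<^sup>2"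
      using xy by (simp add: power_mult_distrib[symmetric] algebra_simps)
    finally show ?case by (simp add: x_def y_def)
  qed
qed

lemma sparse_saturated_rare:
  fixes p e :: real and m :: nat
  assumes p: "0 < p" "p < 1" and m: "5 \<le> m" and e: "0 < e" "e < 1"
  defines "L \<equiv> (\<lambda>n::nat. log (1 / (1 - p)) (real n))"
  shows "(\<lambda>n. measure_pmf.prob (gnp n p) {G. \<exists>H. cycle_saturated m G H \<and>
     real (card H) \<le> real n + (1 - e) * real n / (4 * (real m - 1) * L n)}) \<longlonglongrightarrow> 0"
proof -
  define c where "c = 1 / ln (1 / (1 - p))"
  have c: "0 < c" using p by (simp add: c_def)
  have lnp: "ln (1 - p) = - 1 / c" using p by (simp add: c_def ln_div)
  have L: "L n = c * ln (real n)" for n by (simp add: L_def log_def c_def)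
  define m1 where "m1 = real m - 1"
  have m1: "1 \<le> m1" using m by (simp add: m1_def)
  define \<delta> where "\<delta> = e / 16"
  have \<delta>: "0 < \<delta>" using e by (simp add: \<delta>_def)
  define M where "M = (\<lambda>n::nat. real n + (1 - e) * real n / (4 * m1 * L n))"
  \<comment> \<open>\<open>(1 - p) powr (real n * L n)\<close> is n^(-n), which just cancels the
    main factor of the number of graphs; the excess \<open>e / 2\<close> makes the product tend to
    0.\<close>
  define F where "F = (\<lambda>n::nat. (1 + e / 2) * real n * L n)"
  define ub where "ub = (\<lambda>n::nat. real n powr M n * exp (real n) * (1 - p) powr F n)"
  note I = lower_bound_asymptotics[OF c e \<delta> \<delta>_def m1, folded L]
  have Lpos: "eventually (\<lambda>n. 0 < L n \<and> 1 \<le> n) at_top"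
    unfolding L using c by (intro eventually_conj) real_asymp+
  have bound: "eventually (\<lambda>n. measure_pmf.prob (gnp n p) {G. \<exists>H. cycle_saturated m G H \<and>
     real (card H) \<le> real n + (1 - e) * real n / (4 * (real m - 1) * L n)} \<le> ub n) at_top"
    using I Lpos
  proof eventually_elim
    case (elim n)
    have n: "1 \<le> n" "0 < L n" using elim by auto
    have "measure_pmf.prob (gnp n p) {G. \<exists>H. cycle_saturated m G H \<and>
        real (card H) \<le> real n + (1 - e) * real n / (4 * (real m - 1) * L n)}
      \<le> measure_pmf.prob (gnp n p) {G. \<exists>H. cycle_saturated m G H \<and> real (card H) \<le> M n \<and>
        2 * F n \<le> real (card (unjoined_pairs m {1..n} H))}"
    proof (rule measure_pmf.finite_measure_mono_AE)
      show "AE G in measure_pmf (gnp n p). G \<in> {G. \<exists>H. cycle_saturated m G H \<and>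
        real (card H) \<le> real n + (1 - e) * real n / (4 * (real m - 1) * L n)} \<longrightarrow>
        G \<in> {G. \<exists>H. cycle_saturated m G H \<and> real (card H) \<le> M n \<and>
        2 * F n \<le> real (card (unjoined_pairs m {1..n} H))}"
      proof (unfold AE_measure_pmf_iff, intro ballI impI)
        fix G assume G: "G \<in> set_pmf (gnp n p)" "G \<in> {G. \<exists>H. cycle_saturated m G H \<and>
          real (card H) \<le> real n + (1 - e) * real n / (4 * (real m - 1) * L n)}"
        then obtain H where H: "cycle_saturated m G H" "real (card H) \<le> M n"
          unfolding M_def m1_def by blast
        have "G \<subseteq> all_pairs n" using G(1) set_pmf_random_subset_subset unfolding gnp_eq_random_subset by blast
        then have Hsub: "H \<subseteq> all_pairs n" using H by (auto simp: cycle_saturated_def)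
        have "2 * F n \<le> real (card (unjoined_pairs m {1..n} H))"
        proof (rule ccontr)
          assume neg: "\<not> 2 * F n \<le> real (card (unjoined_pairs m {1..n} H))"
          let ?P = "card (unjoined_pairs m {1..n} H)"
          have HV: "\<exists>u v. e = {u, v} \<and> u \<in> {1..n} \<and> v \<in> {1..n} \<and> u \<noteq> v" if "e \<in> H" for e
            using that Hsub all_pairsE by blast
          have cn: "card {1..n} = n" and ne: "{1..n} \<noteq> {}" and m4: "4 < m" using n m by auto
          note st = lower_bound_structure[of "{1..n}" m H, OF finite_atLeastAtMost ne m4 HV, unfolded cn]
          obtain v' a w D k :: nat where s: "n * k \<le> ?P" "n \<le> v' + k" "v' \<le> n" "v' \<le> card H + 1"
            "a \<le> 1 + k + 2 * (m - 1) * (card H + 1 - v')" "v' \<le> w + D" "w\<^sup>2 \<le> a * (?P + 3 * n)"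
            and deep: "\<And>\<Theta>. \<exists>g q. g \<le> D \<and> (D - g) * \<Theta> \<le> ?P + 2 * card H \<and>
               q * D \<le> ?P + q * (\<Theta> + 2) \<and> g\<^sup>2 \<le> q * (?P + n)"
            by (rule st, assumption) (rule that; assumption)
          show False
          proof (rule lower_bound_numeric[of "real n" "L n" e \<delta> m1 "real ?P" "real (card H)" k v' a w D])
            show "real ?P \<le> (2 + e) * real n * L n"
              using neg by (simp add: F_def algebra_simps)
            show "real (card H) \<le> real n + (1 - e) * real n / (4 * m1 * L n)"
              using H by (simp add: M_def)
            show "real n * real k \<le> real ?P" using s(1) by (metis of_nat_le_iff of_nat_mult)
            show "real n \<le> real v' + real k" using s(2) by linarith
            show "real v' \<le> real (card H) + 1" using s(4) by linarith
            have eqa: "real (2 * (m - 1) * (card H + 1 - v')) = 2 * m1 * (real (card H) + 1 - real v')"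
              unfolding of_nat_mult using s(4) m by (simp add: m1_def of_nat_diff)
            have "real a \<le> real (1 + k + 2 * (m - 1) * (card H + 1 - v'))" using s(5) by (simp only: of_nat_le_iff)
            then have "real a \<le> 1 + real k + real (2 * (m - 1) * (card H + 1 - v'))" by (simp only: of_nat_add of_nat_1)
            then show "real a \<le> 1 + real k + 2 * m1 * (real (card H) + 1 - real v')"
              unfolding eqa .
            show "real v' \<le> real w + real D" using s(6) by linarith
            have "real (w\<^sup>2) \<le> real (a * (?P + 3 * n))" using s(7) by (simp only: of_nat_le_iff)
            then show "(real w)\<^sup>2 \<le> real a * (real ?P + 3 * real n)" by simp
            fix \<Theta> :: nat
            obtain g q where g: "g \<le> D" "(D - g) * \<Theta> \<le> ?P + 2 * card H"
               "q * D \<le> ?P + q * (\<Theta> + 2)" "g\<^sup>2 \<le> q * (?P + n)" using deep[of \<Theta>] by blast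
            have "real ((D - g) * \<Theta>) \<le> real (?P + 2 * card H)" "real (q * D) \<le> real (?P + q * (\<Theta> + 2))"
              "real (g\<^sup>2) \<le> real (q * (?P + n))" using g by (simp_all only: of_nat_le_iff)
            then show "\<exists>g q. g \<le> D \<and> (real D - real g) * real \<Theta> \<le> real ?P + 2 * real (card H) \<and>
               real q * real D \<le> real ?P + real q * (real \<Theta> + 2) \<and> (real g)\<^sup>2 \<le> real q * (real ?P + real n)"
              using g(1) by (intro exI[of _ g] exI[of _ q]) (simp add: of_nat_diff algebra_simps)
          qed (((use elim e m1 in blast) | (rule \<delta>_def) | (use n in simp))+)
        qed
        then show "G \<in> {G. \<exists>H. cycle_saturated m G H \<and> real (card H) \<le> M n \<and>
          2 * F n \<le> real (card (unjoined_pairs m {1..n} H))}" using H by blast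
      qed
    qed auto
    also have "\<dots> \<le> ub n"
      unfolding ub_def using p n m by (intro prob_sparse_saturated_le) auto
    finally show ?case .
  qed
  have ub_eq: "eventually (\<lambda>n. ub n = exp (real n * ((1 - e) / (4 * m1 * c) + 1 - e / 2 * ln (real n)))) at_top"
    using Lpos
  proof eventually_elim
    case (elim n)
    then have lnn: "ln (real n) > 0" using c by (simp add: L zero_less_mult_iff)
    have n: "real n > 0" using elim by simp
    have "ub n = exp (M n * ln (real n) + real n + F n * ln (1 - p))"
      using n p by (simp add: ub_def powr_def exp_add)
    also have "M n * ln (real n) + real n + F n * ln (1 - p)
      = real n * ((1 - e) / (4 * m1 * c) + 1 - e / 2 * ln (real n))"
      unfolding M_def F_def L lnp using lnn c m1 by (simp add: field_simps)
    finally show ?case .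
  qed
  have "(\<lambda>n. exp (real n * ((1 - e) / (4 * m1 * c) + 1 - e / 2 * ln (real n)))) \<longlonglongrightarrow> 0"
    using e by real_asymp
  then have "ub \<longlonglongrightarrow> 0" using ub_eq by (subst tendsto_cong)
  then show ?thesis
    by (rule tendsto_sandwich[OF _ bound tendsto_const, rotated]) auto
qed

section \<open>A sparse saturated graph\<close>

lemma hpathI:
  assumes "length vs = m" "distinct vs" "vs \<noteq> []" "successively (\<lambda>a b. {a, b} \<in> H) vs"
  shows "hpath m H (hd vs) (last vs)"
proof -
  have "P (xs ! i) (xs ! Suc i)" if "successively P xs" "Suc i < length xs" for P and xs :: "'a list" and i
    using that
  proof (induction P xs arbitrary: i rule: successively.induct)
    case (3 P x y xs)
    then show ?case by (cases i) auto
  qed auto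
  then show ?thesis unfolding hpath_def using assms
    by (intro exI[of _ vs]) (auto simp: hd_conv_nth last_conv_nth)
qed

lemma successively_clique:
  assumes "distinct ws" "set ws \<subseteq> B" "\<And>u v. u \<in> B \<Longrightarrow> v \<in> B \<Longrightarrow> u \<noteq> v \<Longrightarrow> {u, v} \<in> H"
  shows "successively (\<lambda>a b. {a, b} \<in> H) ws"
  using assms(1,2)
proof (induction ws)
  case (Cons x ws)
  have "{x, hd ws} \<in> H" if "ws \<noteq> []"
    using Cons.prems that hd_in_set[OF that] by (intro assms(3)) auto
  then show ?case using Cons by (auto simp: successively_Cons)
qed auto

text \<open>
  A clique of \<open>m - 2\<close> hubs; the centres \<open>X\<close> are joined to the two hubs \<open>h1\<close> and \<open>h2\<close>; every other
  vertex \<open>l\<close> is a leaf attached to the centre \<open>c l\<close>.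
\<close>

locale hub_graph =
  fixes m n :: nat and G :: "nat set set" and h1 h2 :: nat and rest :: "nat list"
    and X :: "nat set" and c :: "nat \<Rightarrow> nat"
  assumes m: "5 \<le> m" and G: "G \<subseteq> all_pairs n"
    and hubs: "distinct (h1 # h2 # rest)" "length rest = m - 4"
    and hub_clique: "\<And>u v. u \<in> set (h1 # h2 # rest) \<Longrightarrow> v \<in> set (h1 # h2 # rest) \<Longrightarrow> u \<noteq> v \<Longrightarrow> {u, v} \<in> G"
    and X: "X \<subseteq> {1..n} - set (h1 # h2 # rest)" "2 \<le> card X"
    and Xadj: "\<And>x. x \<in> X \<Longrightarrow> {x, h1} \<in> G \<and> {x, h2} \<in> G"
    and leaf: "\<And>l. l \<in> {1..n} - set (h1 # h2 # rest) - X \<Longrightarrow> c l \<in> X \<and> {l, c l} \<in> G"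
    and leaf_indep: "\<And>l l'. l \<in> {1..n} - set (h1 # h2 # rest) - X \<Longrightarrow>
       l' \<in> {1..n} - set (h1 # h2 # rest) - X \<Longrightarrow> l \<noteq> l' \<Longrightarrow> c l = c l' \<Longrightarrow> {l, l'} \<notin> G"
begin

definition "B = set (h1 # h2 # rest)"
definition "Lf = {1..n} - B - X"
definition "H = {{u, v} |u v. u \<in> B \<and> v \<in> B \<and> u \<noteq> v} \<union> {{x, h} |x h. x \<in> X \<and> h \<in> {h1, h2}} \<union>
   {{l, c l} |l. l \<in> Lf}"

lemma h_in: "h1 \<in> B" "h2 \<in> B" "h1 \<noteq> h2" "set rest \<subseteq> B" using hubs by (auto simp: B_def)

lemma disj: "x \<in> X \<Longrightarrow> x \<notin> B" "x \<in> Lf \<Longrightarrow> x \<notin> B" "x \<in> Lf \<Longrightarrow> x \<notin> X" "l \<in> Lf \<Longrightarrow> c l \<in> X"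
  using X leaf by (auto simp: B_def Lf_def)

lemma H_clique: "u \<in> B \<Longrightarrow> v \<in> B \<Longrightarrow> u \<noteq> v \<Longrightarrow> {u, v} \<in> H" unfolding H_def by blast

lemma H_center: "x \<in> X \<Longrightarrow> {x, h1} \<in> H" "x \<in> X \<Longrightarrow> {x, h2} \<in> H" "x \<in> X \<Longrightarrow> {h1, x} \<in> H" "x \<in> X \<Longrightarrow> {h2, x} \<in> H"
  unfolding H_def by (auto simp: insert_commute)

lemma H_leaf: "l \<in> Lf \<Longrightarrow> {l, c l} \<in> H" "l \<in> Lf \<Longrightarrow> {c l, l} \<in> H"
  unfolding H_def by (auto simp: insert_commute)

lemma nbr_leaf: "l \<in> Lf \<Longrightarrow> {l, w} \<in> H \<Longrightarrow> w = c l"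
  using disj h_in unfolding H_def by (auto simp: doubleton_eq_iff)

lemma nbr_center: "x \<in> X \<Longrightarrow> {x, w} \<in> H \<Longrightarrow> w \<in> {h1, h2} \<union> Lf"
  using disj h_in unfolding H_def by (auto simp: doubleton_eq_iff)

lemma H_vertices: "{u, v} \<in> H \<Longrightarrow> u \<in> B \<union> X \<union> Lf"
  using disj h_in unfolding H_def by (auto simp: doubleton_eq_iff)

lemma H_sub_G: "H \<subseteq> G"
  using hub_clique Xadj leaf unfolding H_def B_def Lf_def by auto

text \<open>Leaves have degree one, so a cycle would consist of hubs and centres, and with only
  \<open>m - 2\<close> hubs it would contain two centres. Both neighbours of either centre on the
  cycle are \<open>h1\<close> and \<open>h2\<close>, which closes a cycle of length 4, shorter than
  \<open>m\<close>.\<close>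

lemma no_cycle: "\<not> has_cycle m H"
proof
  assume "has_cycle m H"
  then obtain vs where vs: "length vs = m" "distinct vs"
    and cyc: "\<And>i. i < m \<Longrightarrow> {vs ! i, vs ! ((i + 1) mod m)} \<in> H" unfolding has_cycle_def by blast
  \<comment> \<open>\<open>s\<close> and \<open>t\<close> are the cyclic successor and predecessor
    of an index.\<close>
  define s where "s = (\<lambda>i. if i = m - 1 then 0 else i + 1)"
  define t where "t = (\<lambda>i. if i = 0 then m - 1 else i - 1)"
  have st: "s i < m" "t i < m" "s i \<noteq> t i" if "i < m" for i
    using that m by (auto simp: s_def t_def)
  have e1: "{vs ! i, vs ! s i} \<in> H" if "i < m" for i
    using cyc[OF that] that m by (auto simp: s_def)
  have e2: "{vs ! i, vs ! t i} \<in> H" if "i < m" for i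
  proof -
    have "s (t i) = i" using that m by (auto simp: s_def t_def)
    then show ?thesis using e1[OF st(2)[OF that]] by (simp add: insert_commute)
  qed
  have ne: "vs ! s i \<noteq> vs ! t i" if "i < m" for i
    using st[OF that] vs by (simp add: nth_eq_iff_index_eq)
  have nL: "vs ! i \<notin> Lf" if "i < m" for i
    using nbr_leaf e1[OF that] e2[OF that] ne[OF that] by metis
  have inBX: "vs ! i \<in> B \<union> X" if "i < m" for i
    using H_vertices[OF e1[OF that]] nL[OF that] by auto
  have nX: "{vs ! s i, vs ! t i} = {h1, h2}" if "i < m" "vs ! i \<in> X" for i
    using nbr_center[OF that(2) e1[OF that(1)]] nbr_center[OF that(2) e2[OF that(1)]]
      nL[OF st(1)[OF that(1)]] nL[OF st(2)[OF that(1)]] ne[OF that(1)] by auto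
  have cB: "card B = m - 2" using hubs m unfolding B_def distinct_card[OF hubs(1)] by simp
  have "\<exists>i j. i < m \<and> j < m \<and> i < j \<and> vs ! i \<in> X \<and> vs ! j \<in> X"
  proof (rule ccontr)
    assume no: "\<not> ?thesis"
    obtain x where x: "set vs - B \<subseteq> {x}"
    proof (cases "set vs - B = {}")
      case False
      then obtain y where y: "y \<in> set vs - B" by blast
      have "z = y" if z: "z \<in> set vs - B" for z
      proof -
        obtain i j where "i < m" "j < m" "vs ! i = y" "vs ! j = z"
          using y z vs(1) by (metis DiffD1 in_set_conv_nth)
        then show ?thesis using no inBX[of i] inBX[of j] y z by (cases i j rule: linorder_cases) auto
      qed
      then show ?thesis using that by blast
    qed auto
    have "card (set vs) \<le> card (insert x B)"
      using x by (intro card_mono) (auto simp: B_def)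
    also have "\<dots> \<le> Suc (card B)" by (simp add: card_insert_if B_def)
    finally show False using cB m vs by (simp add: distinct_card)
  qed
  then obtain i j where ij: "i < m" "j < m" "i < j" "vs ! i \<in> X" "vs ! j \<in> X" by blast
  have "{vs ! s i, vs ! t i} = {vs ! s j, vs ! t j}" using nX[of i] nX[of j] ij by simp
  then have "(s i = s j \<and> t i = t j) \<or> (s i = t j \<and> t i = s j)"
    using st ij vs by (auto simp: doubleton_eq_iff nth_eq_iff_index_eq)
  then show False using ij m by (auto simp: s_def t_def split: if_splits)
qed

section \<open>Paths with \<open>m\<close> vertices in the hub graph\<close>

lemma succ_part: "distinct ws \<Longrightarrow> set ws \<subseteq> B \<Longrightarrow> successively (\<lambda>a b. {a, b} \<in> H) ws"
  using successively_clique[of ws B H] H_clique by blast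

text \<open>The clique admits paths of every length between hubs, so the number of hubs visited can
  be tuned: all \<open>m - 2\<close> between two centres, one fewer for each end that is a leaf and
  so brings its own centre along.\<close>

lemma path_center_center:
  assumes "x \<in> X" "y \<in> X" "x \<noteq> y"
  shows "hpath m H x y"
proof -
  define ws where "ws = h1 # rest @ [h2]"
  have ws: "set ws \<subseteq> B" "distinct ws" "length ws = m - 2" "hd ws = h1" "last ws = h2" "ws \<noteq> []"
    using hubs m h_in by (auto simp: ws_def)
  define vs where "vs = x # ws @ [y]"
  have "hpath m H (hd vs) (last vs)"
  proof (rule hpathI)
    have "successively (\<lambda>a b. {a, b} \<in> H) ws" by (rule succ_part) (use ws in auto)
    then show "successively (\<lambda>a b. {a, b} \<in> H) vs"
      unfolding vs_def using H_center assms ws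
      by (auto simp: successively_append_iff successively_Cons)
    have "x \<notin> B" "y \<notin> B" using disj assms by blast+
    then show "distinct vs" unfolding vs_def using ws assms by auto
  qed (use m ws in \<open>auto simp: vs_def\<close>)
  then show ?thesis by (simp add: vs_def)
qed

lemma path_leaf_center:
  assumes "l \<in> Lf" "y \<in> X" "c l \<noteq> y"
  shows "hpath m H l y"
proof -
  define ws where "ws = h1 # take (m - 5) rest @ [h2]"
  have ws: "set ws \<subseteq> B" "distinct ws" "length ws = m - 3" "hd ws = h1" "last ws = h2" "ws \<noteq> []"
    using hubs m set_take_subset[of "m - 5" rest] h_in by (auto simp: ws_def)
  define vs where "vs = l # c l # ws @ [y]"
  have cl: "c l \<in> X" using disj assms by auto
  have "hpath m H (hd vs) (last vs)"
  proof (rule hpathI)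
    have "successively (\<lambda>a b. {a, b} \<in> H) ws" by (rule succ_part) (use ws in auto)
    then show "successively (\<lambda>a b. {a, b} \<in> H) vs"
      unfolding vs_def using H_center H_leaf assms cl ws
      by (auto simp: successively_append_iff successively_Cons)
    have "l \<notin> X" "l \<notin> B" "c l \<notin> B" "y \<notin> B" using disj assms cl by blast+
    then show "distinct vs" unfolding vs_def using ws cl assms by auto
  qed (use m ws in \<open>auto simp: vs_def\<close>)
  then show ?thesis by (simp add: vs_def)
qed

lemma path_leaf_leaf:
  assumes "l \<in> Lf" "l' \<in> Lf" "c l \<noteq> c l'"
  shows "hpath m H l l'"
proof -
  \<comment> \<open>For \<open>m = 5\<close> there is room for a single hub between the two centres,
    and \<open>h1\<close> is adjacent to both.\<close>
  define ws where "ws = (if m = 5 then [h1] else h1 # take (m - 6) rest @ [h2])"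
  have ws: "set ws \<subseteq> B" "distinct ws" "length ws = m - 4" "hd ws = h1" "last ws \<in> {h1, h2}" "ws \<noteq> []"
    using hubs m set_take_subset[of "m - 6" rest] h_in by (auto simp: ws_def)
  define vs where "vs = l # c l # ws @ [c l', l']"
  have cl: "c l \<in> X" "c l' \<in> X" using disj assms by auto
  have "hpath m H (hd vs) (last vs)"
  proof (rule hpathI)
    have "successively (\<lambda>a b. {a, b} \<in> H) ws" by (rule succ_part) (use ws in auto)
    then show "successively (\<lambda>a b. {a, b} \<in> H) vs"
      unfolding vs_def using H_center H_leaf assms cl ws
      by (auto simp: successively_append_iff successively_Cons)
    have "l \<notin> X" "l \<notin> B" "c l \<notin> B" "l' \<notin> X" "l' \<notin> B" "c l' \<notin> B" using disj assms cl by blast+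
    then show "distinct vs" unfolding vs_def using ws cl assms by auto
  qed (use m ws in \<open>auto simp: vs_def\<close>)
  then show ?thesis by (simp add: vs_def)
qed

text \<open>The leaf, its centre and all \<open>m - 2\<close> hubs have the right number; the hubs
  are ordered to begin with \<open>h1\<close> or \<open>h2\<close> and to end with
  \<open>u\<close>.\<close>

lemma path_leaf_hub:
  assumes "l \<in> Lf" "u \<in> B"
  shows "hpath m H l u"
proof -
  have "\<exists>ws. set ws \<subseteq> B \<and> distinct ws \<and> length ws = m - 2 \<and> hd ws \<in> {h1, h2} \<and> last ws = u"
  proof -
    consider "u = h1" | "u = h2" | "u \<in> set rest" using assms by (auto simp: B_def)
    then show ?thesis
    proof cases
      case 1
      then show ?thesis using hubs m h_in by (intro exI[of _ "h2 # rest @ [h1]"]) auto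
    next
      case 2
      then show ?thesis using hubs m h_in by (intro exI[of _ "h1 # rest @ [h2]"]) auto
    next
      case 3
      then show ?thesis using hubs m h_in
        by (intro exI[of _ "h1 # h2 # remove1 u rest @ [u]"]) (auto simp: length_remove1)
    qed
  qed
  then obtain ws where ws: "set ws \<subseteq> B" "distinct ws" "length ws = m - 2" "hd ws \<in> {h1, h2}" "last ws = u"
    by blast
  have wsne: "ws \<noteq> []" using ws m by auto
  define vs where "vs = l # c l # ws"
  have cl: "c l \<in> X" using disj assms by auto
  have "hpath m H (hd vs) (last vs)"
  proof (rule hpathI)
    have "successively (\<lambda>a b. {a, b} \<in> H) ws" by (rule succ_part) (use ws in auto)
    then show "successively (\<lambda>a b. {a, b} \<in> H) vs"
      unfolding vs_def using H_center H_leaf assms cl ws wsne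
      by (auto simp: successively_append_iff successively_Cons)
    have "l \<notin> X" "l \<notin> B" "c l \<notin> B" using disj assms cl by blast+
    then show "distinct vs" unfolding vs_def using ws cl assms by auto
  qed (use m ws in \<open>auto simp: vs_def\<close>)
  then show ?thesis using ws wsne by (simp add: vs_def)
qed

text \<open>A centre and all hubs make only \<open>m - 1\<close> vertices, so the path inserts a
  second centre \<open>z\<close> between \<open>h1\<close> and \<open>h2\<close>. This is where
  \<open>2 \<le> card X\<close> is used.\<close>

lemma path_center_hub:
  assumes "x \<in> X" "u \<in> set rest"
  shows "hpath m H x u"
proof -
  have "\<not> X \<subseteq> {x}"
  proof
    assume "X \<subseteq> {x}"
    then have "card X \<le> card {x}" by (intro card_mono) auto
    then show False using X by simp
  qed
  then obtain z where z: "z \<in> X" "z \<noteq> x" by blast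
  define ws where "ws = h2 # remove1 u rest @ [u]"
  have ws: "set ws \<subseteq> B" "distinct ws" "length ws = m - 3" "hd ws = h2" "last ws = u" "ws \<noteq> []" "h1 \<notin> set ws"
    using hubs m h_in assms notin_set_remove1 by (auto simp: ws_def length_remove1)
  define vs where "vs = x # h1 # z # ws"
  have "hpath m H (hd vs) (last vs)"
  proof (rule hpathI)
    have "successively (\<lambda>a b. {a, b} \<in> H) ws" by (rule succ_part) (use ws in auto)
    then show "successively (\<lambda>a b. {a, b} \<in> H) vs"
      unfolding vs_def using H_center assms z ws
      by (auto simp: successively_append_iff successively_Cons)
    have "x \<notin> B" "z \<notin> B" using disj assms z by blast+
    then show "distinct vs" unfolding vs_def using ws z h_in by auto
  qed (use m ws in \<open>auto simp: vs_def\<close>)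
  then show ?thesis using ws by (simp add: vs_def)
qed

lemma saturated: "cycle_saturated m G H"
  unfolding cycle_saturated_def
proof (intro conjI ballI)
  show "H \<subseteq> G" by (rule H_sub_G)
  show "\<not> has_cycle m H" by (rule no_cycle)
  fix e assume e: "e \<in> G - H"
  obtain u v where uv: "e = {u, v}" "u \<in> {1..n}" "v \<in> {1..n}" "u \<noteq> v"
    using e G all_pairsE by blast
  have part: "u \<in> B \<or> u \<in> X \<or> u \<in> Lf" "v \<in> B \<or> v \<in> X \<or> v \<in> Lf" using uv by (auto simp: Lf_def)
  have main: "hpath m H u v \<or> hpath m H v u"
    if "u \<in> B \<or> u \<in> X \<or> u \<in> Lf" "v \<in> B \<or> v \<in> X \<or> v \<in> Lf" "{u, v} \<in> G" "{u, v} \<notin> H" "u \<noteq> v"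
    for u v
  proof -
    have BB: "\<not> (u \<in> B \<and> v \<in> B)" using that H_clique by blast
    have LL: "c u \<noteq> c v" if "u \<in> Lf" "v \<in> Lf"
      using leaf_indep[of u v] \<open>{u, v} \<in> G\<close> \<open>u \<noteq> v\<close> that by (auto simp: Lf_def B_def)
    have XB: "b \<in> set rest" if "x \<in> X" "b \<in> B" "{x, b} \<notin> H" for x b
      using H_center that by (auto simp: B_def)
    show ?thesis
      using that(1)
    proof (elim disjE)
      assume u: "u \<in> B"
      then have "v \<in> X \<or> v \<in> Lf" using that BB by blast
      then show ?thesis using path_leaf_hub[of v u] path_center_hub[of v u] XB[of v u] u that
        by (auto simp: insert_commute)
    next
      assume u: "u \<in> X"
      have "hpath m H u v" if "v \<in> B" using path_center_hub[of u v] XB[of u v] u that \<open>{u, v} \<notin> H\<close> by auto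
      moreover have "hpath m H u v" if "v \<in> X" using path_center_center u that \<open>u \<noteq> v\<close> by auto
      moreover have "hpath m H v u" if "v \<in> Lf"
      proof -
        have "c v \<noteq> u" using H_leaf[OF that] \<open>{u, v} \<notin> H\<close> by (auto simp: insert_commute)
        then show ?thesis using path_leaf_center[of v u] u that by auto
      qed
      ultimately show ?thesis using that by blast
    next
      assume u: "u \<in> Lf"
      have "hpath m H u v" if "v \<in> X"
      proof -
        have "c u \<noteq> v" using H_leaf[OF u] \<open>{u, v} \<notin> H\<close> by (auto simp: insert_commute)
        then show ?thesis using path_leaf_center[of u v] u that by auto
      qed
      then show ?thesis using path_leaf_hub[of u v] path_leaf_leaf[of u v] LL u that by blast
    qed
  qed
  have "hpath m H u v \<or> hpath m H v u" using main[OF part] e uv by auto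
  then have "hpath m H u v" using hpath_sym[of m H v u] by auto
  then show "has_cycle m (insert e H)" unfolding uv(1) using m by (intro hpath_imp_has_cycle) auto
qed

text \<open>There are at most \<open>n - card X\<close> leaves with one edge each and
  \<open>card X\<close> centres with two edges to hubs; the clique is bounded crudely.\<close>

lemma card_H: "card H \<le> n + card X + m\<^sup>2"
proof -
  have finX: "finite X" using X finite_subset by blast
  have finB: "finite B" by (simp add: B_def)
  have cB: "card B \<le> m" using hubs m unfolding B_def distinct_card[OF hubs(1)] by simp
  have 1: "card {{u, v} |u v. u \<in> B \<and> v \<in> B \<and> u \<noteq> v} \<le> m\<^sup>2"
  proof -
    have "card {{u, v} |u v. u \<in> B \<and> v \<in> B \<and> u \<noteq> v} \<le> card ((\<lambda>(u, v). {u, v}) ` (B \<times> B))"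
      using finB by (intro card_mono) auto
    also have "\<dots> \<le> card (B \<times> B)" using finB by (intro card_image_le) auto
    also have "\<dots> \<le> m * m" using cB by (simp add: card_cartesian_product mult_le_mono)
    finally show ?thesis by (simp add: power2_eq_square)
  qed
  have 2: "card {{x, h} |x h. x \<in> X \<and> h \<in> {h1, h2}} \<le> 2 * card X"
  proof -
    have "card {{x, h} |x h. x \<in> X \<and> h \<in> {h1, h2}} \<le> card ((\<lambda>x. {x, h1}) ` X \<union> (\<lambda>x. {x, h2}) ` X)"
      using finX by (intro card_mono) auto
    also have "\<dots> \<le> card X + card X"
      using finX by (intro order_trans[OF card_Un_le] add_mono card_image_le)
    finally show ?thesis by simp
  qed
  have 3: "card {{l, c l} |l. l \<in> Lf} \<le> n - card X"
  proof -
    have "card {{l, c l} |l. l \<in> Lf} \<le> card Lf"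
      unfolding Setcompr_eq_image by (rule card_image_le) (auto simp: Lf_def)
    also have "\<dots> \<le> card ({1..n} - X)" by (intro card_mono) (auto simp: Lf_def)
    also have "\<dots> = n - card X" using X finX by (subst card_Diff_subset) auto
    finally show ?thesis .
  qed
  have "card X \<le> card {1..n}" using X by (intro card_mono) auto
  then have cX: "card X \<le> n" by simp
  have "card H \<le> m\<^sup>2 + 2 * card X + (n - card X)"
    unfolding H_def by (intro order_trans[OF card_Un_le] add_mono 1 2 3)
  then show ?thesis using cX by linarith
qed

end

section \<open>Large independent sets\<close>

definition tpairs :: "nat \<Rightarrow> (nat \<Rightarrow> 'a) \<Rightarrow> 'a set set" where
  "tpairs g \<tau> = (\<lambda>S. \<tau> ` S) ` {S. S \<subseteq> {..<g} \<and> card S = 2}"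

text \<open>A set of \<open>g * y\<close> vertices is cut into \<open>g\<close> blocks of order
  \<open>y\<close>, and independent sets are sought with one vertex in each block. Two such
  transversals can meet only at equal indices, so their overlap is described by a set of indices.
  The condition \<open>small\<close> ensures that larger overlaps weigh no more than overlaps in two
  vertices.\<close>

locale transversals =
  fixes g y n :: nat and Wp :: "nat \<Rightarrow> nat set" and p :: real
  assumes g: "2 \<le> g" and y: "1 \<le> y" and p: "0 < p" "p < 1"
    and Wp: "\<And>i. i < g \<Longrightarrow> Wp i \<subseteq> {1..n} \<and> card (Wp i) = y"
    and Wp_disj: "\<And>i j x. i < g \<Longrightarrow> j < g \<Longrightarrow> x \<in> Wp i \<Longrightarrow> x \<in> Wp j \<Longrightarrow> i = j"
    and small: "real g / real y * (1 / (1 - p)) powr (real (g + 1) / 2) \<le> 1"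
begin

definition "T = PiE {..<g} Wp"
definition "agree \<sigma> \<tau> = {i \<in> {..<g}. \<sigma> i = \<tau> i}"
definition "b = 1 / (1 - p)"
definition "C = g choose 2"

lemma finWp: "i < g \<Longrightarrow> finite (Wp i)"
  by (meson Wp finite_subset finite_atLeastAtMost)

lemma finT: "finite T" unfolding T_def using finWp by (intro finite_PiE) auto

lemma cardT: "card T = y ^ g"
  unfolding T_def using Wp by (subst card_PiE) auto

lemma T_in: "\<tau> \<in> T \<Longrightarrow> i < g \<Longrightarrow> \<tau> i \<in> Wp i" by (auto simp: T_def)

lemma T_eqD: "\<sigma> \<in> T \<Longrightarrow> \<tau> \<in> T \<Longrightarrow> i < g \<Longrightarrow> j < g \<Longrightarrow> \<sigma> i = \<tau> j \<Longrightarrow> i = j"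
  using T_in Wp_disj by metis

lemma inj_T: "\<tau> \<in> T \<Longrightarrow> inj_on \<tau> {..<g}"
  using T_eqD by (auto simp: inj_on_def)

lemma fin_tpairs: "finite (tpairs g \<tau>)"
  unfolding tpairs_def by (rule finite_imageI, rule finite_subset[of _ "Pow {..<g}"]) auto

lemma card_tpairs: "\<tau> \<in> T \<Longrightarrow> card (tpairs g \<tau>) = C"
proof -
  assume t: "\<tau> \<in> T"
  have "inj_on ((`) \<tau>) {S. S \<subseteq> {..<g} \<and> card S = 2}"
    by (rule inj_on_subset[OF inj_on_image_Pow[OF inj_T[OF t]]]) auto
  then show ?thesis unfolding tpairs_def C_def by (simp add: card_image n_subsets)
qed

text \<open>The blocks are disjoint, so a common vertex has the same index in both transversals;
  common pairs thus come from pairs of indices at which they agree.\<close>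

lemma tpairs_Int:
  assumes "\<sigma> \<in> T" "\<tau> \<in> T"
  shows "tpairs g \<sigma> \<inter> tpairs g \<tau> = (\<lambda>S. \<tau> ` S) ` {S. S \<subseteq> agree \<sigma> \<tau> \<and> card S = 2}"
proof
  show "tpairs g \<sigma> \<inter> tpairs g \<tau> \<subseteq> (\<lambda>S. \<tau> ` S) ` {S. S \<subseteq> agree \<sigma> \<tau> \<and> card S = 2}"
  proof
    fix e assume "e \<in> tpairs g \<sigma> \<inter> tpairs g \<tau>"
    then obtain S S' where S: "S \<subseteq> {..<g}" "card S = 2" "S' \<subseteq> {..<g}" "card S' = 2" "e = \<sigma> ` S" "e = \<tau> ` S'"
      by (auto simp: tpairs_def)
    have "i \<in> agree \<sigma> \<tau>" if i: "i \<in> S'" for i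
    proof -
      obtain j where j: "j \<in> S" "\<sigma> j = \<tau> i" using S i by (metis imageE imageI)
      then have "j = i" using T_eqD[OF assms, of j i] S i by auto
      then show ?thesis using j S i by (auto simp: agree_def)
    qed
    then show "e \<in> (\<lambda>S. \<tau> ` S) ` {S. S \<subseteq> agree \<sigma> \<tau> \<and> card S = 2}" using S by blast
  qed
  show "(\<lambda>S. \<tau> ` S) ` {S. S \<subseteq> agree \<sigma> \<tau> \<and> card S = 2} \<subseteq> tpairs g \<sigma> \<inter> tpairs g \<tau>"
  proof
    fix e assume "e \<in> (\<lambda>S. \<tau> ` S) ` {S. S \<subseteq> agree \<sigma> \<tau> \<and> card S = 2}"
    then obtain S where S: "S \<subseteq> agree \<sigma> \<tau>" "card S = 2" "e = \<tau> ` S" by blast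
    have "S \<subseteq> {..<g}" using S by (auto simp: agree_def)
    moreover have "e = \<sigma> ` S" unfolding S(3) by (rule image_cong) (use S in \<open>auto simp: agree_def\<close>)
    ultimately show "e \<in> tpairs g \<sigma> \<inter> tpairs g \<tau>" using S(2,3) unfolding tpairs_def by blast
  qed
qed

lemma card_tpairs_Int:
  assumes "\<sigma> \<in> T" "\<tau> \<in> T"
  shows "card (tpairs g \<sigma> \<inter> tpairs g \<tau>) = card (agree \<sigma> \<tau>) choose 2"
proof -
  have "inj_on ((`) \<tau>) {S. S \<subseteq> agree \<sigma> \<tau> \<and> card S = 2}"
    by (rule inj_on_subset[OF inj_on_image_Pow[OF inj_T[OF assms(2)]]]) (auto simp: agree_def)
  then show ?thesis unfolding tpairs_Int[OF assms] by (simp add: card_image n_subsets agree_def)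
qed

lemma tpairs_sub: "\<tau> \<in> T \<Longrightarrow> tpairs g \<tau> \<subseteq> all_pairs n"
proof
  fix e assume t: "\<tau> \<in> T" and "e \<in> tpairs g \<tau>"
  then obtain i j where ij: "i < g" "j < g" "i \<noteq> j" "e = {\<tau> i, \<tau> j}"
    by (auto simp: tpairs_def card_2_iff)
  then have "\<tau> i \<noteq> \<tau> j" using T_eqD[OF t t] by blast
  moreover have "\<tau> i \<in> {1..n}" "\<tau> j \<in> {1..n}" using T_in[OF t] Wp ij by blast+
  ultimately show "e \<in> all_pairs n" using ij by (simp only: doubleton_in_all_pairs) simp
qed

definition "E = all_pairs n"
text \<open>
  The largest number of edge-disjoint transversals independent in \<open>G\<close> changes by at most one when an
  edge is added, so it obeys the bounded difference inequality, unlike the number of all independent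
  transversals.
\<close>

definition "fams G = {F. F \<subseteq> T \<and> (\<forall>\<tau>\<in>F. G \<inter> tpairs g \<tau> = {}) \<and>
   (\<forall>\<sigma>\<in>F. \<forall>\<tau>\<in>F. \<sigma> \<noteq> \<tau> \<longrightarrow> tpairs g \<sigma> \<inter> tpairs g \<tau> = {})}"
definition "f G = real (Max (card ` fams G))"

lemma fams_fin: "finite (fams G)" unfolding fams_def by (rule finite_subset[of _ "Pow T"]) (use finT in auto)
lemma fams_ne: "{} \<in> fams G" by (simp add: fams_def)

lemma f_ge: "F \<in> fams G \<Longrightarrow> real (card F) \<le> f G"
  unfolding f_def using fams_fin by (intro of_nat_mono Max_ge) auto

lemma f_attained: "\<exists>F \<in> fams G. f G = real (card F)"
proof -
  have "Max (card ` fams G) \<in> card ` fams G" using fams_fin fams_ne by (intro Max_in) auto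
  then show ?thesis by (auto simp: f_def)
qed

definition "E0 = \<Union>(tpairs g ` T)"

lemma E0_sub: "E0 \<subseteq> E" using tpairs_sub by (auto simp: E0_def E_def)

lemma card_E0: "real (card E0) \<le> (real g * real y)\<^sup>2"
proof -
  define U where "U = (\<Union>i<g. Wp i)"
  have finU: "finite U" unfolding U_def using finWp by auto
  have "card U \<le> (\<Sum>i<g. card (Wp i))" unfolding U_def by (rule card_UN_le) simp
  also have "\<dots> = g * y" using Wp by simp
  finally have cU: "card U \<le> g * y" .
  have "E0 \<subseteq> (\<lambda>(u, v). {u, v}) ` (U \<times> U)"
  proof
    fix e assume "e \<in> E0"
    then obtain \<tau> i j where ij: "\<tau> \<in> T" "i < g" "j < g" "e = {\<tau> i, \<tau> j}"
      by (auto simp: E0_def tpairs_def card_2_iff)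
    then have "\<tau> i \<in> U" "\<tau> j \<in> U" using T_in by (auto simp: U_def)
    then show "e \<in> (\<lambda>(u, v). {u, v}) ` (U \<times> U)" using ij by auto
  qed
  then have "card E0 \<le> card (U \<times> U)" using finU by (intro surj_card_le) auto
  also have "\<dots> \<le> (g * y) * (g * y)" using cU by (simp add: card_cartesian_product mult_le_mono)
  finally have "real (card E0) \<le> real ((g * y) * (g * y))" by (rule of_nat_mono)
  then show ?thesis by (simp add: power2_eq_square)
qed

text \<open>The members of a family are edge-disjoint, so at most one of them contains
  \<open>e\<close>; discarding it leaves a family valid for \<open>insert e S\<close>.\<close>

lemma f_Lipschitz: "\<bar>f (insert e S) - f S\<bar> \<le> (if e \<in> E0 then 1 else 0)"
proof -
  have mono: "f (insert e S) \<le> f S"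
  proof -
    obtain F where F: "F \<in> fams (insert e S)" "f (insert e S) = real (card F)" using f_attained by blast
    then have "F \<in> fams S" by (auto simp: fams_def)
    then show ?thesis using f_ge F by simp
  qed
  obtain F where F: "F \<in> fams S" "f S = real (card F)" using f_attained by blast
  have finF: "finite F" using F finT finite_subset by (auto simp: fams_def)
  define F' where "F' = {\<tau> \<in> F. e \<in> tpairs g \<tau>}"
  have "F - F' \<in> fams (insert e S)" using F by (auto simp: fams_def F'_def)
  then have 1: "real (card (F - F')) \<le> f (insert e S)" by (rule f_ge)
  have c: "card (F - F') = card F - card F'" "card F' \<le> card F"
    using finF by (auto simp: F'_def card_Diff_subset intro: card_mono)
  show ?thesis
  proof (cases "e \<in> E0")
    case True
    have "card F' \<le> 1"
    proof (rule ccontr)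
      assume "\<not> card F' \<le> 1"
      then obtain \<sigma> \<tau> where "\<sigma> \<in> F'" "\<tau> \<in> F'" "\<sigma> \<noteq> \<tau>"
        using card_le_Suc0_iff_eq[of F'] finF by (auto simp: F'_def)
      then show False using F unfolding F'_def fams_def by blast
    qed
    then show ?thesis using mono 1 c F True by auto
  next
    case False
    then have "F' = {}" using F by (auto simp: F'_def E0_def fams_def)
    then show ?thesis using mono 1 c F False by auto
  qed
qed

section \<open>Second moment of the number of independent transversals, whose mean is
  \<open>\<mu>\<close>\<close>

definition "\<mu> = real y ^ g * (1 - p) ^ C"

lemma prob_indep: "\<tau> \<in> T \<Longrightarrow> measure_pmf.prob (random_subset E p) {G. G \<inter> tpairs g \<tau> = {}} = (1 - p) ^ C"
  using prob_random_subset_disjoint[of E "tpairs g \<tau>" p] tpairs_sub card_tpairs p by (simp add: E_def)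

lemma prob_indep2:
  assumes "\<sigma> \<in> T" "\<tau> \<in> T"
  shows "measure_pmf.prob (random_subset E p) {G. G \<inter> tpairs g \<sigma> = {} \<and> G \<inter> tpairs g \<tau> = {}}
    = (1 - p) ^ (2 * C) * b ^ (card (agree \<sigma> \<tau>) choose 2)"
proof -
  define j where "j = card (agree \<sigma> \<tau>) choose 2"
  have cu: "card (tpairs g \<sigma> \<union> tpairs g \<tau>) + j = 2 * C"
    using card_Un_Int[OF fin_tpairs fin_tpairs, of \<sigma> \<tau>] card_tpairs assms card_tpairs_Int[OF assms]
    by (simp add: j_def)
  have "{G. G \<inter> tpairs g \<sigma> = {} \<and> G \<inter> tpairs g \<tau> = {}} = {G. G \<inter> (tpairs g \<sigma> \<union> tpairs g \<tau>) = {}}"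
    by auto
  then have "measure_pmf.prob (random_subset E p) {G. G \<inter> tpairs g \<sigma> = {} \<and> G \<inter> tpairs g \<tau> = {}}
    = (1 - p) ^ card (tpairs g \<sigma> \<union> tpairs g \<tau>)"
    using prob_random_subset_disjoint[of E "tpairs g \<sigma> \<union> tpairs g \<tau>" p] tpairs_sub assms p by (simp add: E_def)
  also have "\<dots> = (1 - p) ^ (2 * C) * b ^ j"
    unfolding cu[symmetric] power_add b_def using p by (simp add: power_divide)
  finally show ?thesis by (simp add: j_def)
qed

lemma b1: "1 < b" using p by (simp add: b_def field_simps)

text \<open>Since \<open>j choose 2\<close> equals 1 + (j - 2)(j + 1) / 2, every agreement beyond
  the second contributes a factor \<open>b powr (real (j + 1) / 2) * (real g / real y)\<close>,
  which is at most 1 by \<open>small\<close>.\<close>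

lemma pair_weight:
  assumes "2 \<le> j" "j \<le> g"
  shows "b ^ (j choose 2) * (real g / real y) ^ j \<le> (real g / real y)\<^sup>2 * b"
proof -
  define r where "r = real g / real y"
  have r: "0 < r" using g y by (simp add: r_def)
  have ch: "real (j choose 2) = real j * (real j - 1) / 2"
    using assms by (simp add: choose_two real_of_nat_div of_nat_diff)
  have eq: "b ^ (j choose 2) = b * (b powr (real (j + 1) / 2)) ^ (j - 2)"
  proof -
    have "b ^ (j choose 2) = b powr (real (j choose 2))" using b1 by (simp add: powr_realpow)
    also have "real (j choose 2) = 1 + (real (j + 1) / 2) * real (j - 2)"
      unfolding ch using assms by (simp add: of_nat_diff field_simps)
    also have "b powr \<dots> = b * (b powr (real (j + 1) / 2)) powr real (j - 2)"
      using b1 by (simp add: powr_add powr_powr)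
    also have "\<dots> = b * (b powr (real (j + 1) / 2)) ^ (j - 2)" using b1 by (simp add: powr_realpow)
    finally show ?thesis .
  qed
  have "b powr (real (j + 1) / 2) * r \<le> b powr (real (g + 1) / 2) * r"
    using b1 r assms by (intro mult_right_mono powr_mono) auto
  also have "\<dots> \<le> 1" using small by (simp add: b_def r_def mult.commute)
  finally have le1: "b powr (real (j + 1) / 2) * r \<le> 1" .
  have "b ^ (j choose 2) * r ^ j = b * r\<^sup>2 * (b powr (real (j + 1) / 2) * r) ^ (j - 2)"
  proof -
    have "r ^ j = r\<^sup>2 * r ^ (j - 2)" using assms by (metis le_add_diff_inverse power_add)
    then show ?thesis unfolding eq power_mult_distrib by simp
  qed
  also have "\<dots> \<le> b * r\<^sup>2 * 1"
    using le1 b1 r by (intro mult_left_mono power_le_one) auto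
  finally show ?thesis by (simp add: r_def mult.commute)
qed

lemma one_plus_inverse_power: "(1 + 1 / real g) ^ g \<le> 3"
proof -
  have "(1 + 1 / real g) ^ g \<le> exp (1 / real g) ^ g"
    by (intro power_mono exp_ge_add_one_self) auto
  also have "\<dots> = exp 1" using g by (simp add: exp_of_nat_mult[symmetric])
  also have "\<dots> \<le> 3" using exp_le by simp
  finally show ?thesis .
qed

text \<open>Group the transversals by the set J of indices where they agree with
  \<open>\<sigma>\<close>; at most y^(g - |J|) belong to J. Write y^(-|J|) as (g/y)^|J| (1/g)^|J|:
  \<open>pair_weight\<close> bounds the first factor together with the power of \<open>b\<close>,
  and the second, summed over all J, gives (1 + 1/g)^g, at most 3.\<close>

lemma sum_pairs_fixed:
  assumes s: "\<sigma> \<in> T"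
  shows "(\<Sum>\<tau>\<in>{\<tau>\<in>T. 2 \<le> card (agree \<sigma> \<tau>)}. b ^ (card (agree \<sigma> \<tau>) choose 2))
    \<le> 3 * real y ^ g * ((real g / real y)\<^sup>2 * b)"
proof -
  define R where "R = (real g / real y)\<^sup>2 * b"
  have R0: "0 \<le> R" using b1 by (simp add: R_def)
  define A where "A = (\<lambda>J. {\<tau>\<in>T. agree \<sigma> \<tau> = J})"
  have finA: "finite (A J)" for J using finT by (simp add: A_def)
  have yg: "0 < real y" "0 < real g" using y g by auto
  have cA: "real (card (A J)) \<le> real y ^ g / real y ^ card J" if J: "J \<subseteq> {..<g}" for J
  proof -
    have "A J \<subseteq> PiE {..<g} (\<lambda>i. if i \<in> J then {\<sigma> i} else Wp i)"
    proof
      fix \<tau> assume "\<tau> \<in> A J"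
      then have t: "\<tau> \<in> T" "agree \<sigma> \<tau> = J" by (auto simp: A_def)
      then show "\<tau> \<in> PiE {..<g} (\<lambda>i. if i \<in> J then {\<sigma> i} else Wp i)"
        unfolding T_def by (intro PiE_I) (auto simp: agree_def PiE_iff extensional_def)
    qed
    moreover have "finite (PiE {..<g} (\<lambda>i. if i \<in> J then {\<sigma> i} else Wp i))"
      using finWp by (intro finite_PiE) auto
    ultimately have "card (A J) \<le> card (PiE {..<g} (\<lambda>i. if i \<in> J then {\<sigma> i} else Wp i))"
      by (rule card_mono[rotated])
    also have "\<dots> = (\<Prod>i<g. if i \<in> J then 1 else y)"
      using Wp by (subst card_PiE) (auto intro!: prod.cong)
    also have "\<dots> = y ^ card ({..<g} - J)"
      by (simp add: prod.If_cases Diff_eq)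
    also have "card ({..<g} - J) = g - card J" using J by (simp add: card_Diff_subset finite_subset)
    finally have "real (card (A J)) \<le> real (y ^ (g - card J))" by (rule of_nat_mono)
    moreover have "card J \<le> g" using card_mono[OF _ J] by simp
    moreover from this have "real (y ^ (g - card J)) = real y ^ g / real y ^ card J"
      unfolding of_nat_power using yg by (intro power_diff) auto
    ultimately show ?thesis by linarith
  qed
  have finJ: "finite {J. J \<subseteq> {..<g} \<and> 2 \<le> card J}"
    by (rule finite_subset[of _ "Pow {..<g}"]) auto
  have "(\<Sum>\<tau>\<in>{\<tau>\<in>T. 2 \<le> card (agree \<sigma> \<tau>)}. b ^ (card (agree \<sigma> \<tau>) choose 2))
     = (\<Sum>J\<in>{J. J \<subseteq> {..<g} \<and> 2 \<le> card J}. \<Sum>\<tau>\<in>{\<tau> \<in> {\<tau>\<in>T. 2 \<le> card (agree \<sigma> \<tau>)}. agree \<sigma> \<tau> = J}. b ^ (card (agree \<sigma> \<tau>) choose 2))"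
    using finT finJ by (intro sum.group[symmetric]) (auto simp: agree_def)
  also have "\<dots> = (\<Sum>J\<in>{J. J \<subseteq> {..<g} \<and> 2 \<le> card J}. real (card (A J)) * b ^ (card J choose 2))"
  proof (intro sum.cong refl)
    fix J assume J: "J \<in> {J. J \<subseteq> {..<g} \<and> 2 \<le> card J}"
    have "{\<tau> \<in> {\<tau>\<in>T. 2 \<le> card (agree \<sigma> \<tau>)}. agree \<sigma> \<tau> = J} = A J" using J by (auto simp: A_def)
    then show "(\<Sum>\<tau>\<in>{\<tau> \<in> {\<tau>\<in>T. 2 \<le> card (agree \<sigma> \<tau>)}. agree \<sigma> \<tau> = J}. b ^ (card (agree \<sigma> \<tau>) choose 2))
       = real (card (A J)) * b ^ (card J choose 2)" by (simp add: A_def)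
  qed
  also have "\<dots> \<le> (\<Sum>J\<in>{J. J \<subseteq> {..<g} \<and> 2 \<le> card J}. real y ^ g * R * (1 / real g) ^ card J)"
  proof (rule sum_mono)
    fix J assume J: "J \<in> {J. J \<subseteq> {..<g} \<and> 2 \<le> card J}"
    then have jg: "2 \<le> card J" "card J \<le> g" using card_mono[of "{..<g}" J] by auto
    have "b ^ (card J choose 2) * (real g / real y) ^ card J \<le> R"
      unfolding R_def by (rule pair_weight[OF jg])
    then have w: "b ^ (card J choose 2) / real y ^ card J \<le> R * (1 / real g) ^ card J"
      using yg by (simp add: power_divide field_simps)
    have "real (card (A J)) * b ^ (card J choose 2) \<le> real y ^ g / real y ^ card J * b ^ (card J choose 2)"
      using J cA b1 by (intro mult_right_mono) auto
    also have "\<dots> = real y ^ g * (b ^ (card J choose 2) / real y ^ card J)" by simp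
    also have "\<dots> \<le> real y ^ g * (R * (1 / real g) ^ card J)" using w by (intro mult_left_mono) auto
    finally show "real (card (A J)) * b ^ (card J choose 2) \<le> real y ^ g * R * (1 / real g) ^ card J" by simp
  qed
  also have "\<dots> \<le> (\<Sum>J\<in>Pow {..<g}. real y ^ g * R * (1 / real g) ^ card J)"
    using R0 by (intro sum_mono2) auto
  also have "\<dots> = real y ^ g * R * (1 + 1 / real g) ^ g"
    by (simp add: sum_distrib_left[symmetric] sum_power_card_Pow)
  also have "\<dots> \<le> real y ^ g * R * 3"
    using R0 by (intro mult_left_mono one_plus_inverse_power) auto
  finally show ?thesis by (simp add: R_def mult_ac)
qed

text \<open>The expected number of ordered pairs of independent transversals that share a pair of
  vertices. The case \<open>\<sigma> = \<tau>\<close> is included; it alone contributes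
  \<open>\<mu>\<close>, which keeps the probability \<open>q\<close> of \<open>Ef_ge\<close> below
  1.\<close>

definition "S2 = (\<Sum>\<sigma>\<in>T. \<Sum>\<tau>\<in>{\<tau>\<in>T. 2 \<le> card (agree \<sigma> \<tau>)}.
   measure_pmf.prob (random_subset E p) {G. G \<inter> tpairs g \<sigma> = {} \<and> G \<inter> tpairs g \<tau> = {}})"

lemma mu_pos: "0 < \<mu>" using p y by (simp add: \<mu>_def)

lemma S2_ge: "\<mu> \<le> S2"
proof -
  have "\<mu> = (\<Sum>\<sigma>\<in>T. (1 - p) ^ C)" by (simp add: \<mu>_def cardT)
  also have "\<dots> \<le> S2" unfolding S2_def
  proof (rule sum_mono)
    fix \<sigma> assume s: "\<sigma> \<in> T"
    have a: "agree \<sigma> \<sigma> = {..<g}" by (auto simp: agree_def)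
    have "(1 - p) ^ C = measure_pmf.prob (random_subset E p) {G. G \<inter> tpairs g \<sigma> = {} \<and> G \<inter> tpairs g \<sigma> = {}}"
      using prob_indep[OF s] by simp
    also have "\<dots> \<le> (\<Sum>\<tau>\<in>{\<tau>\<in>T. 2 \<le> card (agree \<sigma> \<tau>)}.
        measure_pmf.prob (random_subset E p) {G. G \<inter> tpairs g \<sigma> = {} \<and> G \<inter> tpairs g \<tau> = {}})"
      using s a g finT by (intro member_le_sum) auto
    finally show "(1 - p) ^ C \<le> (\<Sum>\<tau>\<in>{\<tau>\<in>T. 2 \<le> card (agree \<sigma> \<tau>)}.
        measure_pmf.prob (random_subset E p) {G. G \<inter> tpairs g \<sigma> = {} \<and> G \<inter> tpairs g \<tau> = {}})" .
  qed
  finally show ?thesis .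
qed

lemma S2_le: "S2 \<le> \<mu>\<^sup>2 * (3 * ((real g / real y)\<^sup>2 * b))"
proof -
  have "S2 = (\<Sum>\<sigma>\<in>T. \<Sum>\<tau>\<in>{\<tau>\<in>T. 2 \<le> card (agree \<sigma> \<tau>)}. (1 - p) ^ (2 * C) * b ^ (card (agree \<sigma> \<tau>) choose 2))"
    unfolding S2_def by (intro sum.cong refl prob_indep2) auto
  also have "\<dots> = (\<Sum>\<sigma>\<in>T. (1 - p) ^ (2 * C) * (\<Sum>\<tau>\<in>{\<tau>\<in>T. 2 \<le> card (agree \<sigma> \<tau>)}. b ^ (card (agree \<sigma> \<tau>) choose 2)))"
    by (simp add: sum_distrib_left)
  also have "\<dots> \<le> (\<Sum>\<sigma>\<in>T. (1 - p) ^ (2 * C) * (3 * real y ^ g * ((real g / real y)\<^sup>2 * b)))"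
    using p by (intro sum_mono mult_left_mono sum_pairs_fixed) auto
  also have "\<dots> = \<mu>\<^sup>2 * (3 * ((real g / real y)\<^sup>2 * b))"
    unfolding \<mu>_def power_mult_distrib by (simp add: cardT power2_eq_square power_add mult_2)
  finally show ?thesis .
qed

text \<open>Join two independent transversals when they share a pair of vertices; an independent set
  in this conflict graph is an edge-disjoint family, and the deletion method provides one. As
  \<open>q\<close> is the same for all \<open>G\<close>, the bound is linear in indicators and can
  be averaged over \<open>G\<close>.\<close>

lemma f_ge_q:
  assumes q: "0 \<le> q" "q \<le> 1"
  shows "q * (\<Sum>\<tau>\<in>T. indicator {G. G \<inter> tpairs g \<tau> = {}} G) -
     q\<^sup>2 * (\<Sum>\<sigma>\<in>T. \<Sum>\<tau>\<in>{\<tau>\<in>T. 2 \<le> card (agree \<sigma> \<tau>)}.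
        indicator {G. G \<inter> tpairs g \<sigma> = {} \<and> G \<inter> tpairs g \<tau> = {}} G) \<le> f G"
proof -
  define V where "V = {\<tau>\<in>T. G \<inter> tpairs g \<tau> = {}}"
  define R where "R = {{\<sigma>, \<tau>} |\<sigma> \<tau>. \<sigma> \<in> V \<and> \<tau> \<in> V \<and> \<sigma> \<noteq> \<tau> \<and> tpairs g \<sigma> \<inter> tpairs g \<tau> \<noteq> {}}"
  have finV: "finite V" using finT by (simp add: V_def)
  obtain I where I: "I \<subseteq> V" "\<forall>e\<in>R. \<not> e \<subseteq> I" "q * real (card V) - q\<^sup>2 * real (card R) \<le> real (card I)"
    using independent_set_random[of V R q] finV q by (fastforce simp: R_def)
  have "I \<in> fams G"
  proof -
    have "tpairs g \<sigma> \<inter> tpairs g \<tau> = {}" if "\<sigma> \<in> I" "\<tau> \<in> I" "\<sigma> \<noteq> \<tau>" for \<sigma> \<tau>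
    proof (rule ccontr)
      assume "tpairs g \<sigma> \<inter> tpairs g \<tau> \<noteq> {}"
      then have "{\<sigma>, \<tau>} \<in> R" using that I(1) unfolding R_def by blast
      then show False using I that by auto
    qed
    then show ?thesis using I by (auto simp: fams_def V_def)
  qed
  then have "real (card I) \<le> f G" by (rule f_ge)
  moreover have sumV: "(\<Sum>\<tau>\<in>T. indicator {G. G \<inter> tpairs g \<tau> = {}} G) = real (card V)"
    unfolding V_def using finT by (simp add: indicator_def sum.If_cases Int_def)
  moreover have "real (card R) \<le> (\<Sum>\<sigma>\<in>T. \<Sum>\<tau>\<in>{\<tau>\<in>T. 2 \<le> card (agree \<sigma> \<tau>)}.
        indicator {G. G \<inter> tpairs g \<sigma> = {} \<and> G \<inter> tpairs g \<tau> = {}} G)"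
  proof -
    define Q where "Q = (SIGMA \<sigma>:T. {\<tau> \<in> {\<tau>\<in>T. 2 \<le> card (agree \<sigma> \<tau>)}. G \<inter> tpairs g \<sigma> = {} \<and> G \<inter> tpairs g \<tau> = {}})"
    have finQ: "finite Q" unfolding Q_def using finT by auto
    have "R \<subseteq> (\<lambda>(\<sigma>, \<tau>). {\<sigma>, \<tau>}) ` Q"
    proof
      fix e assume "e \<in> R"
      then obtain \<sigma> \<tau> where st: "e = {\<sigma>, \<tau>}" "\<sigma> \<in> V" "\<tau> \<in> V" "tpairs g \<sigma> \<inter> tpairs g \<tau> \<noteq> {}"
        by (auto simp: R_def)
      have "2 \<le> card (agree \<sigma> \<tau>)"
      proof -
        obtain S where "S \<subseteq> agree \<sigma> \<tau>" "card S = 2"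
          using st tpairs_Int[of \<sigma> \<tau>] by (auto simp: V_def)
        moreover have "finite (agree \<sigma> \<tau>)" by (simp add: agree_def)
        ultimately show ?thesis using card_mono[of "agree \<sigma> \<tau>" S] by simp
      qed
      then show "e \<in> (\<lambda>(\<sigma>, \<tau>). {\<sigma>, \<tau>}) ` Q"
        using st by (intro image_eqI[of _ _ "(\<sigma>, \<tau>)"]) (auto simp: Q_def V_def)
    qed
    then have "card R \<le> card Q" using finQ by (intro surj_card_le)
    also have "card Q = (\<Sum>\<sigma>\<in>T. card {\<tau> \<in> {\<tau>\<in>T. 2 \<le> card (agree \<sigma> \<tau>)}. G \<inter> tpairs g \<sigma> = {} \<and> G \<inter> tpairs g \<tau> = {}})"
      unfolding Q_def using finT by (subst card_SigmaI) auto
    finally have "real (card R) \<le> (\<Sum>\<sigma>\<in>T. real (card {\<tau> \<in> {\<tau>\<in>T. 2 \<le> card (agree \<sigma> \<tau>)}. G \<inter> tpairs g \<sigma> = {} \<and> G \<inter> tpairs g \<tau> = {}}))"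
      by (simp flip: of_nat_sum)
    also have "\<dots> = (\<Sum>\<sigma>\<in>T. \<Sum>\<tau>\<in>{\<tau>\<in>T. 2 \<le> card (agree \<sigma> \<tau>)}.
        indicator {G. G \<inter> tpairs g \<sigma> = {} \<and> G \<inter> tpairs g \<tau> = {}} G)"
      using finT by (intro sum.cong refl) (simp add: indicator_def sum.If_cases Int_def)
    finally show ?thesis .
  qed
  then have "q\<^sup>2 * real (card R) \<le> q\<^sup>2 * (\<Sum>\<sigma>\<in>T. \<Sum>\<tau>\<in>{\<tau>\<in>T. 2 \<le> card (agree \<sigma> \<tau>)}.
        indicator {G. G \<inter> tpairs g \<sigma> = {} \<and> G \<inter> tpairs g \<tau> = {}} G)"
    by (intro mult_left_mono) auto
  ultimately show ?thesis unfolding sumV using I(3) by linarith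
qed

lemma Ef_ge: "(real y)\<^sup>2 / (12 * b * (real g)\<^sup>2) \<le> expec E p f"
proof -
  have finE: "finite E" by (simp add: E_def)
  have S0: "0 < S2" using mu_pos S2_ge by linarith
  \<comment> \<open>This value maximises \<open>q * \<mu> - q\<^sup>2 * S2\<close>.\<close>
  define q where "q = \<mu> / (2 * S2)"
  have q: "0 \<le> q" "q \<le> 1" using mu_pos S2_ge S0 by (auto simp: q_def field_simps)
  have "expec E p (\<lambda>G. q * (\<Sum>\<tau>\<in>T. indicator {G. G \<inter> tpairs g \<tau> = {}} G) -
     q\<^sup>2 * (\<Sum>\<sigma>\<in>T. \<Sum>\<tau>\<in>{\<tau>\<in>T. 2 \<le> card (agree \<sigma> \<tau>)}.
        indicator {G. G \<inter> tpairs g \<sigma> = {} \<and> G \<inter> tpairs g \<tau> = {}} G)) \<le> expec E p f"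
    using finE f_ge_q[OF q] by (intro expec_mono) auto
  also have "expec E p (\<lambda>G. q * (\<Sum>\<tau>\<in>T. indicator {G. G \<inter> tpairs g \<tau> = {}} G) -
     q\<^sup>2 * (\<Sum>\<sigma>\<in>T. \<Sum>\<tau>\<in>{\<tau>\<in>T. 2 \<le> card (agree \<sigma> \<tau>)}.
        indicator {G. G \<inter> tpairs g \<sigma> = {} \<and> G \<inter> tpairs g \<tau> = {}} G))
    = q * (\<Sum>\<tau>\<in>T. measure_pmf.prob (random_subset E p) {G. G \<inter> tpairs g \<tau> = {}}) - q\<^sup>2 * S2"
    using finE by (simp add: S2_def)
  also have "(\<Sum>\<tau>\<in>T. measure_pmf.prob (random_subset E p) {G. G \<inter> tpairs g \<tau> = {}}) = \<mu>"
    using prob_indep by (simp add: \<mu>_def cardT)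
  also have "q * \<mu> - q\<^sup>2 * S2 = \<mu>\<^sup>2 / (4 * S2)"
    unfolding q_def using S0 by (simp add: field_simps power2_eq_square)
  finally have 1: "\<mu>\<^sup>2 / (4 * S2) \<le> expec E p f" .
  have yg: "0 < real y" "0 < real g" using y g by auto
  have "\<mu>\<^sup>2 / (4 * (\<mu>\<^sup>2 * (3 * ((real g / real y)\<^sup>2 * b)))) \<le> \<mu>\<^sup>2 / (4 * S2)"
    using S0 mu_pos b1 yg by (intro divide_left_mono mult_pos_pos mult_left_mono S2_le) auto
  moreover have "\<mu>\<^sup>2 / (4 * (\<mu>\<^sup>2 * (3 * ((real g / real y)\<^sup>2 * b)))) = (real y)\<^sup>2 / (12 * b * (real g)\<^sup>2)"
    using mu_pos yg b1 by (simp add: field_simps)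
  ultimately show ?thesis using 1 by linarith
qed

lemma prob_no_indep_transversal:
  "measure_pmf.prob (random_subset E p) {G. \<forall>\<tau>\<in>T. G \<inter> tpairs g \<tau> \<noteq> {}}
     \<le> exp (- ((real y)\<^sup>2 / (72 * b\<^sup>2 * real g ^ 6)))"
proof -
  \<comment> \<open>The deviation is the whole mean: without an independent transversal,
    \<open>f G\<close> is 0.\<close>
  define t where "t = expec E p f"
  have yg: "0 < real y" "0 < real g" using y g by auto
  have "measure_pmf.prob (random_subset E p) {G. \<forall>\<tau>\<in>T. G \<inter> tpairs g \<tau> \<noteq> {}}
    \<le> measure_pmf.prob (random_subset E p) {G. f G \<le> expec E p f - t}"
  proof (rule measure_pmf.finite_measure_mono)
    show "{G. \<forall>\<tau>\<in>T. G \<inter> tpairs g \<tau> \<noteq> {}} \<subseteq> {G. f G \<le> expec E p f - t}"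
    proof
      fix G assume G: "G \<in> {G. \<forall>\<tau>\<in>T. G \<inter> tpairs g \<tau> \<noteq> {}}"
      obtain F where F: "F \<in> fams G" "f G = real (card F)" using f_attained by blast
      then have "F = {}" using G by (auto simp: fams_def)
      then show "G \<in> {G. f G \<le> expec E p f - t}" using F by (simp add: t_def)
    qed
  qed auto
  also have "\<dots> \<le> exp (- 2 * t\<^sup>2 / (real g * real y)\<^sup>2)"
  proof (rule bounded_difference_lower_tail[where ?E0.0 = E0])
    have "0 \<le> (real y)\<^sup>2 / (12 * b * (real g)\<^sup>2)" using b1 by simp
    then show "0 \<le> t" unfolding t_def using Ef_ge by linarith
  qed (use p E0_sub card_E0 yg f_Lipschitz in \<open>auto simp: E_def\<close>)
  also have "\<dots> \<le> exp (- ((real y)\<^sup>2 / (72 * b\<^sup>2 * real g ^ 6)))"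
  proof -
    have "((real y)\<^sup>2 / (12 * b * (real g)\<^sup>2))\<^sup>2 \<le> t\<^sup>2"
      unfolding t_def using Ef_ge b1 by (intro power_mono) auto
    then have "2 * ((real y)\<^sup>2 / (12 * b * (real g)\<^sup>2))\<^sup>2 / (real g * real y)\<^sup>2 \<le> 2 * t\<^sup>2 / (real g * real y)\<^sup>2"
      by (intro divide_right_mono) auto
    moreover have "2 * ((real y)\<^sup>2 / (12 * b * (real g)\<^sup>2))\<^sup>2 / (real g * real y)\<^sup>2 = (real y)\<^sup>2 / (72 * b\<^sup>2 * real g ^ 6)"
      using yg b1 by (simp add: field_simps power2_eq_square eval_nat_numeral)
    ultimately show ?thesis by simp
  qed
  finally show ?thesis .
qed

end

lemma split_into_blocks:
  assumes "finite W" "card W = g * y"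
  obtains Wp :: "nat \<Rightarrow> 'a set" where "\<And>i. i < g \<Longrightarrow> Wp i \<subseteq> W \<and> card (Wp i) = y"
    "\<And>i j x. i < g \<Longrightarrow> j < g \<Longrightarrow> x \<in> Wp i \<Longrightarrow> x \<in> Wp j \<Longrightarrow> i = j"
proof -
  obtain h where h: "bij_betw h {0..<card W} W" using ex_bij_betw_nat_finite[OF assms(1)] by blast
  have inj: "inj_on h {0..<g * y}" and im: "h ` {0..<g * y} = W"
    using h assms by (auto simp: bij_betw_def)
  define I where "I = (\<lambda>i. {i * y..<i * y + y})"
  have I: "I i \<subseteq> {0..<g * y}" if "i < g" for i
  proof -
    have "i * y + y \<le> g * y" using that by (metis Suc_leI add.commute mult_Suc mult_le_mono1)
    then show ?thesis by (auto simp: I_def)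
  qed
  have dv: "i = a div y" if "a \<in> I i" for a i
    using that unfolding I_def by (intro div_nat_eqI[symmetric]) (auto simp: mult.commute)
  show ?thesis
  proof (rule that[of "\<lambda>i. h ` I i"])
    fix i assume i: "i < g"
    have "card (h ` I i) = card (I i)" by (rule card_image) (rule inj_on_subset[OF inj I[OF i]])
    then show "h ` I i \<subseteq> W \<and> card (h ` I i) = y" using I[OF i] im by (auto simp: I_def)
  next
    fix i j x assume *: "i < g" "j < g" "x \<in> h ` I i" "x \<in> h ` I j"
    then obtain a b where "a \<in> I i" "b \<in> I j" "h a = h b" by auto
    moreover from this have "a = b" using inj I[OF *(1)] I[OF *(2)] by (meson inj_onD subsetD)
    ultimately show "i = j" using dv by metis
  qed
qed

definition indep :: "'a set set \<Rightarrow> 'a set \<Rightarrow> bool" where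
  "indep G I \<longleftrightarrow> (\<forall>u\<in>I. \<forall>v\<in>I. u \<noteq> v \<longrightarrow> {u, v} \<notin> G)"

definition has_indep :: "nat \<Rightarrow> nat \<Rightarrow> nat \<Rightarrow> nat set set \<Rightarrow> bool" where
  "has_indep n g y G \<longleftrightarrow> (\<forall>W. W \<subseteq> {1..n} \<and> card W = g * y \<longrightarrow> (\<exists>I\<subseteq>W. card I = g \<and> indep G I))"

text \<open>With \<open>g\<close> of order L and \<open>y\<close> of order n / L^2 the exponent is
  of order n^2 / L^10, so the union over all vertex sets \<open>W\<close> can afford the factor
  \<open>2 ^ n\<close>.\<close>

lemma prob_not_has_indep:
  assumes p: "0 < p" "p < 1" and "2 \<le> g" "1 \<le> y"
    and "real g / real y * (1 / (1 - p)) powr (real (g + 1) / 2) \<le> 1"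
  shows "measure_pmf.prob (gnp n p) {G. \<not> has_indep n g y G}
    \<le> 2 ^ n * exp (- ((real y)\<^sup>2 / (72 * (1 / (1 - p))\<^sup>2 * real g ^ 6)))"
proof -
  define WW where "WW = {W. W \<subseteq> {1..n} \<and> card W = g * y}"
  have finWW: "finite WW" unfolding WW_def by (rule finite_subset[of _ "Pow {1..n}"]) auto
  define bad where "bad = (\<lambda>W :: nat set. {G. \<not> (\<exists>I\<subseteq>W. card I = g \<and> indep G I)})"
  have "{G. \<not> has_indep n g y G} = (\<Union>W\<in>WW. bad W)"
    by (auto simp: has_indep_def WW_def bad_def)
  then have "measure_pmf.prob (gnp n p) {G. \<not> has_indep n g y G} \<le> (\<Sum>W\<in>WW. measure_pmf.prob (gnp n p) (bad W))"
    using finWW by (simp add: measure_UNION_le)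
  also have "\<dots> \<le> (\<Sum>W\<in>WW. exp (- ((real y)\<^sup>2 / (72 * (1 / (1 - p))\<^sup>2 * real g ^ 6))))"
  proof (rule sum_mono)
    fix W assume W: "W \<in> WW"
    have finW: "finite W" using W finite_subset by (auto simp: WW_def)
    obtain Wp where WpW: "\<And>i. i < g \<Longrightarrow> Wp i \<subseteq> W \<and> card (Wp i) = y"
      "\<And>i j x. i < g \<Longrightarrow> j < g \<Longrightarrow> x \<in> Wp i \<Longrightarrow> x \<in> Wp j \<Longrightarrow> i = j"
      using split_into_blocks[of W g y] finW W by (auto simp: WW_def)
    interpret transversals g y n Wp p
    proof
      show "Wp i \<subseteq> {1..n} \<and> card (Wp i) = y" if "i < g" for i
        using WpW(1)[OF that] W by (auto simp: WW_def)
    qed (use assms WpW(2) in blast)+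
    have "bad W \<subseteq> {G. \<forall>\<tau>\<in>T. G \<inter> tpairs g \<tau> \<noteq> {}}"
    proof
      fix G assume G: "G \<in> bad W"
      have "G \<inter> tpairs g \<tau> \<noteq> {}" if t: "\<tau> \<in> T" for \<tau>
      proof
        assume e: "G \<inter> tpairs g \<tau> = {}"
        have "indep G (\<tau> ` {..<g})"
          unfolding indep_def
        proof (clarsimp)
          fix i j assume ij: "i < g" "j < g" "\<tau> i \<noteq> \<tau> j" "{\<tau> i, \<tau> j} \<in> G"
          have "i \<noteq> j" using ij by auto
          then have "{\<tau> i, \<tau> j} = \<tau> ` {i, j}" "card {i, j} = 2" "{i, j} \<subseteq> {..<g}" using ij by auto
          then have "{\<tau> i, \<tau> j} \<in> tpairs g \<tau>" unfolding tpairs_def by blast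
          then show False using e ij by blast
        qed
        moreover have "card (\<tau> ` {..<g}) = g" using card_image[OF inj_T[OF t]] by simp
        moreover have "\<tau> ` {..<g} \<subseteq> W"
        proof (rule image_subsetI)
          fix i assume "i \<in> {..<g}"
          then show "\<tau> i \<in> W" using T_in[OF t, of i] WpW(1)[of i] by auto
        qed
        ultimately show False using G by (auto simp: bad_def)
      qed
      then show "G \<in> {G. \<forall>\<tau>\<in>T. G \<inter> tpairs g \<tau> \<noteq> {}}" by blast
    qed
    then have "measure_pmf.prob (gnp n p) (bad W) \<le> measure_pmf.prob (gnp n p) {G. \<forall>\<tau>\<in>T. G \<inter> tpairs g \<tau> \<noteq> {}}"
      by (intro measure_pmf.finite_measure_mono) auto
    also have "\<dots> \<le> exp (- ((real y)\<^sup>2 / (72 * (1 / (1 - p))\<^sup>2 * real g ^ 6)))"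
      using prob_no_indep_transversal unfolding E_def b_def gnp_eq_random_subset .
    finally show "measure_pmf.prob (gnp n p) (bad W) \<le> exp (- ((real y)\<^sup>2 / (72 * (1 / (1 - p))\<^sup>2 * real g ^ 6)))" .
  qed
  also have "\<dots> = real (card WW) * exp (- ((real y)\<^sup>2 / (72 * (1 / (1 - p))\<^sup>2 * real g ^ 6)))" by simp
  also have "\<dots> \<le> 2 ^ n * exp (- ((real y)\<^sup>2 / (72 * (1 / (1 - p))\<^sup>2 * real g ^ 6)))"
  proof (rule mult_right_mono)
    have "card WW \<le> card (Pow {1..n})" by (intro card_mono) (auto simp: WW_def)
    also have "\<dots> = 2 ^ n" by (simp add: card_Pow)
    finally show "real (card WW) \<le> 2 ^ n" by (metis of_nat_le_iff of_nat_numeral of_nat_power)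
  qed simp
  finally show ?thesis .
qed

section \<open>Edges between two sets, and common neighbours\<close>

definition edge_dense :: "nat \<Rightarrow> nat \<Rightarrow> nat \<Rightarrow> real \<Rightarrow> nat set set \<Rightarrow> bool" where
  "edge_dense n s r p G \<longleftrightarrow> (\<forall>A R. A \<subseteq> {1..n} \<and> R \<subseteq> {1..n} \<and> A \<inter> R = {} \<and> card A = s \<and> card R = r \<longrightarrow>
     (\<exists>x\<in>A. p / 2 * real r \<le> real (card {v\<in>R. {x, v} \<in> G})))"

text \<open>If every \<open>x \<in> A\<close> has too few neighbours in \<open>R\<close>, the number
  of edges between \<open>A\<close> and \<open>R\<close> is at most half its mean. This number
  changes by at most one with each edge.\<close>

lemma prob_few_edges:
  assumes p: "0 < p" "p < 1" and AR: "A \<subseteq> {1..n}" "R \<subseteq> {1..n}" "A \<inter> R = {}" "A \<noteq> {}" "R \<noteq> {}"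
  shows "measure_pmf.prob (gnp n p) {G. \<forall>x\<in>A. real (card {v\<in>R. {x, v} \<in> G}) < p / 2 * real (card R)}
    \<le> exp (- (p\<^sup>2 * real (card A) * real (card R) / 2))"
proof -
  define E where "E = all_pairs n"
  have fin: "finite A" "finite R" "finite E"
    using finite_subset[OF AR(1)] finite_subset[OF AR(2)] by (simp_all add: E_def)
  define F where "F = (\<lambda>(x, v). {x, v}) ` (A \<times> R)"
  have inj: "inj_on (\<lambda>(x, v). {x, v}) (A \<times> R)"
    using AR(3) by (auto simp: inj_on_def doubleton_eq_iff)
  have FE: "F \<subseteq> E"
  proof
    fix e assume "e \<in> F"
    then obtain x v where v: "x \<in> A" "v \<in> R" "e = {x, v}" by (auto simp: F_def)
    have "x \<in> {1..n}" "v \<in> {1..n}" "x \<noteq> v" using v AR(1,2,3) by blast+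
    then show "e \<in> E" unfolding v(3) E_def doubleton_in_all_pairs by blast
  qed
  have finF: "finite F" using FE fin finite_subset by blast
  have cF: "card F = card A * card R"
    unfolding F_def by (simp add: card_image[OF inj] card_cartesian_product)
  have cpos: "0 < card A" "0 < card R" using AR fin by (auto simp: card_gt_0_iff)
  define f where "f = (\<lambda>G. real (card (G \<inter> F)))"
  have Ef: "expec E p f = p * real (card F)"
  proof -
    have "expec E p f = expec E p (\<lambda>G. \<Sum>e\<in>F. indicator {G. {e} \<subseteq> G} G)"
      by (rule expec_cong) (use finF in \<open>simp add: f_def indicator_def sum.If_cases Int_commute\<close>)
    also have "\<dots> = (\<Sum>e\<in>F. measure_pmf.prob (random_subset E p) {G. {e} \<subseteq> G})"
      using fin by (subst Bochner_Integration.integral_sum) auto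
    also have "\<dots> = (\<Sum>e\<in>F. p ^ card {e})"
      using FE fin p by (intro sum.cong refl prob_random_subset_subset) auto
    finally show ?thesis by simp
  qed
  define t where "t = p * real (card F) / 2"
  have "measure_pmf.prob (gnp n p) {G. \<forall>x\<in>A. real (card {v\<in>R. {x, v} \<in> G}) < p / 2 * real (card R)}
     \<le> measure_pmf.prob (random_subset E p) {G. f G \<le> expec E p f - t}"
    unfolding gnp_eq_random_subset E_def[symmetric]
  proof (rule measure_pmf.finite_measure_mono)
    show "{G. \<forall>x\<in>A. real (card {v\<in>R. {x, v} \<in> G}) < p / 2 * real (card R)} \<subseteq> {G. f G \<le> expec E p f - t}"
    proof
      fix G assume G: "G \<in> {G. \<forall>x\<in>A. real (card {v\<in>R. {x, v} \<in> G}) < p / 2 * real (card R)}"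
      have "G \<inter> F \<subseteq> (\<Union>x\<in>A. (\<lambda>v. {x, v}) ` {v\<in>R. {x, v} \<in> G})" by (auto simp: F_def)
      then have "card (G \<inter> F) \<le> card (\<Union>x\<in>A. (\<lambda>v. {x, v}) ` {v\<in>R. {x, v} \<in> G})"
        using fin by (intro card_mono) auto
      also have "\<dots> \<le> (\<Sum>x\<in>A. card ((\<lambda>v. {x, v}) ` {v\<in>R. {x, v} \<in> G}))" using fin by (intro card_UN_le) auto
      also have "\<dots> \<le> (\<Sum>x\<in>A. card {v\<in>R. {x, v} \<in> G})" using fin by (intro sum_mono card_image_le) auto
      finally have "f G \<le> (\<Sum>x\<in>A. real (card {v\<in>R. {x, v} \<in> G}))" by (simp add: f_def flip: of_nat_sum)
      also have "\<dots> \<le> (\<Sum>x\<in>A. p / 2 * real (card R))" using G by (intro sum_mono) (auto intro: less_imp_le)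
      also have "\<dots> = expec E p f - t" by (simp add: Ef t_def cF)
      finally show "G \<in> {G. f G \<le> expec E p f - t}" by simp
    qed
  qed auto
  also have "\<dots> \<le> exp (- 2 * t\<^sup>2 / real (card F))"
  proof (rule bounded_difference_lower_tail[where ?E0.0 = F])
    show "0 < real (card F)" using cpos by (simp add: cF)
    fix e S assume "e \<in> E" "S \<subseteq> E" "e \<notin> S"
    have fS: "finite (S \<inter> F)" using finF by simp
    show "\<bar>f (insert e S) - f S\<bar> \<le> (if e \<in> F then 1 else 0)"
      using fS \<open>e \<notin> S\<close> by (auto simp: f_def Int_insert_left)
  qed (use fin p FE in \<open>auto simp: t_def\<close>)
  also have "- 2 * t\<^sup>2 / real (card F) = - (p\<^sup>2 * real (card A) * real (card R) / 2)"
    using cpos by (simp add: t_def cF power2_eq_square field_simps)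
  finally show ?thesis .
qed

lemma prob_not_edge_dense:
  assumes p: "0 < p" "p < 1" and "1 \<le> s" "1 \<le> r"
  shows "measure_pmf.prob (gnp n p) {G. \<not> edge_dense n s r p G} \<le> 4 ^ n * exp (- (p\<^sup>2 * real s * real r / 2))"
proof -
  define AR where "AR = {(A, R). A \<subseteq> {1..n} \<and> R \<subseteq> {1..n} \<and> A \<inter> R = {} \<and> card A = s \<and> card R = r}"
  have sub: "AR \<subseteq> Pow {1..n} \<times> Pow {1..n}" by (auto simp: AR_def)
  have fin: "finite AR" by (rule finite_subset[OF sub]) auto
  define bad where "bad = (\<lambda>(A :: nat set, R). {G. \<forall>x\<in>A. real (card {v\<in>R. {x, v} \<in> G}) < p / 2 * real (card R)})"
  have "{G. \<not> edge_dense n s r p G} \<subseteq> (\<Union>x\<in>AR. bad x)"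
  proof
    fix G assume "G \<in> {G. \<not> edge_dense n s r p G}"
    then obtain A R where AR: "A \<subseteq> {1..n}" "R \<subseteq> {1..n}" "A \<inter> R = {}" "card A = s" "card R = r"
      "\<forall>x\<in>A. \<not> p / 2 * real r \<le> real (card {v\<in>R. {x, v} \<in> G})"
      unfolding edge_dense_def mem_Collect_eq by blast
    have "(A, R) \<in> AR" using AR(1-5) unfolding AR_def by simp
    moreover have "G \<in> bad (A, R)" using AR(5,6) unfolding bad_def by (simp add: not_le)
    ultimately show "G \<in> (\<Union>x\<in>AR. bad x)" by blast
  qed
  then have "measure_pmf.prob (gnp n p) {G. \<not> edge_dense n s r p G} \<le> measure_pmf.prob (gnp n p) (\<Union>x\<in>AR. bad x)"
    by (intro measure_pmf.finite_measure_mono) auto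
  also have "\<dots> \<le> (\<Sum>x\<in>AR. measure_pmf.prob (gnp n p) (bad x))"
    using fin by (intro measure_UNION_le) auto
  also have "\<dots> \<le> (\<Sum>x\<in>AR. exp (- (p\<^sup>2 * real s * real r / 2)))"
  proof (rule sum_mono)
    fix x assume "x \<in> AR"
    then obtain A R where x: "x = (A, R)" "A \<subseteq> {1..n}" "R \<subseteq> {1..n}" "A \<inter> R = {}" "card A = s" "card R = r"
      by (auto simp: AR_def)
    have "A \<noteq> {}" "R \<noteq> {}" using x assms by auto
    then show "measure_pmf.prob (gnp n p) (bad x) \<le> exp (- (p\<^sup>2 * real s * real r / 2))"
      using prob_few_edges[OF p x(2,3,4)] x by (simp add: bad_def)
  qed
  also have "\<dots> = real (card AR) * exp (- (p\<^sup>2 * real s * real r / 2))" by simp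
  also have "\<dots> \<le> 4 ^ n * exp (- (p\<^sup>2 * real s * real r / 2))"
  proof (rule mult_right_mono)
    have "card AR \<le> card (Pow {1..n} \<times> Pow {1..n})" using sub by (intro card_mono) auto
    also have "\<dots> = 4 ^ n" by (simp add: card_cartesian_product card_Pow power_mult_distrib[symmetric])
    finally show "real (card AR) \<le> 4 ^ n" by (metis of_nat_le_iff of_nat_numeral of_nat_power)
  qed simp
  finally show ?thesis .
qed

text \<open>The set \<open>J\<close> says where the common neighbours are to be found: later it is
  either all of \<open>{1..n}\<close> or an initial segment reserved for the centres of leftover
  leaves.\<close>

definition common_nbrs :: "nat \<Rightarrow> nat \<Rightarrow> real \<Rightarrow> nat set \<Rightarrow> nat set set \<Rightarrow> bool" where
  "common_nbrs n q p J G \<longleftrightarrow> (\<forall>S. S \<subseteq> {1..n} \<and> card S = q \<longrightarrow>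
     p ^ q / 2 * (real (card J) - real q) \<le> real (card {w\<in>J - S. \<forall>v\<in>S. {w, v} \<in> G}))"

text \<open>The stars from different vertices \<open>w\<close> outside \<open>S\<close> to
  \<open>S\<close> are edge-disjoint, so one edge completes at most one star, and the number of
  complete stars obeys the bounded difference inequality.\<close>

lemma prob_few_common_nbrs:
  assumes p: "0 < p" "p < 1" and S: "S \<subseteq> {1..n}" "card S = q" "1 \<le> q" and J: "J \<subseteq> {1..n}" "q < card J"
  shows "measure_pmf.prob (gnp n p) {G. real (card {w\<in>J - S. \<forall>v\<in>S. {w, v} \<in> G}) < p ^ q / 2 * (real (card J) - real q)}
    \<le> exp (- (p ^ (2 * q) * (real (card J) - real q) / (2 * real q)))"
proof -
  define E where "E = all_pairs n"
  have fin: "finite S" "finite J" "finite E"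
    using finite_subset[OF S(1)] finite_subset[OF J(1)] by (simp_all add: E_def)
  define K where "K = J - S"
  have finK: "finite K" using fin by (simp add: K_def)
  define k where "k = real (card K)"
  have "card J - card S \<le> card (J - S)" using fin by (intro diff_card_le_card_Diff) auto
  then have kJ: "real (card J) - real q \<le> k" using S J by (simp add: k_def K_def)
  have k0: "0 < k" using kJ J by linarith
  define F where "F = (\<lambda>w. (\<lambda>v. {w, v}) ` S)"
  have Fw: "F w \<subseteq> E" "card (F w) = q" if "w \<in> K" for w
  proof -
    show "F w \<subseteq> E"
    proof
      fix e assume "e \<in> F w"
      then obtain v where v: "v \<in> S" "e = {w, v}" by (auto simp: F_def)
      have "w \<in> {1..n}" "v \<in> {1..n}" "w \<noteq> v" using that v S(1) J(1) unfolding K_def by blast+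
      then show "e \<in> E" unfolding v(2) E_def doubleton_in_all_pairs by blast
    qed
    have "inj_on (\<lambda>v. {w, v}) S" by (auto simp: inj_on_def doubleton_eq_iff)
    then show "card (F w) = q" using S by (simp add: F_def card_image)
  qed
  have disj: "w = w'" if "e \<in> F w" "e \<in> F w'" "w \<in> K" "w' \<in> K" for e w w'
    using that by (auto simp: F_def K_def doubleton_eq_iff)
  define E0 where "E0 = (\<Union>w\<in>K. F w)"
  have E0E: "E0 \<subseteq> E" using Fw by (auto simp: E0_def)
  have "card E0 \<le> (\<Sum>w\<in>K. card (F w))" unfolding E0_def using finK by (rule card_UN_le)
  also have "\<dots> = card K * q" using Fw by simp
  finally have "real (card E0) \<le> real (card K * q)" by (rule of_nat_mono)
  then have cE0: "real (card E0) \<le> k * real q" by (simp add: k_def)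
  define f where "f = (\<lambda>G. real (card {w\<in>K. F w \<subseteq> G}))"
  have Ef: "expec E p f = k * p ^ q"
  proof -
    have "expec E p f = expec E p (\<lambda>G. \<Sum>w\<in>K. indicator {G. F w \<subseteq> G} G)"
      by (rule expec_cong) (use finK in \<open>simp add: f_def indicator_def sum.If_cases Int_def\<close>)
    also have "\<dots> = (\<Sum>w\<in>K. measure_pmf.prob (random_subset E p) {G. F w \<subseteq> G})"
      using fin by (subst Bochner_Integration.integral_sum) auto
    also have "\<dots> = (\<Sum>w\<in>K. p ^ q)"
      using fin p Fw by (intro sum.cong refl) (simp add: prob_random_subset_subset)
    finally show ?thesis by (simp add: k_def)
  qed
  define t where "t = k * p ^ q / 2"
  have "measure_pmf.prob (gnp n p) {G. real (card {w\<in>J - S. \<forall>v\<in>S. {w, v} \<in> G}) < p ^ q / 2 * (real (card J) - real q)}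
     \<le> measure_pmf.prob (random_subset E p) {G. f G \<le> expec E p f - t}"
    unfolding gnp_eq_random_subset E_def[symmetric]
  proof (rule measure_pmf.finite_measure_mono)
    show "{G. real (card {w\<in>J - S. \<forall>v\<in>S. {w, v} \<in> G}) < p ^ q / 2 * (real (card J) - real q)} \<subseteq> {G. f G \<le> expec E p f - t}"
    proof
      fix G assume G: "G \<in> {G. real (card {w\<in>J - S. \<forall>v\<in>S. {w, v} \<in> G}) < p ^ q / 2 * (real (card J) - real q)}"
      have "{w\<in>J - S. \<forall>v\<in>S. {w, v} \<in> G} = {w\<in>K. F w \<subseteq> G}" by (auto simp: K_def F_def)
      then have "f G < p ^ q / 2 * (real (card J) - real q)" using G by (simp add: f_def)
      also have "\<dots> \<le> p ^ q / 2 * k" using kJ p by (intro mult_left_mono) auto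
      finally show "G \<in> {G. f G \<le> expec E p f - t}" by (simp add: Ef t_def field_simps)
    qed
  qed auto
  also have "\<dots> \<le> exp (- 2 * t\<^sup>2 / (k * real q))"
  proof (rule bounded_difference_lower_tail[where ?E0.0 = E0])
    fix e G assume e: "e \<in> E" "G \<subseteq> E" "e \<notin> G"
    define N where "N = {w\<in>K. F w \<subseteq> insert e G} - {w\<in>K. F w \<subseteq> G}"
    have sub: "{w\<in>K. F w \<subseteq> G} \<subseteq> {w\<in>K. F w \<subseteq> insert e G}" by auto
    have finN: "finite N" "finite {w\<in>K. F w \<subseteq> G}" "finite {w\<in>K. F w \<subseteq> insert e G}"
      using finK by (auto simp: N_def)
    have "card N = card {w\<in>K. F w \<subseteq> insert e G} - card {w\<in>K. F w \<subseteq> G}"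
      unfolding N_def by (rule card_Diff_subset) (use finN sub in auto)
    moreover have "card {w\<in>K. F w \<subseteq> G} \<le> card {w\<in>K. F w \<subseteq> insert e G}" using finN sub by (intro card_mono) auto
    ultimately have d: "f (insert e G) - f G = real (card N)" by (simp add: f_def)
    have Ne: "e \<in> F w" if "w \<in> N" for w using that by (auto simp: N_def)
    show "\<bar>f (insert e G) - f G\<bar> \<le> (if e \<in> E0 then 1 else 0)"
    proof (cases "e \<in> E0")
      case True
      have "w = w'" if "w \<in> N" "w' \<in> N" for w w'
        using disj[OF Ne Ne] that by (auto simp: N_def)
      then have "card N \<le> 1" using card_le_Suc0_iff_eq[OF finN(1)] by auto
      then show ?thesis using True d by simp
    next
      case False
      then have "N = {}" using Ne by (auto simp: E0_def N_def)
      then show ?thesis using d by simp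
    qed
  qed (use fin p E0E cE0 k0 S(3) in \<open>auto simp: t_def\<close>)
  also have "\<dots> \<le> exp (- (p ^ (2 * q) * (real (card J) - real q) / (2 * real q)))"
  proof -
    have "p ^ (2 * q) * (real (card J) - real q) / (2 * real q) \<le> p ^ (2 * q) * k / (2 * real q)"
      using kJ p by (intro divide_right_mono mult_left_mono) auto
    also have "\<dots> = 2 * t\<^sup>2 / (k * real q)"
      using k0 S(3) by (simp add: t_def power2_eq_square power_mult field_simps)
    finally show ?thesis by simp
  qed
  finally show ?thesis .
qed

lemma prob_not_common_nbrs:
  assumes p: "0 < p" "p < 1" and q: "1 \<le> q" and J: "J \<subseteq> {1..n}" "q < card J"
  shows "measure_pmf.prob (gnp n p) {G. \<not> common_nbrs n q p J G}
    \<le> real n ^ q * exp (- (p ^ (2 * q) * (real (card J) - real q) / (2 * real q)))"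
proof -
  define SS where "SS = {S. S \<subseteq> {1..n} \<and> card S = q}"
  have fin: "finite SS" unfolding SS_def by (rule finite_subset[of _ "Pow {1..n}"]) auto
  define bad where "bad = (\<lambda>S. {G. real (card {w\<in>J - S. \<forall>v\<in>S. {w, v} \<in> G}) < p ^ q / 2 * (real (card J) - real q)})"
  have "{G. \<not> common_nbrs n q p J G} \<subseteq> (\<Union>S\<in>SS. bad S)"
    by (auto simp: common_nbrs_def SS_def bad_def not_le)
  then have "measure_pmf.prob (gnp n p) {G. \<not> common_nbrs n q p J G} \<le> measure_pmf.prob (gnp n p) (\<Union>S\<in>SS. bad S)"
    by (intro measure_pmf.finite_measure_mono) auto
  also have "\<dots> \<le> (\<Sum>S\<in>SS. measure_pmf.prob (gnp n p) (bad S))"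
    using fin by (intro measure_UNION_le) auto
  also have "\<dots> \<le> (\<Sum>S\<in>SS. exp (- (p ^ (2 * q) * (real (card J) - real q) / (2 * real q))))"
    unfolding bad_def using p q J by (intro sum_mono prob_few_common_nbrs) (auto simp: SS_def)
  also have "\<dots> = real (card SS) * exp (- (p ^ (2 * q) * (real (card J) - real q) / (2 * real q)))" by simp
  also have "\<dots> \<le> real n ^ q * exp (- (p ^ (2 * q) * (real (card J) - real q) / (2 * real q)))"
  proof (rule mult_right_mono)
    have "card SS = n choose q" unfolding SS_def by (simp add: n_subsets)
    also have "\<dots> \<le> n ^ q"
    proof -
      have "card J \<le> card {1..n}" using J by (intro card_mono) auto
      then have "q \<le> n" using J by simp
      then show ?thesis by (rule binomial_le_pow)
    qed
    finally show "real (card SS) \<le> real n ^ q" by (metis of_nat_le_iff of_nat_power)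
  qed simp
  finally show ?thesis .
qed

section \<open>Building the sparse saturated graph\<close>

text \<open>Each round gives one centre a group of \<open>g\<close> vertices and then removes both.
  The two sides of \<open>g * s + card R \<le> g * card X\<close> fall by \<open>g\<close> together,
  so at least \<open>s\<close> centres remain available as long as \<open>r\<close> vertices are
  left.\<close>

lemma greedy_groups:
  fixes R X :: "nat set" and G :: "nat set set"
  assumes "finite R" "finite X" "g * s + card R \<le> g * card X" "1 \<le> g" "1 \<le> r"
    and step: "\<And>R' X'. R' \<subseteq> R \<Longrightarrow> X' \<subseteq> X \<Longrightarrow> r \<le> card R' \<Longrightarrow> s \<le> card X' \<Longrightarrow>
      \<exists>x\<in>X'. \<exists>I\<subseteq>R'. card I = g \<and> indep G I \<and> (\<forall>v\<in>I. {v, x} \<in> G)"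
  shows "\<exists>Rf c. Rf \<subseteq> R \<and> card Rf < r \<and> (\<forall>v\<in>R - Rf. c v \<in> X \<and> {v, c v} \<in> G) \<and>
     (\<forall>u\<in>R - Rf. \<forall>v\<in>R - Rf. u \<noteq> v \<longrightarrow> c u = c v \<longrightarrow> {u, v} \<notin> G)"
  using assms(1,2,3,6)
proof (induction "card R" arbitrary: R X rule: less_induct)
  case less
  show ?case
  proof (cases "card R < r")
    case True
    then show ?thesis by (intro exI[of _ R]) auto
  next
    case False
    have "g * s \<le> g * card X" using less.prems(3) by linarith
    then have sX: "s \<le> card X" using assms(4) by simp
    obtain x I where x: "x \<in> X" "I \<subseteq> R" "card I = g" "indep G I" "\<forall>v\<in>I. {v, x} \<in> G"
      using less.prems(4)[of R X] False sX by auto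
    have finI: "finite I" using x(2) less.prems(1) finite_subset by blast
    have cR: "card (R - I) = card R - g" using x finI by (simp add: card_Diff_subset)
    have gR: "g \<le> card R" using x card_mono[OF less.prems(1) x(2)] by simp
    have cX: "card (X - {x}) = card X - 1" using x less.prems(2) by simp
    have X1: "1 \<le> card X" using x less.prems(2) by (metis One_nat_def Suc_leI card_gt_0_iff empty_iff)
    have le: "g * s + card (R - I) \<le> g * card (X - {x})"
      unfolding cR cX using less.prems(3) gR X1 by (simp add: diff_mult_distrib2)
    have lt: "card (R - I) < card R" using cR gR assms(4) by simp
    have st: "\<exists>y\<in>X'. \<exists>I\<subseteq>R'. card I = g \<and> indep G I \<and> (\<forall>v\<in>I. {v, y} \<in> G)"
      if "R' \<subseteq> R - I" "X' \<subseteq> X - {x}" "r \<le> card R'" "s \<le> card X'" for R' X'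
      by (rule less.prems(4)) (use that in auto)
    have fins: "finite (R - I)" "finite (X - {x})" using less.prems by auto
    obtain Rf c where c: "Rf \<subseteq> R - I" "card Rf < r" "\<forall>v\<in>R - I - Rf. c v \<in> X - {x} \<and> {v, c v} \<in> G"
      "\<forall>u\<in>R - I - Rf. \<forall>v\<in>R - I - Rf. u \<noteq> v \<longrightarrow> c u = c v \<longrightarrow> {u, v} \<notin> G"
      using less.hyps[OF lt fins le st] by blast
    define c' where "c' = (\<lambda>v. if v \<in> I then x else c v)"
    have "c' v \<in> X \<and> {v, c' v} \<in> G" if "v \<in> R - Rf" for v
      using that c(3) x by (cases "v \<in> I") (auto simp: c'_def)
    moreover have "{u, v} \<notin> G" if uv: "u \<in> R - Rf" "v \<in> R - Rf" "u \<noteq> v" "c' u = c' v" for u v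
    proof (cases "u \<in> I \<and> v \<in> I")
      case True
      then show ?thesis using x(4) uv by (auto simp: indep_def)
    next
      case False
      have out: "c w \<noteq> x" if "w \<in> R - Rf" "w \<notin> I" for w using c(3) that by auto
      have "u \<notin> I" "v \<notin> I"
        using False uv out[of u] out[of v] by (auto simp: c'_def split: if_splits)
      then show ?thesis using c(4) uv by (auto simp: c'_def)
    qed
    ultimately show ?thesis using c(1,2) by (intro exI[of _ Rf] exI[of _ c']) auto
  qed
qed

text \<open>Greedy choice: with at most \<open>k\<close> vertices to serve, fewer than
  \<open>k\<close> values are taken when the next one chooses.\<close>

lemma injective_choice:
  assumes "finite R" "\<And>v. v \<in> R \<Longrightarrow> finite (N v) \<and> k \<le> card (N v)" "card R \<le> k"
  shows "\<exists>c. inj_on c R \<and> (\<forall>v\<in>R. c v \<in> N v)"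
  using assms
proof (induction R rule: finite_induct)
  case (insert v R)
  then obtain c where c: "inj_on c R" "\<forall>u\<in>R. c u \<in> N u" by auto
  have "card (c ` R) < card (N v)"
    using card_image_le[OF insert.hyps(1), of c] insert by force
  then have "\<not> N v \<subseteq> c ` R" using card_mono[of "c ` R" "N v"] insert.hyps by auto
  then obtain z where z: "z \<in> N v" "z \<notin> c ` R" by blast
  define c' where "c' = (\<lambda>u. if u = v then z else c u)"
  have "inj_on c' (insert v R)"
    using c(1) z(2) insert.hyps(2) by (auto simp: inj_on_def c'_def)
  moreover have "\<forall>u\<in>insert v R. c' u \<in> N u" using c(2) z by (auto simp: c'_def)
  ultimately show ?case by blast
qed auto

text \<open>Enlarging \<open>S\<close> to exactly \<open>q\<close> vertices can only lose common
  neighbours.\<close>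

lemma common_nbrs_smaller:
  assumes cn: "common_nbrs n q p J G" and S: "S \<subseteq> {1..n}" "card S \<le> q" "q \<le> n" and J: "finite J"
  shows "p ^ q / 2 * (real (card J) - real q) \<le> real (card {w\<in>J - S. \<forall>v\<in>S. {w, v} \<in> G})"
proof -
  obtain S' where S': "S \<subseteq> S'" "S' \<subseteq> {1..n}" "card S' = q"
    using exists_subset_between[of S q "{1..n}"] S by auto
  have "p ^ q / 2 * (real (card J) - real q) \<le> real (card {w\<in>J - S'. \<forall>v\<in>S'. {w, v} \<in> G})"
    using cn S' by (auto simp: common_nbrs_def)
  also have "\<dots> \<le> real (card {w\<in>J - S. \<forall>v\<in>S. {w, v} \<in> G})"
    using S'(1) J by (intro of_nat_mono card_mono) auto
  finally show ?thesis .
qed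

lemma clique_exists:
  assumes cn: "common_nbrs n q p {1..n} G" and q: "q < n" and p: "0 < p" and k: "k \<le> q"
  shows "\<exists>bs. length bs = k \<and> distinct bs \<and> set bs \<subseteq> {1..n} \<and>
    (\<forall>u\<in>set bs. \<forall>v\<in>set bs. u \<noteq> v \<longrightarrow> {u, v} \<in> G)"
  using k
proof (induction k)
  case (Suc k)
  then obtain bs where bs: "length bs = k" "distinct bs" "set bs \<subseteq> {1..n}"
    "\<forall>u\<in>set bs. \<forall>v\<in>set bs. u \<noteq> v \<longrightarrow> {u, v} \<in> G" by auto
  have "card (set bs) \<le> q" using bs Suc.prems distinct_card by fastforce
  then have "p ^ q / 2 * (real (card {1..n}) - real q) \<le> real (card {w\<in>{1..n} - set bs. \<forall>v\<in>set bs. {w, v} \<in> G})"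
    using cn bs q by (intro common_nbrs_smaller) auto
  moreover have "0 < p ^ q / 2 * (real (card {1..n}) - real q)" using p q by simp
  ultimately have "{w\<in>{1..n} - set bs. \<forall>v\<in>set bs. {w, v} \<in> G} \<noteq> {}" by (metis card.empty not_le of_nat_0)
  then obtain w where w: "w \<in> {1..n}" "w \<notin> set bs" "\<forall>v\<in>set bs. {w, v} \<in> G" by blast
  then show ?case using bs by (intro exI[of _ "w # bs"]) (auto simp: insert_commute)
qed auto

text \<open>All centres are common neighbours of the hubs. Those in \<open>X1\<close>, outside
  \<open>{1..j0}\<close>, receive groups of \<open>g\<close> leaves greedily: some \<open>x\<close>
  has \<open>g * y\<close> neighbours among the remaining vertices, and these contain an independent
  set of order \<open>g\<close>. Fewer than \<open>r\<close> vertices are left over; each gets a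
  private centre in \<open>X2\<close>, inside \<open>{1..j0}\<close>. Centres without leaves do no
  harm.\<close>

lemma saturated_exists:
  fixes p :: real
  assumes p: "0 < p" and m: "5 \<le> m" and G: "G \<subseteq> all_pairs n"
    and cn1: "common_nbrs n m p {1..n} G" and cn2: "common_nbrs n m p {1..j0} G"
    and dn: "edge_dense n s r p G" and hi: "has_indep n g y G"
    and mn: "m < n" "j0 \<le> n" and gy: "real (g * y) \<le> p / 2 * real r"
    and j0: "real r \<le> p ^ m / 2 * (real j0 - real m)"
    and n1: "real (n1 + j0) \<le> p ^ m / 2 * (real n - real m)" "2 \<le> n1"
    and gs: "g * s + n \<le> g * n1" "1 \<le> g" "1 \<le> r"
  shows "\<exists>H. cycle_saturated m G H \<and> card H \<le> n + n1 + j0 + m\<^sup>2"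
proof -
  obtain bs where bs: "length bs = m - 2" "distinct bs" "set bs \<subseteq> {1..n}"
    "\<forall>u\<in>set bs. \<forall>v\<in>set bs. u \<noteq> v \<longrightarrow> {u, v} \<in> G"
    using clique_exists[OF cn1 mn(1) p, of "m - 2"] by auto
  obtain h1 h2 rest where hb: "bs = h1 # h2 # rest"
  proof (cases bs)
    case Nil
    then show ?thesis using bs(1) m by simp
  next
    case (Cons a as)
    then show ?thesis using that bs(1) m by (cases as) auto
  qed
  define B where "B = set bs"
  have B: "B \<subseteq> {1..n}" "card B = m - 2" "h1 \<in> B" "h2 \<in> B"
    using bs distinct_card[OF bs(2)] hb by (auto simp: B_def)
  define Y where "Y = {w\<in>{1..n} - B. \<forall>v\<in>B. {w, v} \<in> G}"
  have finY: "finite Y" by (simp add: Y_def)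
  have "p ^ m / 2 * (real (card {1..n}) - real m) \<le> real (card {w\<in>{1..n} - B. \<forall>v\<in>B. {w, v} \<in> G})"
    by (rule common_nbrs_smaller[OF cn1]) (use B mn in auto)
  then have "n1 + j0 \<le> card Y" using n1(1) unfolding Y_def by simp
  moreover have "card Y - card {1..j0} \<le> card (Y - {1..j0})" by (rule diff_card_le_card_Diff) simp
  ultimately have "n1 \<le> card (Y - {1..j0})" by simp
  then obtain X1 where X1: "X1 \<subseteq> Y - {1..j0}" "card X1 = n1" "finite X1"
    using obtain_subset_with_card_n by metis
  define X2 where "X2 = {w\<in>{1..j0} - B. \<forall>v\<in>B. {w, v} \<in> G}"
  have X2: "finite X2" "X2 \<subseteq> {1..j0}" "X2 \<subseteq> Y" using mn(2) by (auto simp: X2_def Y_def)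
  have cX2: "card X2 \<le> j0" using card_mono[OF _ X2(2)] by simp
  define X where "X = X1 \<union> X2"
  have X12: "X1 \<inter> X2 = {}" using X1 X2 by auto
  have XY: "X \<subseteq> Y" using X1 X2 by (auto simp: X_def)
  have finX: "finite X" using X1 X2 by (simp add: X_def)
  have cX: "card X \<le> n1 + j0" unfolding X_def using card_Un_le[of X1 X2] X1 cX2 by linarith
  have X2le: "2 \<le> card X" using card_mono[OF finX, of X1] X1 n1(2) by (auto simp: X_def)
  define R where "R = {1..n} - B - X"
  have finR: "finite R" by (simp add: R_def)
  have cRn: "card R \<le> n" using card_mono[of "{1..n}" R] by (auto simp: R_def)
  have "\<exists>Rf c. Rf \<subseteq> R \<and> card Rf < r \<and> (\<forall>v\<in>R - Rf. c v \<in> X1 \<and> {v, c v} \<in> G) \<and>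
     (\<forall>u\<in>R - Rf. \<forall>v\<in>R - Rf. u \<noteq> v \<longrightarrow> c u = c v \<longrightarrow> {u, v} \<notin> G)"
  proof (rule greedy_groups[OF finR X1(3) _ gs(2,3)])
    show "g * s + card R \<le> g * card X1" using gs(1) X1(2) cRn by simp
    fix R' X' assume R': "R' \<subseteq> R" "X' \<subseteq> X1" "r \<le> card R'" "s \<le> card X'"
    \<comment> \<open>\<open>edge_dense\<close> speaks of sets of exact order, so both sets are
      first cut down to size.\<close>
    obtain R'' where R'': "R'' \<subseteq> R'" "card R'' = r" "finite R''" using obtain_subset_with_card_n[OF R'(3)] by metis
    obtain X'' where X'': "X'' \<subseteq> X'" "card X'' = s" "finite X''" using obtain_subset_with_card_n[OF R'(4)] by metis
    have sub: "X'' \<subseteq> {1..n}" "R'' \<subseteq> {1..n}" "X'' \<inter> R'' = {}"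
      using R'(1,2) R''(1) X''(1) X1(1) unfolding R_def X_def Y_def by blast+
    obtain x where x: "x \<in> X''" "p / 2 * real r \<le> real (card {v\<in>R''. {x, v} \<in> G})"
      using dn sub R'' X'' unfolding edge_dense_def by blast
    have "real (g * y) \<le> real (card {v\<in>R''. {x, v} \<in> G})" using gy x(2) by linarith
    then have "g * y \<le> card {v\<in>R''. {x, v} \<in> G}" by (simp only: of_nat_le_iff)
    from obtain_subset_with_card_n[OF this] obtain W
      where W: "W \<subseteq> {v\<in>R''. {x, v} \<in> G}" "card W = g * y" by blast
    have "W \<subseteq> {1..n}" using W(1) sub(2) by auto
    then obtain I where I: "I \<subseteq> W" "card I = g" "indep G I" using hi W(2) unfolding has_indep_def by blast
    have "\<forall>v\<in>I. {v, x} \<in> G" using I(1) W(1) by (auto simp: insert_commute)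
    moreover have "I \<subseteq> R'" using I(1) W(1) R''(1) by auto
    moreover have "x \<in> X'" using x(1) X''(1) by auto
    ultimately show "\<exists>x\<in>X'. \<exists>I\<subseteq>R'. card I = g \<and> indep G I \<and> (\<forall>v\<in>I. {v, x} \<in> G)" using I(2,3) by blast
  qed
  then obtain Rf c1 where Rf: "Rf \<subseteq> R" "card Rf < r"
    and c1: "\<forall>v\<in>R - Rf. c1 v \<in> X1 \<and> {v, c1 v} \<in> G"
      "\<forall>u\<in>R - Rf. \<forall>v\<in>R - Rf. u \<noteq> v \<longrightarrow> c1 u = c1 v \<longrightarrow> {u, v} \<notin> G" by blast
  have finRf: "finite Rf" using Rf(1) finR finite_subset by blast
  \<comment> \<open>A usable private centre must be adjacent to \<open>v\<close> as well as to all
    hubs. These are \<open>m - 1\<close> vertices in all, within reach of \<open>common_nbrs\<close>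
    for \<open>m\<close>.\<close>
  have nb: "r \<le> card {w\<in>X2. {w, v} \<in> G}" if v: "v \<in> Rf" for v
  proof -
    have vn: "v \<in> {1..n}" "v \<notin> B" using v Rf(1) by (auto simp: R_def)
    have "card (insert v B) \<le> m" using card_insert_le_m1[of m B v] B(2) m by simp
    then have "p ^ m / 2 * (real (card {1..j0}) - real m) \<le>
        real (card {w\<in>{1..j0} - insert v B. \<forall>u\<in>insert v B. {w, u} \<in> G})"
      by (intro common_nbrs_smaller[OF cn2]) (use B vn mn in auto)
    also have "\<dots> \<le> real (card {w\<in>X2. {w, v} \<in> G})"
      using X2(1) by (intro of_nat_mono card_mono) (auto simp: X2_def)
    finally have "real r \<le> real (card {w\<in>X2. {w, v} \<in> G})" using j0 by simp
    then show ?thesis by (simp only: of_nat_le_iff)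
  qed
  obtain c2 where c2: "inj_on c2 Rf" "\<forall>v\<in>Rf. c2 v \<in> {w\<in>X2. {w, v} \<in> G}"
    using injective_choice[of Rf "\<lambda>v. {w\<in>X2. {w, v} \<in> G}" r] finRf nb X2(1) Rf(2) by auto
  define c where "c = (\<lambda>v. if v \<in> Rf then c2 v else c1 v)"
  interpret hub_graph m n G h1 h2 rest X c
  proof
    have Bs: "set (h1 # h2 # rest) = B" by (simp add: B_def hb)
    show "5 \<le> m" "G \<subseteq> all_pairs n" by (fact m, fact G)
    show "distinct (h1 # h2 # rest)" using bs(2) hb by simp
    show "length rest = m - 4" using bs(1) hb by simp
    show "{u, v} \<in> G" if "u \<in> set (h1 # h2 # rest)" "v \<in> set (h1 # h2 # rest)" "u \<noteq> v" for u v
      using bs(4) that unfolding hb by blast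
    show "X \<subseteq> {1..n} - set (h1 # h2 # rest)" unfolding Bs using XY by (auto simp: Y_def)
    show "2 \<le> card X" by (rule X2le)
    show "{x, h1} \<in> G \<and> {x, h2} \<in> G" if "x \<in> X" for x using XY that B by (auto simp: Y_def)
    show "c l \<in> X \<and> {l, c l} \<in> G" if "l \<in> {1..n} - set (h1 # h2 # rest) - X" for l
    proof -
      have l: "l \<in> R" using that unfolding Bs R_def .
      show ?thesis
      proof (cases "l \<in> Rf")
        case True
        then show ?thesis using c2(2) by (auto simp: c_def X_def insert_commute)
      next
        case False
        then show ?thesis using c1(1) l by (auto simp: c_def X_def)
      qed
    qed
    show "{l, l'} \<notin> G" if ll: "l \<in> {1..n} - set (h1 # h2 # rest) - X" "l' \<in> {1..n} - set (h1 # h2 # rest) - X"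
      "l \<noteq> l'" "c l = c l'" for l l'
    proof -
      have l: "l \<in> R" "l' \<in> R" using ll(1,2) unfolding Bs R_def by blast+
      have in1: "c v \<in> X1" if "v \<in> R" "v \<notin> Rf" for v using c1(1) that by (auto simp: c_def)
      have in2: "c v \<in> X2" if "v \<in> Rf" for v using c2(2) that by (auto simp: c_def)
      consider "l \<in> Rf" "l' \<in> Rf" | "l \<in> Rf" "l' \<notin> Rf" | "l \<notin> Rf" "l' \<in> Rf" | "l \<notin> Rf" "l' \<notin> Rf" by blast
      then show ?thesis
      proof cases
        case 1
        then have "c2 l = c2 l'" using ll(4) by (simp add: c_def)
        then show ?thesis using inj_onD[OF c2(1)] 1 ll(3) by blast
      next
        case 2
        then show ?thesis using in1[of l'] in2[of l] l X12 ll(4) by auto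
      next
        case 3
        then show ?thesis using in1[of l] in2[of l'] l X12 ll(4) by auto
      next
        case 4
        then have "c1 l = c1 l'" using ll(4) by (simp add: c_def)
        then show ?thesis using c1(2) 4 l ll(3) by blast
      qed
    qed
  qed
  have "card H \<le> n + n1 + j0 + m\<^sup>2" using card_H cX by linarith
  then show ?thesis using saturated by blast
qed

section \<open>The saturation number\<close>

text \<open>The growth conditions and limits for \<open>prob_no_sparse_saturated_le\<close>. In the
  last condition, \<open>4 * e\<close> pays for groups of order \<open>(2 - e) * l n\<close> instead
  of \<open>2 * l n\<close>, since 2 / (2 - e) < 1 + 2 e, and for the
  \<open>e * real n / l n\<close> reserved centres, which add \<open>2 * e\<close>.\<close>

lemma upper_bound_asymptotics:
  fixes c e \<kappa> lam b p :: real and m :: nat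
  assumes c: "0 < c" and e: "0 < e" "e < 1 / 2" and \<kappa>: "0 < \<kappa>" and lam: "0 < lam" and b: "1 < b" and p: "0 < p"
    and m: "0 < m"
  defines "l \<equiv> (\<lambda>n::nat. c * ln (real n))"
  shows "eventually (\<lambda>n. 4 \<le> l n) at_top"
    and "eventually (\<lambda>n. 1 \<le> \<kappa> * real n / l n) at_top"
    and "eventually (\<lambda>n. 1 \<le> lam * real n / (l n)\<^sup>2) at_top"
    and "eventually (\<lambda>n. 1 + 2 * real m \<le> e * real n / (2 * l n)) at_top"
    and "eventually (\<lambda>n. (l n)\<^sup>2 + 2 + real n / l n + e * real n / l n \<le> p ^ m / 2 * (real n - real m)) at_top"
    and "eventually (\<lambda>n. 2 / lam * l n ^ 3 / real n * exp ((1 - e / 2) * ln (real n) + ln b / 2) \<le> 1) at_top"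
    and "(\<lambda>n. exp (real n * ln 2 - lam\<^sup>2 * (real n)\<^sup>2 / (4608 * b\<^sup>2 * l n ^ 10))) \<longlonglongrightarrow> 0"
    and "(\<lambda>n. exp (real n * (ln 4 - p\<^sup>2 * \<kappa> * l n / 2))) \<longlonglongrightarrow> 0"
    and "(\<lambda>n. exp (real m * ln (real n) - p ^ (2 * m) * (real n - real m) / (2 * real m))) \<longlonglongrightarrow> 0"
    and "(\<lambda>n. exp (real m * ln (real n) - p ^ (2 * m) * (e * real n / (2 * l n) - real m) / (2 * real m))) \<longlonglongrightarrow> 0"
    and "eventually (\<lambda>n. (l n)\<^sup>2 + 2 + (real m)\<^sup>2 + real n / ((2 - e) * l n - 1) + e * real n / l n
            \<le> real n / (2 * l n) * (1 + 4 * e)) at_top"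
proof -
  show "eventually (\<lambda>n. 4 \<le> l n) at_top" unfolding l_def using c by real_asymp
  show "eventually (\<lambda>n. 1 \<le> \<kappa> * real n / l n) at_top" unfolding l_def using c \<kappa> by real_asymp
  show "eventually (\<lambda>n. 1 \<le> lam * real n / (l n)\<^sup>2) at_top" unfolding l_def using c lam by real_asymp
  show "eventually (\<lambda>n. 1 + 2 * real m \<le> e * real n / (2 * l n)) at_top" unfolding l_def using c e by real_asymp
  define P where "P = p ^ m / 2"
  have P: "0 < P" using p by (simp add: P_def)
  show "eventually (\<lambda>n. (l n)\<^sup>2 + 2 + real n / l n + e * real n / l n \<le> p ^ m / 2 * (real n - real m)) at_top"
    unfolding l_def P_def[symmetric] using c e P by real_asymp
  show "eventually (\<lambda>n. 2 / lam * l n ^ 3 / real n * exp ((1 - e / 2) * ln (real n) + ln b / 2) \<le> 1) at_top"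
  proof -
    have "(\<lambda>n. 2 / lam * c ^ 3 * exp (ln b / 2) * (ln (real n) ^ 3 * exp (- e / 2 * ln (real n)))) \<longlonglongrightarrow>
      2 / lam * c ^ 3 * exp (ln b / 2) * 0"
      by (intro tendsto_mult tendsto_const) (use e in real_asymp)
    then have "eventually (\<lambda>n. 2 / lam * c ^ 3 * exp (ln b / 2) * (ln (real n) ^ 3 * exp (- e / 2 * ln (real n))) < 1) at_top"
      by (intro order_tendstoD(2)) auto
    then show ?thesis using eventually_gt_at_top[of 0]
    proof eventually_elim
      case (elim n)
      have "exp ((1 - e / 2) * ln (real n) + ln b / 2) = real n * exp (- e / 2 * ln (real n)) * exp (ln b / 2)"
      proof -
        have "exp ((1 - e / 2) * ln (real n) + ln b / 2) = exp (ln (real n) + (- e / 2 * ln (real n)) + ln b / 2)"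
          by (simp add: algebra_simps)
        also have "\<dots> = real n * exp (- e / 2 * ln (real n)) * exp (ln b / 2)"
          using elim by (simp only: exp_add) simp
        finally show ?thesis .
      qed
      then have "2 / lam * l n ^ 3 / real n * exp ((1 - e / 2) * ln (real n) + ln b / 2)
         = 2 / lam * c ^ 3 * exp (ln b / 2) * (ln (real n) ^ 3 * exp (- e / 2 * ln (real n)))"
        using elim by (simp add: l_def power_mult_distrib)
      then show ?case using elim by linarith
    qed
  qed
  define Q where "Q = lam\<^sup>2 / (4608 * b\<^sup>2 * c ^ 10)"
  have Q: "0 < Q" using lam b c by (simp add: Q_def)
  have "(\<lambda>n. exp (real n * ln 2 - Q * ((real n)\<^sup>2 / ln (real n) ^ 10))) \<longlonglongrightarrow> 0" using Q by real_asymp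
  moreover have "lam\<^sup>2 * (real n)\<^sup>2 / (4608 * b\<^sup>2 * l n ^ 10) = Q * ((real n)\<^sup>2 / ln (real n) ^ 10)" for n
    by (simp add: Q_def l_def power_mult_distrib)
  ultimately show "(\<lambda>n. exp (real n * ln 2 - lam\<^sup>2 * (real n)\<^sup>2 / (4608 * b\<^sup>2 * l n ^ 10))) \<longlonglongrightarrow> 0" by simp
  define Q' where "Q' = p\<^sup>2 * \<kappa> / 2"
  have Q': "0 < Q'" using p \<kappa> by (simp add: Q'_def)
  have "(\<lambda>n. exp (real n * (ln 4 - Q' * (c * ln (real n))))) \<longlonglongrightarrow> 0" using Q' c by real_asymp
  moreover have "p\<^sup>2 * \<kappa> * l n / 2 = Q' * (c * ln (real n))" for n by (simp add: Q'_def l_def)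
  ultimately show "(\<lambda>n. exp (real n * (ln 4 - p\<^sup>2 * \<kappa> * l n / 2))) \<longlonglongrightarrow> 0" by simp
  define Z where "Z = p ^ (2 * m) / (2 * real m)"
  have Z: "0 < Z" using p m by (simp add: Z_def)
  define M where "M = real m"
  have "(\<lambda>n. exp (M * ln (real n) - Z * (real n - M))) \<longlonglongrightarrow> 0" using Z by real_asymp
  then show "(\<lambda>n. exp (real m * ln (real n) - p ^ (2 * m) * (real n - real m) / (2 * real m))) \<longlonglongrightarrow> 0"
    by (simp add: Z_def M_def)
  have "(\<lambda>n. exp (M * ln (real n) - Z * (e * real n / (2 * (c * ln (real n))) - M))) \<longlonglongrightarrow> 0" using Z e c by real_asymp
  then show "(\<lambda>n. exp (real m * ln (real n) - p ^ (2 * m) * (e * real n / (2 * l n) - real m) / (2 * real m))) \<longlonglongrightarrow> 0"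
    by (simp add: Z_def M_def l_def)
  have e2: "0 < 2 - e" using e by simp
  have lim: "(\<lambda>n. 2 * l n * ((l n)\<^sup>2 + 2 + M\<^sup>2) / real n + 2 / ((2 - e) - 1 / l n) + 2 * e) \<longlonglongrightarrow> 0 + 2 / ((2 - e) - 0) + 2 * e"
  proof (intro tendsto_intros)
    show "(\<lambda>n. 2 * l n * ((l n)\<^sup>2 + 2 + M\<^sup>2) / real n) \<longlonglongrightarrow> 0" unfolding l_def using c by real_asymp
    show "(\<lambda>n. 1 / l n) \<longlonglongrightarrow> 0" unfolding l_def using c by real_asymp
    show "(2 - e) - 0 \<noteq> 0" using e by simp
  qed
  have "0 + 2 / ((2 - e) - 0) + 2 * e < 1 + 4 * e"
  proof -
    have "2 < (1 + 2 * e) * (2 - e)" using e by (simp add: algebra_simps)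
    then have "2 / (2 - e) < 1 + 2 * e" using e by (simp add: field_simps)
    then show ?thesis by simp
  qed
  then have ev1: "eventually (\<lambda>n. 2 * l n * ((l n)\<^sup>2 + 2 + M\<^sup>2) / real n + 2 / ((2 - e) - 1 / l n) + 2 * e < 1 + 4 * e) at_top"
    by (rule order_tendstoD(2)[OF lim])
  have ev2: "eventually (\<lambda>n. 4 \<le> l n) at_top" unfolding l_def using c by real_asymp
  show "eventually (\<lambda>n. (l n)\<^sup>2 + 2 + (real m)\<^sup>2 + real n / ((2 - e) * l n - 1) + e * real n / l n
            \<le> real n / (2 * l n) * (1 + 4 * e)) at_top"
    using ev1 ev2 eventually_gt_at_top[of 0]
  proof eventually_elim
    case (elim n)
    define x where "x = real n"
    define y where "y = l n"
    have xy: "0 < x" "0 < y" "4 \<le> y" using elim by (auto simp: x_def y_def)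
    have "0 < (2 - e) * y - 1"
    proof -
      have "1 * 4 \<le> (2 - e) * y" using e xy by (intro mult_mono) auto
      then show ?thesis by simp
    qed
    then have d: "2 / ((2 - e) - 1 / y) = 2 * y / ((2 - e) * y - 1)"
      using xy by (simp add: field_simps)
    have "x / (2 * y) * (2 * y * (y\<^sup>2 + 2 + M\<^sup>2) / x + 2 / ((2 - e) - 1 / y) + 2 * e)
       = y\<^sup>2 + 2 + M\<^sup>2 + x / ((2 - e) * y - 1) + e * x / y"
    proof -
      define t where "t = y\<^sup>2 + 2 + M\<^sup>2"
      show ?thesis unfolding d t_def[symmetric] distrib_left using xy by (simp add: mult.commute)
    qed
    moreover have "x / (2 * y) * (2 * y * (y\<^sup>2 + 2 + M\<^sup>2) / x + 2 / ((2 - e) - 1 / y) + 2 * e)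
       \<le> x / (2 * y) * (1 + 4 * e)"
      using elim xy unfolding x_def[symmetric] y_def[symmetric] by (intro mult_left_mono) auto
    ultimately show ?case by (simp add: x_def y_def M_def)
  qed
qed

lemma prob_no_sparse_saturated_le:
  fixes p e c l x :: real and m n :: nat
  assumes p: "0 < p" "p < 1" and m: "5 \<le> m" and e: "0 < e" "e < 1 / 2"
    and c: "c = 1 / ln (1 / (1 - p))" and l: "l = c * ln x" and x: "x = real n"
    and \<kappa>: "\<kappa> = p ^ m * e / 16" and lam: "lam = p * \<kappa> / 8"
    and A1: "4 \<le> l" and A2: "1 \<le> \<kappa> * x / l" and A3: "1 \<le> lam * x / l\<^sup>2"
    and A4: "1 + 2 * real m \<le> e * x / (2 * l)"
    and A5: "l\<^sup>2 + 2 + x / l + e * x / l \<le> p ^ m / 2 * (x - real m)"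
    and A6: "2 / lam * l ^ 3 / x * exp ((1 - e / 2) * ln x + ln (1 / (1 - p)) / 2) \<le> 1"
    and A7: "l\<^sup>2 + 2 + (real m)\<^sup>2 + x / ((2 - e) * l - 1) + e * x / l \<le> x / (2 * l) * (1 + 4 * e)"
    and mn: "m < n"
  shows "measure_pmf.prob (gnp n p) {G. \<not> (\<exists>H. cycle_saturated m G H \<and> real (card H) \<le> x + x / (2 * l) * (1 + 4 * e))}
    \<le> exp (x * ln 2 - lam\<^sup>2 * x\<^sup>2 / (4608 * (1 / (1 - p))\<^sup>2 * l ^ 10)) + exp (x * (ln 4 - p\<^sup>2 * \<kappa> * l / 2))
      + exp (real m * ln x - p ^ (2 * m) * (x - real m) / (2 * real m))
      + exp (real m * ln x - p ^ (2 * m) * (e * x / (2 * l) - real m) / (2 * real m))"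
proof -
  define b where "b = 1 / (1 - p)"
  have b: "1 < b" "c * ln b = 1" "0 < ln b" using p by (auto simp: b_def c)
  have x0: "0 < x" using x mn by simp
  have l0: "0 < l" using A1 by simp
  have pm: "0 < p ^ m" using p by simp
  have \<kappa>0: "0 < \<kappa>" "0 < lam" using p e by (auto simp: \<kappa> lam)
  \<comment> \<open>The parameters: \<open>g\<close> is just below the order 2 l of the largest
    independent sets; \<open>j\<close> centres, a small share, are reserved; \<open>r\<close> is
    what \<open>j\<close> reserved centres can serve; \<open>s * r\<close> is of order x l and so
    outweighs the \<open>4 ^ n\<close> of \<open>prob_not_edge_dense\<close>; \<open>y\<close> is
    the block order for which \<open>g * y\<close> is at most the degree guaranteed into
    \<open>r\<close> vertices.\<close>
  define g where "g = nat \<lfloor>(2 - e) * l\<rfloor>"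
  define j where "j = nat \<lfloor>e * x / l\<rfloor>"
  define r where "r = nat \<lfloor>p ^ m / 4 * real j\<rfloor>"
  define s where "s = nat \<lceil>l\<^sup>2\<rceil>"
  define y where "y = nat \<lfloor>p * real r / (2 * real g)\<rfloor>"
  \<comment> \<open>\<open>n div g + 1\<close> groups of order \<open>g\<close> cover all vertices,
    and \<open>s\<close> further centres keep the greedy step possible to the end.\<close>
  define n1 where "n1 = s + n div g + 1"
  have nf: "real (nat \<lfloor>z\<rfloor>) \<le> z" "z - 1 < real (nat \<lfloor>z\<rfloor>)" if "0 \<le> z" for z :: real
    using that by linarith+
  have el: "e * l \<le> l / 2" using e l0 by (simp add: field_simps)
  have g1: "real g \<le> (2 - e) * l" "(2 - e) * l - 1 < real g"
    unfolding g_def using nf[of "(2 - e) * l"] e l0 by auto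
  have gl: "(2 - e) * l = 2 * l - e * l" "0 \<le> e * l" using e l0 by (auto simp: algebra_simps)
  have g2: "l \<le> real g" "real g \<le> 2 * l" using g1 el A1 gl by linarith+
  have g3: "4 \<le> g" using g2(1) A1 by linarith
  have j1: "real j \<le> e * x / l" "e * x / l - 1 < real j"
    unfolding j_def using nf[of "e * x / l"] e l0 x0 by auto
  have half: "e * x / l = 2 * (e * x / (2 * l))" using l0 by simp
  have j2: "e * x / (2 * l) \<le> real j" "1 + 2 * real m \<le> real j" using j1 A4 half by linarith+
  have r1: "real r \<le> p ^ m / 4 * real j" "p ^ m / 4 * real j - 1 < real r"
    unfolding r_def using nf[of "p ^ m / 4 * real j"] pm by auto
  have r2: "\<kappa> * x / l \<le> real r"
  proof -
    have "p ^ m / 4 * (e * x / (2 * l)) \<le> p ^ m / 4 * real j" using j2 pm by (intro mult_left_mono) auto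
    \<comment> \<open>The constants \<open>\<kappa>\<close> here and \<open>lam\<close> below are
      half of what the estimate gives; the other half absorbs the rounding of \<open>r\<close> and
      \<open>y\<close>.\<close>
    moreover have "p ^ m / 4 * (e * x / (2 * l)) = 2 * (\<kappa> * x / l)" by (simp add: \<kappa>)
    ultimately show ?thesis using r1 A2 by linarith
  qed
  have r3: "1 \<le> r" using r2 A2 by linarith
  have y1: "real y \<le> p * real r / (2 * real g)" "p * real r / (2 * real g) - 1 < real y"
    unfolding y_def using nf[of "p * real r / (2 * real g)"] p by auto
  have y2: "lam * x / l\<^sup>2 \<le> real y"
  proof -
    have "p * (\<kappa> * x / l) / (2 * (2 * l)) \<le> p * real r / (2 * real g)"
      using r2 g2 g3 p l0 \<kappa>0 x0 by (intro frac_le mult_left_mono) auto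
    moreover have "p * (\<kappa> * x / l) / (2 * (2 * l)) = 2 * (lam * x / l\<^sup>2)"
      by (simp add: lam power2_eq_square mult_ac)
    ultimately show ?thesis using y1 A3 by linarith
  qed
  have y3: "1 \<le> y" using y2 A3 by linarith
  have s1: "l\<^sup>2 \<le> real s" "real s \<le> l\<^sup>2 + 1" unfolding s_def using zero_le_power2[of l] by linarith+
  have s2: "1 \<le> s" using s1(1) one_le_power[of l 2] A1 by linarith
  have "real (n div g * g) \<le> real n" by (simp only: of_nat_le_iff div_times_less_eq_dividend)
  then have dg: "real (n div g) \<le> x / real g" using g3 by (simp add: x le_divide_eq)
  have n1b: "real n1 \<le> l\<^sup>2 + 2 + x / real g" unfolding n1_def using s1 dg by simp
  have mn': "m < card {1..n}" "m < card {1..j}" using mn j2 by auto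
  have jn: "j \<le> n"
  proof -
    have "e * x \<le> l * x" using e A1 x0 by (intro mult_right_mono) auto
    then have "e * x / l \<le> x" using l0 by (simp add: divide_le_eq mult.commute)
    then show ?thesis using j1 x by linarith
  qed
  \<comment> \<open>By the choice of \<open>c\<close>, \<open>b\<close> to the power (2 - e) l / 2
    is x^(1 - e/2). As \<open>y\<close> is of order x / l^2, a factor x^(e/2) is left against powers
    of \<open>l\<close>.\<close>
  have small: "real g / real y * (1 / (1 - p)) powr (real (g + 1) / 2) \<le> 1"
  proof -
    have "b powr (real (g + 1) / 2) = exp (real (g + 1) / 2 * ln b)" using b by (simp add: powr_def)
    also have "\<dots> \<le> exp ((1 - e / 2) * ln x + ln b / 2)"
    proof -
      have "real (g + 1) / 2 * ln b \<le> ((2 - e) * l + 1) / 2 * ln b"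
        using g1 b by (intro mult_right_mono) auto
      also have "\<dots> = (1 - e / 2) * (c * ln b) * ln x + ln b / 2" by (simp add: l field_simps)
      also have "\<dots> = (1 - e / 2) * ln x + ln b / 2" by (simp add: b)
      finally show ?thesis by simp
    qed
    finally have p1: "b powr (real (g + 1) / 2) \<le> exp ((1 - e / 2) * ln x + ln b / 2)" .
    have "real g / real y \<le> (2 * l) / (lam * x / l\<^sup>2)"
      using g2 y2 l0 \<kappa>0 x0 by (intro frac_le) auto
    also have "\<dots> = 2 / lam * l ^ 3 / x" by (simp add: power2_eq_square power3_eq_cube)
    finally have p2: "real g / real y \<le> 2 / lam * l ^ 3 / x" .
    have "real g / real y * b powr (real (g + 1) / 2) \<le> 2 / lam * l ^ 3 / x * exp ((1 - e / 2) * ln x + ln b / 2)"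
      using p1 p2 l0 \<kappa>0 x0 by (intro mult_mono) auto
    also have "\<dots> \<le> 1" using A6 by (simp add: b_def)
    finally show ?thesis by (simp add: b_def)
  qed
  define B1 where "B1 = {G. \<not> has_indep n g y G}"
  define B2 where "B2 = {G. \<not> edge_dense n s r p G}"
  define B3 where "B3 = {G. \<not> common_nbrs n m p {1..n} G}"
  define B4 where "B4 = {G. \<not> common_nbrs n m p {1..j} G}"
  have "measure_pmf.prob (gnp n p) {G. \<not> (\<exists>H. cycle_saturated m G H \<and> real (card H) \<le> x + x / (2 * l) * (1 + 4 * e))}
     \<le> measure_pmf.prob (gnp n p) (B1 \<union> B2 \<union> B3 \<union> B4)"
  proof (rule measure_pmf.finite_measure_mono_AE)
    show "AE G in measure_pmf (gnp n p). G \<in> {G. \<not> (\<exists>H. cycle_saturated m G H \<and> real (card H) \<le> x + x / (2 * l) * (1 + 4 * e))}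
      \<longrightarrow> G \<in> B1 \<union> B2 \<union> B3 \<union> B4"
    proof (unfold AE_measure_pmf_iff, intro ballI impI, rule ccontr)
      fix G assume G: "G \<in> set_pmf (gnp n p)"
        "G \<in> {G. \<not> (\<exists>H. cycle_saturated m G H \<and> real (card H) \<le> x + x / (2 * l) * (1 + 4 * e))}"
        "G \<notin> B1 \<union> B2 \<union> B3 \<union> B4"
      have Gs: "G \<subseteq> all_pairs n" using G(1) set_pmf_random_subset_subset unfolding gnp_eq_random_subset by blast
      have "\<exists>H. cycle_saturated m G H \<and> card H \<le> n + n1 + j + m\<^sup>2"
      proof (rule saturated_exists[where p = p and s = s and r = r and g = g and y = y])
        show "common_nbrs n m p {1..n} G" "common_nbrs n m p {1..j} G" "edge_dense n s r p G" "has_indep n g y G"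
          using G(3) by (auto simp: B1_def B2_def B3_def B4_def)
        have "real g * real y \<le> real g * (p * real r / (2 * real g))" using y1 by (intro mult_left_mono) auto
        also have "\<dots> = p / 2 * real r" using g3 by simp
        finally show "real (g * y) \<le> p / 2 * real r" by simp
        have "p ^ m / 4 * real j \<le> p ^ m / 4 * (2 * (real j - real m))" using j2 pm by (intro mult_left_mono) auto
        also have "\<dots> = p ^ m / 2 * (real j - real m)" by simp
        finally show "real r \<le> p ^ m / 2 * (real j - real m)" using r1 by linarith
        have "x / real g \<le> x / l" using g2 l0 x0 by (intro divide_left_mono) auto
        then have "real (n1 + j) \<le> l\<^sup>2 + 2 + x / l + e * x / l" using n1b j1 by simp
        then show "real (n1 + j) \<le> p ^ m / 2 * (real n - real m)" using A5 unfolding x[symmetric] by linarith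
        show "2 \<le> n1" using s2 by (simp add: n1_def)
        have "n \<le> g * (n div g) + g" using mod_less_divisor[of g n] g3 mult_div_mod_eq[of g n] by linarith
        then show "g * s + n \<le> g * n1" by (simp add: n1_def distrib_left)
        show "1 \<le> g" using g3 by simp
      qed (use p m Gs mn jn r3 in auto)
      then obtain H where H: "cycle_saturated m G H" "card H \<le> n + n1 + j + m\<^sup>2" by blast
      have "real (card H) \<le> real (n + n1 + j + m\<^sup>2)" using H(2) by (simp only: of_nat_le_iff)
      also have "\<dots> = x + (real n1 + real j + (real m)\<^sup>2)" by (simp add: x)
      also have "x / real g \<le> x / ((2 - e) * l - 1)"
        using g1 x0 g2 A1 el g3 gl by (intro divide_left_mono mult_pos_pos) linarith+
      then have "real n1 + real j + (real m)\<^sup>2 \<le> x / (2 * l) * (1 + 4 * e)" using n1b j1 A7 by linarith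
      finally show False using G(2) H(1) by auto
    qed
  qed auto
  also have "\<dots> \<le> measure_pmf.prob (gnp n p) B1 + measure_pmf.prob (gnp n p) B2 + measure_pmf.prob (gnp n p) B3
       + measure_pmf.prob (gnp n p) B4"
    by (intro order_trans[OF measure_Un_le] add_mono) auto
  also have "measure_pmf.prob (gnp n p) B1 \<le> exp (x * ln 2 - lam\<^sup>2 * x\<^sup>2 / (4608 * (1 / (1 - p))\<^sup>2 * l ^ 10))"
  proof -
    have "measure_pmf.prob (gnp n p) B1 \<le> 2 ^ n * exp (- ((real y)\<^sup>2 / (72 * b\<^sup>2 * real g ^ 6)))"
      unfolding B1_def b_def using p g3 y3 small by (intro prob_not_has_indep) auto
    also have "2 ^ n = exp (x * ln 2)" by (simp add: x exp_of_nat_mult)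
    also have "exp (x * ln 2) * exp (- ((real y)\<^sup>2 / (72 * b\<^sup>2 * real g ^ 6))) = exp (x * ln 2 - (real y)\<^sup>2 / (72 * b\<^sup>2 * real g ^ 6))"
      by (simp add: exp_add[symmetric])
    also have "\<dots> \<le> exp (x * ln 2 - lam\<^sup>2 * x\<^sup>2 / (4608 * b\<^sup>2 * l ^ 10))"
    proof -
      \<comment> \<open>Inserting the lower bound for \<open>y\<close> and
        \<open>g \<le> 2 * l\<close> gives 4608 = 72 * 2^6 and the exponent 10 = 4 + 6.\<close>
      have "(lam * x / l\<^sup>2)\<^sup>2 / (72 * b\<^sup>2 * (2 * l) ^ 6) \<le> (real y)\<^sup>2 / (72 * b\<^sup>2 * real g ^ 6)"
        using y2 g2 g3 l0 \<kappa>0 x0 b by (intro frac_le mult_left_mono power_mono) auto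
      moreover have "(lam * x / l\<^sup>2)\<^sup>2 / (72 * b\<^sup>2 * (2 * l) ^ 6) = lam\<^sup>2 * x\<^sup>2 / (4608 * b\<^sup>2 * l ^ 10)"
        using l0 by (simp add: power_mult_distrib power_divide power_mult[symmetric] field_simps power_add[symmetric])
      ultimately show ?thesis by simp
    qed
    finally show ?thesis by (simp add: b_def)
  qed
  also have "measure_pmf.prob (gnp n p) B2 \<le> exp (x * (ln 4 - p\<^sup>2 * \<kappa> * l / 2))"
  proof -
    have "measure_pmf.prob (gnp n p) B2 \<le> 4 ^ n * exp (- (p\<^sup>2 * real s * real r / 2))"
      unfolding B2_def using p s2 r3 by (intro prob_not_edge_dense) auto
    also have "4 ^ n = exp (x * ln 4)" by (simp add: x exp_of_nat_mult)
    also have "exp (x * ln 4) * exp (- (p\<^sup>2 * real s * real r / 2)) = exp (x * ln 4 - p\<^sup>2 * real s * real r / 2)"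
      by (simp add: exp_add[symmetric])
    also have "\<dots> \<le> exp (x * (ln 4 - p\<^sup>2 * \<kappa> * l / 2))"
    proof -
      have "p\<^sup>2 * l\<^sup>2 * (\<kappa> * x / l) / 2 \<le> p\<^sup>2 * real s * real r / 2"
        using s1 r2 \<kappa>0 x0 l0 by (intro divide_right_mono mult_mono) auto
      moreover have "p\<^sup>2 * l\<^sup>2 * (\<kappa> * x / l) / 2 = x * (p\<^sup>2 * \<kappa> * l / 2)"
        using l0 by (simp add: power2_eq_square)
      ultimately show ?thesis by (simp add: algebra_simps)
    qed
    finally show ?thesis .
  qed
  also have "measure_pmf.prob (gnp n p) B3 \<le> exp (real m * ln x - p ^ (2 * m) * (x - real m) / (2 * real m))"
  proof -
    have "measure_pmf.prob (gnp n p) B3 \<le> real n ^ m * exp (- (p ^ (2 * m) * (real (card {1..n}) - real m) / (2 * real m)))"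
      unfolding B3_def using p m mn' by (intro prob_not_common_nbrs) auto
    also have "real n ^ m = exp (real m * ln x)" using x0 by (simp add: x exp_of_nat_mult)
    finally show ?thesis by (simp add: x exp_add[symmetric])
  qed
  also have "measure_pmf.prob (gnp n p) B4 \<le> exp (real m * ln x - p ^ (2 * m) * (e * x / (2 * l) - real m) / (2 * real m))"
  proof -
    have "measure_pmf.prob (gnp n p) B4 \<le> real n ^ m * exp (- (p ^ (2 * m) * (real (card {1..j}) - real m) / (2 * real m)))"
      unfolding B4_def using p m mn' jn by (intro prob_not_common_nbrs) auto
    also have "real n ^ m = exp (real m * ln x)" using x0 by (simp add: x exp_of_nat_mult)
    also have "exp (real m * ln x) * exp (- (p ^ (2 * m) * (real (card {1..j}) - real m) / (2 * real m)))
       = exp (real m * ln x - p ^ (2 * m) * (real j - real m) / (2 * real m))" by (simp add: exp_add[symmetric])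
    also have "\<dots> \<le> exp (real m * ln x - p ^ (2 * m) * (e * x / (2 * l) - real m) / (2 * real m))"
    proof -
      have "p ^ (2 * m) * (e * x / (2 * l) - real m) / (2 * real m) \<le> p ^ (2 * m) * (real j - real m) / (2 * real m)"
        using j2 p by (intro divide_right_mono mult_left_mono) auto
      then show ?thesis by simp
    qed
    finally show ?thesis .
  qed
  finally show ?thesis by simp
qed

lemma no_sparse_saturated_rare:
  fixes p e :: real and m :: nat
  assumes p: "0 < p" "p < 1" and m: "5 \<le> m" and e: "0 < e" "e < 1 / 2"
  shows "(\<lambda>n. measure_pmf.prob (gnp n p) {G. \<not> (\<exists>H. cycle_saturated m G H \<and>
     real (card H) \<le> real n + real n / (2 * log (1 / (1 - p)) (real n)) * (1 + 4 * e))}) \<longlonglongrightarrow> 0"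
proof -
  define c where "c = 1 / ln (1 / (1 - p))"
  have c: "0 < c" using p by (simp add: c_def)
  have L: "log (1 / (1 - p)) (real n) = c * ln (real n)" for n by (simp add: log_def c_def)
  define \<kappa> where "\<kappa> = p ^ m * e / 16"
  define lam where "lam = p * \<kappa> / 8"
  have \<kappa>: "0 < \<kappa>" using p e by (simp add: \<kappa>_def)
  then have lam: "0 < lam" using p by (simp add: lam_def)
  have b: "1 < 1 / (1 - p)" using p by simp
  have m0: "0 < m" using m by simp
  note A = upper_bound_asymptotics[OF c e \<kappa> lam b p(1) m0]
  define ub where "ub = (\<lambda>n::nat. exp (real n * ln 2 - lam\<^sup>2 * (real n)\<^sup>2 / (4608 * (1 / (1 - p))\<^sup>2 * (c * ln (real n)) ^ 10))
      + exp (real n * (ln 4 - p\<^sup>2 * \<kappa> * (c * ln (real n)) / 2))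
      + exp (real m * ln (real n) - p ^ (2 * m) * (real n - real m) / (2 * real m))
      + exp (real m * ln (real n) - p ^ (2 * m) * (e * real n / (2 * (c * ln (real n))) - real m) / (2 * real m)))"
  have bound: "eventually (\<lambda>n. measure_pmf.prob (gnp n p) {G. \<not> (\<exists>H. cycle_saturated m G H \<and>
     real (card H) \<le> real n + real n / (2 * (c * ln (real n))) * (1 + 4 * e))} \<le> ub n) at_top"
    using A(1,2,3,4,5,6,11) eventually_gt_at_top[of m]
  proof eventually_elim
    case (elim n)
    then show ?case unfolding ub_def
      by (intro prob_no_sparse_saturated_le[OF p m e c_def refl refl \<kappa>_def lam_def])
  qed
  have "ub \<longlonglongrightarrow> 0 + 0 + 0 + 0"
    unfolding ub_def by (intro tendsto_add A(7,8,9,10))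
  then have ub0: "ub \<longlonglongrightarrow> 0" by simp
  show ?thesis unfolding L
    by (rule tendsto_sandwich[OF _ bound tendsto_const ub0]) simp
qed

text \<open>Convergence for every fixed error becomes convergence with a vanishing error: the error
  is lowered to \<open>d k\<close> only after \<open>n\<close> has passed a threshold
  \<open>N k\<close> beyond which \<open>Q (d k) n\<close> is within \<open>d k\<close> of its
  limit.\<close>

lemma diagonal_rate:
  fixes Q :: "real \<Rightarrow> nat \<Rightarrow> real"
  assumes "\<And>e. 0 < e \<Longrightarrow> e < 1 / 2 \<Longrightarrow> Q e \<longlonglongrightarrow> 1"
  shows "\<exists>\<delta>. \<delta> \<longlonglongrightarrow> 0 \<and> (\<lambda>n. Q (\<delta> n) n) \<longlonglongrightarrow> 1"
proof -
  define d where "d = (\<lambda>k::nat. 1 / (real k + 3))"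
  have d0: "0 < d k" "d k < 1 / 2" for k by (auto simp: d_def field_simps)
  have "\<exists>N. \<forall>n\<ge>N. \<bar>Q (d k) n - 1\<bar> < d k" for k
    using LIMSEQ_D[OF assms[OF d0(1,2)] d0(1), of k k] by auto
  then obtain N where N: "\<And>k n. N k \<le> n \<Longrightarrow> \<bar>Q (d k) n - 1\<bar> < d k" by metis
  \<comment> \<open>The default \<open>k = 0\<close> keeps the set nonempty for small
    \<open>n\<close>; the bound \<open>k \<le> n\<close> keeps it finite.\<close>
  define A where "A = (\<lambda>n. {k. k = 0 \<or> (k \<le> n \<and> N k \<le> n)})"
  define K where "K = (\<lambda>n. Max (A n))"
  have finA: "finite (A n)" for n by (rule finite_subset[of _ "{..n}"]) (auto simp: A_def)
  have KA: "K n \<in> A n" for n unfolding K_def using finA by (intro Max_in) (auto simp: A_def)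
  have Kge: "k \<le> K n" if "k \<le> n" "N k \<le> n" for k n
    unfolding K_def using finA that by (intro Max_ge) (auto simp: A_def)
  have dmono: "d k \<le> d k'" if "k' \<le> k" for k k' using that by (auto simp: d_def intro!: divide_left_mono)
  have dlim: "d \<longlonglongrightarrow> 0" unfolding d_def by real_asymp
  have ex: "\<exists>n0. \<forall>n\<ge>n0. d (K n) < \<eta> \<and> \<bar>Q (d (K n)) n - 1\<bar> < \<eta>" if eta: "0 < \<eta>" for \<eta>
  proof -
    obtain k0 where "\<And>k. k0 \<le> k \<Longrightarrow> d k < \<eta>"
      using order_tendstoD(2)[OF dlim eta] by (auto simp: eventually_at_top_linorder)
    then obtain k where k: "d (Suc k) < \<eta>" by (meson le_SucI order_refl)
    have "d (K n) < \<eta> \<and> \<bar>Q (d (K n)) n - 1\<bar> < \<eta>" if n: "max (Suc k) (N (Suc k)) \<le> n" for n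
    proof -
      \<comment> \<open>Working with \<open>Suc k\<close> makes \<open>K n\<close> positive, so that
        its membership in \<open>A n\<close> is not due to the default and its threshold has really
        been passed.\<close>
      have K: "Suc k \<le> K n" using Kge[of "Suc k" n] n by auto
      then have "N (K n) \<le> n" using KA[of n] by (auto simp: A_def)
      then show ?thesis using N[of "K n" n] dmono[OF K] k by linarith
    qed
    then show ?thesis by blast
  qed
  have "(\<lambda>n. d (K n)) \<longlonglongrightarrow> 0"
  proof (rule LIMSEQ_I)
    fix \<eta> :: real assume "0 < \<eta>"
    from ex[OF this] obtain n0 where "\<forall>n\<ge>n0. d (K n) < \<eta>" by blast
    moreover have "norm (d (K n) - 0) = d (K n)" for n using d0(1)[of "K n"] by simp
    ultimately show "\<exists>n0. \<forall>n\<ge>n0. norm (d (K n) - 0) < \<eta>" by metis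
  qed
  moreover have "(\<lambda>n. Q (d (K n)) n) \<longlonglongrightarrow> 1"
  proof (rule LIMSEQ_I)
    fix \<eta> :: real assume "0 < \<eta>"
    from ex[OF this] show "\<exists>n0. \<forall>n\<ge>n0. norm (Q (d (K n)) n - 1) < \<eta>"
      unfolding real_norm_def by blast
  qed
  ultimately show ?thesis by blast
qed

text \<open>Outside \<open>B1\<close> every saturated graph is large, outside \<open>B2\<close> some
  saturated graph is small. The latter also shows that a saturated graph exists, so that the
  \<open>Min\<close> in \<open>sat_cycle\<close> is attained.\<close>

lemma sat_cycle_bounds_whp:
  fixes p e :: real and m :: nat
  assumes p: "0 < p" "p < 1" and m: "5 \<le> m" and e: "0 < e" "e < 1 / 2"
  shows "(\<lambda>n. measure_pmf.prob (gnp n p)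
        {G. real n + real n / (4 * (real m - 1) * log (1 / (1 - p)) (real n)) * (1 - e)
              \<le> real (sat_cycle G m) \<and>
            real (sat_cycle G m)
              \<le> real n + real n / (2 * log (1 / (1 - p)) (real n)) * (1 + 4 * e)}) \<longlonglongrightarrow> 1"
proof -
  define L where "L = (\<lambda>n::nat. log (1 / (1 - p)) (real n))"
  define B1 where "B1 = (\<lambda>n. {G. \<exists>H. cycle_saturated m G H \<and>
     real (card H) \<le> real n + (1 - e) * real n / (4 * (real m - 1) * L n)})"
  define B2 where "B2 = (\<lambda>n. {G. \<not> (\<exists>H. cycle_saturated m G H \<and>
     real (card H) \<le> real n + real n / (2 * L n) * (1 + 4 * e))})"
  define S where "S = (\<lambda>n. {G. real n + real n / (4 * (real m - 1) * L n) * (1 - e) \<le> real (sat_cycle G m) \<and>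
            real (sat_cycle G m) \<le> real n + real n / (2 * L n) * (1 + 4 * e)})"
  have lower: "1 - (measure_pmf.prob (gnp n p) (B1 n) + measure_pmf.prob (gnp n p) (B2 n))
      \<le> measure_pmf.prob (gnp n p) (S n)" for n
  proof -
    have "measure_pmf.prob (gnp n p) (- (B1 n \<union> B2 n)) \<le> measure_pmf.prob (gnp n p) (S n)"
    proof (rule measure_pmf.finite_measure_mono_AE)
      show "AE G in measure_pmf (gnp n p). G \<in> - (B1 n \<union> B2 n) \<longrightarrow> G \<in> S n"
      proof (unfold AE_measure_pmf_iff, intro ballI impI)
        fix G assume G: "G \<in> set_pmf (gnp n p)" "G \<in> - (B1 n \<union> B2 n)"
        have Gs: "G \<subseteq> all_pairs n" using G(1) set_pmf_random_subset_subset unfolding gnp_eq_random_subset by blast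
        then have finG: "finite G" using finite_subset finite_all_pairs by blast
        define C where "C = {H. cycle_saturated m G H}"
        have finC: "finite C"
          by (rule finite_subset[of _ "Pow G"]) (use finG in \<open>auto simp: C_def cycle_saturated_def\<close>)
        obtain H where H: "H \<in> C" "real (card H) \<le> real n + real n / (2 * L n) * (1 + 4 * e)"
          using G(2) by (auto simp: B2_def C_def)
        have sc: "sat_cycle G m = Min (card ` C)" by (simp add: sat_cycle_def C_def)
        have "sat_cycle G m \<le> card H" unfolding sc using finC H(1) by (intro Min_le) auto
        then have up: "real (sat_cycle G m) \<le> real n + real n / (2 * L n) * (1 + 4 * e)" using H(2) by linarith
        have "sat_cycle G m \<in> card ` C" unfolding sc using finC H(1) by (intro Min_in) auto
        then obtain H' where H': "H' \<in> C" "sat_cycle G m = card H'" by auto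
        have "\<not> real (card H') \<le> real n + (1 - e) * real n / (4 * (real m - 1) * L n)"
          using G(2) H'(1) by (auto simp: B1_def C_def)
        then have "real n + real n / (4 * (real m - 1) * L n) * (1 - e) \<le> real (sat_cycle G m)"
          unfolding H'(2) by (simp add: mult.commute)
        then show "G \<in> S n" using up by (simp add: S_def)
      qed
    qed auto
    moreover have "measure_pmf.prob (gnp n p) (- (B1 n \<union> B2 n)) = 1 - measure_pmf.prob (gnp n p) (B1 n \<union> B2 n)"
      using measure_pmf.prob_compl[of "B1 n \<union> B2 n" "gnp n p"] by (simp add: Compl_eq_Diff_UNIV)
    moreover have "measure_pmf.prob (gnp n p) (B1 n \<union> B2 n) \<le> measure_pmf.prob (gnp n p) (B1 n) + measure_pmf.prob (gnp n p) (B2 n)"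
      by (rule measure_Un_le) auto
    ultimately show ?thesis by linarith
  qed
  have lim1: "(\<lambda>n. measure_pmf.prob (gnp n p) (B1 n)) \<longlonglongrightarrow> 0"
    unfolding B1_def L_def using sparse_saturated_rare[OF p m e(1)] e(2) by simp
  have lim2: "(\<lambda>n. measure_pmf.prob (gnp n p) (B2 n)) \<longlonglongrightarrow> 0"
    unfolding B2_def L_def by (rule no_sparse_saturated_rare[OF p m e])
  have lim: "(\<lambda>n. 1 - (measure_pmf.prob (gnp n p) (B1 n) + measure_pmf.prob (gnp n p) (B2 n))) \<longlonglongrightarrow> 1 - (0 + 0)"
    by (intro tendsto_diff tendsto_add tendsto_const lim1 lim2)
  have "(\<lambda>n. measure_pmf.prob (gnp n p) (S n)) \<longlonglongrightarrow> 1"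
  proof (rule tendsto_sandwich)
    show "(\<lambda>n. 1 - (measure_pmf.prob (gnp n p) (B1 n) + measure_pmf.prob (gnp n p) (B2 n))) \<longlonglongrightarrow> 1" using lim by simp
    show "(\<lambda>n. 1 :: real) \<longlonglongrightarrow> 1" by simp
  qed (use lower in auto)
  then show ?thesis unfolding S_def L_def .
qed

theorem theorem1:
  fixes p :: real and m :: nat
  assumes "0 < p" and "p < 1" and "m \<ge> 5"
  shows "\<exists>\<epsilon>1 \<epsilon>2 :: nat \<Rightarrow> real. \<epsilon>1 \<longlonglongrightarrow> 0 \<and> \<epsilon>2 \<longlonglongrightarrow> 0 \<and>
    (\<lambda>n. measure_pmf.prob (gnp n p)
        {G. real n + real n / (4 * (real m - 1) * log (1 / (1 - p)) (real n)) * (1 - \<epsilon>1 n)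
              \<le> real (sat_cycle G m) \<and>
            real (sat_cycle G m)
              \<le> real n + real n / (2 * log (1 / (1 - p)) (real n)) * (1 + \<epsilon>2 n)})
    \<longlonglongrightarrow> 1"
proof -
  define Q where "Q = (\<lambda>e n. measure_pmf.prob (gnp n p)
        {G. real n + real n / (4 * (real m - 1) * log (1 / (1 - p)) (real n)) * (1 - e)
              \<le> real (sat_cycle G m) \<and>
            real (sat_cycle G m)
              \<le> real n + real n / (2 * log (1 / (1 - p)) (real n)) * (1 + 4 * e)})"
  have "Q e \<longlonglongrightarrow> 1" if "0 < e" "e < 1 / 2" for e
    unfolding Q_def using sat_cycle_bounds_whp[OF assms that] .
  then obtain \<delta> where \<delta>: "\<delta> \<longlonglongrightarrow> 0" "(\<lambda>n. Q (\<delta> n) n) \<longlonglongrightarrow> 1"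
    using diagonal_rate[of Q] by blast
  have "(\<lambda>n. 4 * \<delta> n) \<longlonglongrightarrow> 0" using tendsto_mult_right_zero[OF \<delta>(1)] by simp
  then show ?thesis using \<delta> unfolding Q_def
    by (intro exI[of _ \<delta>] exI[of _ "\<lambda>n. 4 * \<delta> n"]) simp
qed

end
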